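(* Let $m,n\ge 0$ be integers with $m+n\ge 1$. For every integer $k\ge 0$ and every permutation $\sigma\in S_k$, \[ w_{\mathfrak{gl}(m|n)}(\sigma)=\Phi_{m|n}\bigl(w_{\mathfrak{gl}}(\sigma)\bigr), \] where $\Phi_{m|n}:\mathbb{C}[C_0,C_1,C_2,\dots]\to ZU(\mathfrak{gl}(m|n))$ is the algebra homomorphism sending $C_0\mapsto (m-n)\cdot 1$ and $C_j\mapsto C_j^{(m|n)}$ for $j\ge 1$. In words: the $\mathfrak{gl}(m|n)$-weight system on permutations is obtained from the universal $\mathfrak{gl}$-weight system by substituting $m-n$ for $C_0$ and the $j$-th Casimir element of $\mathfrak{gl}(m|n)$ for $C_j$, $j>0$.
   Context: The Lie superalgebra $\mathfrak{gl}(m|n)$ (over $\mathbb{C}$) has basis the matrix units $E_{ij}$, $1\le i,j\le m+n$. Put $\bar i=0$ if $i\le m$ and $\bar i=1$ if $i>m$; $E_{ij}$ has parity $\bar i+\bar j\in\mathbb{Z}_2$. The bracket is $[E_{ij},E_{kl}]=\delta_{jk}E_{il}-(-1)^{(\bar i+\bar j)(\bar k+\bar l)}\delta_{il}E_{kj}$. $U(\mathfrak{gl}(m|n))$ is the universal enveloping algebra, i.e. the tensor algebra modulo the relations $xy-(-1)^{|x||y|}yx=[x,y]$ for homogeneous $x,y$, and $ZU(\mathfrak{gl}(m|n))$ its center. The Casimir elements are $C_j^{(m|n)}=\sum_{i_1,\dots,i_j=1}^{m+n}(-1)^{\bar i_2+\cdots+\bar i_j}E_{i_1i_2}E_{i_2i_3}\cdots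 E_{i_{j-1}i_j}E_{i_ji_1}$ for $j\ge1$; they are central. Digraph and sign function. To $\sigma\in S_k$ associate the digraph with vertices $1,\dots,k$ placed in increasing order on a horizontal line and edges $x\to\sigma(x)$. For the edge $x\to y$ consider the shifted endpoints $x+\tfrac13$ and $y-\tfrac13$. The edge is distinguished if $x<y$. Two distinct edges form a distinguished pair if their shifted endpoint pairs alternate on the line (exactly one shifted endpoint of one edge lies strictly between the two shifted endpoints of the other). For a labelling $i:\{\text{edges}\}\to\{1,\dots,m+n\}$, set $f_\sigma=\sum_{e\text{ distinguished}}\bar i_e+\sum_{\{e,e'\}\text{ distinguished pair}}\bar i_e\bar i_{e'}\in\mathbb{Z}_2$. Define \[ w_{\mathfrak{gl}(m|n)}(\sigma)=\sum_{i}(-1)^{f_\sigma}E_{i_{\mathrm{in}(1)}i_{\mathrm{out}(1)}}E_{i_{\mathrm{in}(2)}i_{\mathrm{out}(2)}}\cdots E_{i_{\mathrm{in}(k)}i_{\mathrm{out}(k)}}\in U(\mathfrak{gl}(m|n)), \] where $\mathrm{in}(v)$ and $\mathrm{out}(v)$ are the edges entering and leaving vertex $v$, and the sum is over all labellings. Equivalently, labelling the edge $\sigma^{-1}(j)\to j$ by $i_j$, this is $\sum_{i_1,\dots,i_k}(-1)^{f_\sigma}E_{i_1i_{\sigma(1)}}\cdots E_{i_ki_{\sigma(k)}}$. For $k=0$ the value is $1$. Universal $\mathfrak{gl}$-weight system. $w_{\mathfrak{gl}}$ is the function on permutations (all $k\ge0$) with values in the polynomial ring $\mathbb{C}[C_0,C_1,C_2,\dots]$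 uniquely determined by the following rules. (i) $w_{\mathfrak{gl}}$ of the empty permutation ($k=0$) is $1$. (ii) Multiplicativity under concatenation: if $\sigma\in S_k$ and $\rho\in S_j$, and $\sigma\sqcup\rho\in S_{k+j}$ acts as $\sigma$ on $\{1,\dots,k\}$ and as $x\mapsto k+\rho(x-k)$ on $\{k+1,\dots,k+j\}$, then $w_{\mathfrak{gl}}(\sigma\sqcup\rho)=w_{\mathfrak{gl}}(\sigma)w_{\mathfrak{gl}}(\rho)$. (iii) For the cycle $1\mapsto2\mapsto\cdots\mapsto k\mapsto1$ the value is $C_k$. (iv) Recurrence. Let $\sigma\in S_k$ and $1\le l<k$, put $\tau=(l\ l{+}1)$ and $\sigma'=\tau\sigma\tau$. For a permutation $\pi$ of $\{1,\dots,k\}$ with $\pi(l+1)\ne l+1$, let $D(\pi)\in S_{k-1}$ be obtained from the permutation of $\{1,\dots,k\}\setminus\{l+1\}$ given by $x\mapsto\pi(x)$ if $\pi(x)\ne l+1$ and $x\mapsto\pi(l+1)$ if $\pi(x)=l+1$, by relabelling $x\mapsto x-1$ for $x>l+1$. - If $\sigma(l)\ne l+1$ and $\sigma(l+1)\ne l$, then $w_{\mathfrak{gl}}(\sigma)-w_{\mathfrak{gl}}(\sigma')=w_{\mathfrak{gl}}(D(\sigma\tau))-w_{\mathfrak{gl}}(D(\sigma'\tau))$. Pictorially: $D(\sigma\tau)$ merges $l,l+1$ into a single vertex, joins the edge entering $l+1$ with the edge leaving $l$ into one edge, and makes the edge entering $l$ and the edge leaving $l+1$ the incoming and outgoing edges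 of the merged vertex. - If $\sigma(l+1)=l$ and $\sigma(l)\ne l+1$, write $a=\sigma^{-1}(l+1)$ and $b=\sigma(l)$. Let $\rho\in S_{k-2}$ be obtained by deleting $l,l+1$ and setting $a\mapsto b$, and let $\rho'\in S_{k-1}$ be obtained by replacing $l,l+1$ with one vertex $l'$ with $a\mapsto l'\mapsto b$ (after order-preserving relabelling). Then $w_{\mathfrak{gl}}(\sigma)-w_{\mathfrak{gl}}(\sigma')=C_1\,w_{\mathfrak{gl}}(\rho)-C_0\,w_{\mathfrak{gl}}(\rho')$. *)

theory Defs
  imports
    Complex_Main
    "HOL-Library.FuncSet"
    "HOL-Library.Poly_Mapping"
    "HOL-Combinatorics.Transposition"
    "HOL-Combinatorics.Permutations"
    "HOL-Algebra.QuotRing"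
begin

section \<open>Rings from type classes, centers\<close>

definition class_ring :: "'a::ring_1 ring"
  where "class_ring = \<lparr>carrier = UNIV, mult = (*), one = 1, zero = 0, add = (+)\<rparr>"

definition center_ring :: "'a ring \<Rightarrow> 'a ring"
  where "center_ring R =
    R\<lparr>carrier := {z \<in> carrier R. \<forall>x\<in>carrier R. z \<otimes>\<^bsub>R\<^esub> x = x \<otimes>\<^bsub>R\<^esub> z}\<rparr>"


section \<open>Tensor algebras\<close>

text \<open>
  Words form a monoid, written additively, with concatenation as addition. With the convolution
  product of \<^theory>\<open>HOL-Library.Poly_Mapping\<close>, finitely supported functions from words
  to the complex numbers are then the noncommutative polynomials, that is, the tensor
  algebra of the vector space with basis \<^typ>\<open>'a\<close>.
\<close>

datatype 'a fword = FWord (letters: "'a list")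

instantiation fword :: (type) monoid_add
begin

definition zero_fword :: "'a fword"
  where "zero_fword = FWord []"

definition plus_fword :: "'a fword \<Rightarrow> 'a fword \<Rightarrow> 'a fword"
  where "plus_fword u v = FWord (letters u @ letters v)"

instance
  by standard (simp_all add: zero_fword_def plus_fword_def)

end

type_synonym 'a tensor = "'a fword \<Rightarrow>\<^sub>0 complex"

definition tensor_const :: "complex \<Rightarrow> 'a tensor"
  where "tensor_const c = Poly_Mapping.single 0 c"

text \<open>The inclusion of the vector space as the degree one part of its tensor algebra.\<close>

definition tensor_incl :: "('a \<Rightarrow>\<^sub>0 complex) \<Rightarrow> 'a tensor"
  where "tensor_incl x =
    (\<Sum>a\<in>Poly_Mapping.keys x. Poly_Mapping.single (FWord [a]) (Poly_Mapping.lookup x a))"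

definition tensor_algebra :: "'a set \<Rightarrow> 'a tensor ring"
  where "tensor_algebra B =
    class_ring\<lparr>carrier := {p. \<forall>u\<in>Poly_Mapping.keys p. set (letters u) \<subseteq> B}\<rparr>"


section \<open>The Lie superalgebra $\mathfrak{gl}(m|n)$ and its universal enveloping algebra\<close>

text \<open>
  The matrix unit $E_{ij}$ is represented by its index pair \<open>(i, j)\<close>; elements of
  $\mathfrak{gl}(m|n)$ are the finitely supported families of coefficients of matrix units.
\<close>

definition gl_basis :: "nat \<Rightarrow> nat \<Rightarrow> (nat \<times> nat) set"
  where "gl_basis m n = {1..m + n} \<times> {1..m + n}"

definition gl :: "nat \<Rightarrow> nat \<Rightarrow> ((nat \<times> nat) \<Rightarrow>\<^sub>0 complex) set"
  where "gl m n = {x. Poly_Mapping.keys x \<subseteq> gl_basis m n}"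

definition par :: "nat \<Rightarrow> nat \<Rightarrow> nat"
  where "par m i = (if i \<le> m then 0 else 1)"

definition homogeneous :: "nat \<Rightarrow> nat \<Rightarrow> ((nat \<times> nat) \<Rightarrow>\<^sub>0 complex) \<Rightarrow> bool"
  where "homogeneous m d x \<longleftrightarrow>
    d \<in> {0, 1} \<and> (\<forall>(i, j)\<in>Poly_Mapping.keys x. (par m i + par m j) mod 2 = d)"

fun unit_bracket :: "nat \<Rightarrow> nat \<times> nat \<Rightarrow> nat \<times> nat \<Rightarrow> ((nat \<times> nat) \<Rightarrow>\<^sub>0 complex)"
  where "unit_bracket m (i, j) (k, l) =
    (if j = k then Poly_Mapping.single (i, l) 1 else 0) -
    (if i = l then Poly_Mapping.single (k, j)
        ((-1) ^ ((par m i + par m j) * (par m k + par m l))) else 0)"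

definition gl_bracket ::
    "nat \<Rightarrow> ((nat \<times> nat) \<Rightarrow>\<^sub>0 complex) \<Rightarrow> ((nat \<times> nat) \<Rightarrow>\<^sub>0 complex) \<Rightarrow> ((nat \<times> nat) \<Rightarrow>\<^sub>0 complex)"
  where "gl_bracket m x y =
    (\<Sum>a\<in>Poly_Mapping.keys x. \<Sum>b\<in>Poly_Mapping.keys y.
      Poly_Mapping.map ((*) (Poly_Mapping.lookup x a * Poly_Mapping.lookup y b))
        (unit_bracket m a b))"

abbreviation T_gl :: "nat \<Rightarrow> nat \<Rightarrow> (nat \<times> nat) tensor ring"
  where "T_gl m n \<equiv> tensor_algebra (gl_basis m n)"

definition U_relations :: "nat \<Rightarrow> nat \<Rightarrow> (nat \<times> nat) tensor set"
  where "U_relations m n =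
    {tensor_incl x * tensor_incl y - (-1) ^ (d * e) * (tensor_incl y * tensor_incl x)
        - tensor_incl (gl_bracket m x y) | x y d e.
      x \<in> gl m n \<and> y \<in> gl m n \<and> homogeneous m d x \<and> homogeneous m e y}"

definition U_ideal :: "nat \<Rightarrow> nat \<Rightarrow> (nat \<times> nat) tensor set"
  where "U_ideal m n = Idl\<^bsub>T_gl m n\<^esub> (U_relations m n)"

definition U_gl :: "nat \<Rightarrow> nat \<Rightarrow> (nat \<times> nat) tensor set ring"
  where "U_gl m n = T_gl m n Quot U_ideal m n"

text \<open>
  The canonical ring homomorphism from the tensor algebra onto the universal enveloping
  algebra. Elements of the latter are written below as images of the corresponding
  expressions in the tensor algebra.
\<close>

definition U_proj :: "nat \<Rightarrow> nat \<Rightarrow> (nat \<times> nat) tensor \<Rightarrow> (nat \<times> nat) tensor set"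
  where "U_proj m n p = U_ideal m n +>\<^bsub>T_gl m n\<^esub> p"

abbreviation ZU_gl :: "nat \<Rightarrow> nat \<Rightarrow> (nat \<times> nat) tensor set ring"
  where "ZU_gl m n \<equiv> center_ring (U_gl m n)"

definition mat_unit :: "nat \<Rightarrow> nat \<Rightarrow> (nat \<times> nat) tensor"
  where "mat_unit i j = tensor_incl (Poly_Mapping.single (i, j) 1)"

definition casimir :: "nat \<Rightarrow> nat \<Rightarrow> nat \<Rightarrow> (nat \<times> nat) tensor set"
  where "casimir m n j = U_proj m n
    (\<Sum>i\<in>{1..j} \<rightarrow>\<^sub>E {1..m + n}. (-1) ^ (\<Sum>t\<in>{2..j}. par m (i t)) *
      prod_list (map (\<lambda>t. mat_unit (i t) (i (if t = j then 1 else t + 1))) [1..<j + 1]))"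


section \<open>The $\mathfrak{gl}(m|n)$-weight system on permutations\<close>

text \<open>
  A permutation in $S_k$ is a function \<open>\<sigma>\<close> with \<open>\<sigma> permutes {1..k}\<close>. As such a function does
  not determine \<open>k\<close>, weight systems take \<open>k\<close> as an additional argument.
  The edge $x \to \sigma(x)$ is the pair \<open>(x, \<sigma> x)\<close>.
\<close>

definition edges :: "nat \<Rightarrow> (nat \<Rightarrow> nat) \<Rightarrow> (nat \<times> nat) set"
  where "edges k \<sigma> = {(x, \<sigma> x) | x. x \<in> {1..k}}"

definition in_edge :: "(nat \<Rightarrow> nat) \<Rightarrow> nat \<Rightarrow> nat \<times> nat"
  where "in_edge \<sigma> v = (inv_into UNIV \<sigma> v, v)"

definition out_edge :: "(nat \<Rightarrow> nat) \<Rightarrow> nat \<Rightarrow> nat \<times> nat"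
  where "out_edge \<sigma> v = (v, \<sigma> v)"

definition tail_pt :: "nat \<times> nat \<Rightarrow> real"
  where "tail_pt e = real (fst e) + 1 / 3"

definition head_pt :: "nat \<times> nat \<Rightarrow> real"
  where "head_pt e = real (snd e) - 1 / 3"

definition between_pts :: "nat \<times> nat \<Rightarrow> real \<Rightarrow> bool"
  where "between_pts e z \<longleftrightarrow> min (tail_pt e) (head_pt e) < z \<and> z < max (tail_pt e) (head_pt e)"

text \<open>
  On the edges of one permutation this relation is symmetric, as distinct edges have no
  shifted endpoint in common.
\<close>

definition alternate :: "nat \<times> nat \<Rightarrow> nat \<times> nat \<Rightarrow> bool"
  where "alternate e e' \<longleftrightarrow> between_pts e (tail_pt e') \<noteq> between_pts e (head_pt e')"

definition distinguished_edges :: "nat \<Rightarrow> (nat \<Rightarrow> nat) \<Rightarrow> (nat \<times> nat) set"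
  where "distinguished_edges k \<sigma> = {e \<in> edges k \<sigma>. fst e < snd e}"

definition distinguished_pairs :: "nat \<Rightarrow> (nat \<Rightarrow> nat) \<Rightarrow> (nat \<times> nat) set set"
  where "distinguished_pairs k \<sigma> =
    {{e, e'} | e e'. e \<in> edges k \<sigma> \<and> e' \<in> edges k \<sigma> \<and> e \<noteq> e' \<and> alternate e e'}"

definition sign_exponent :: "nat \<Rightarrow> nat \<Rightarrow> (nat \<Rightarrow> nat) \<Rightarrow> (nat \<times> nat \<Rightarrow> nat) \<Rightarrow> nat"
  where "sign_exponent m k \<sigma> i =
    (\<Sum>e\<in>distinguished_edges k \<sigma>. par m (i e)) +
    (\<Sum>P\<in>distinguished_pairs k \<sigma>. \<Prod>e\<in>P. par m (i e))"

definition w_super :: "nat \<Rightarrow> nat \<Rightarrow> nat \<Rightarrow> (nat \<Rightarrow> nat) \<Rightarrow> (nat \<times> nat) tensor set"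
  where "w_super m n k \<sigma> = U_proj m n
    (\<Sum>i\<in>edges k \<sigma> \<rightarrow>\<^sub>E {1..m + n}. (-1) ^ sign_exponent m k \<sigma> i *
      prod_list (map (\<lambda>v. mat_unit (i (in_edge \<sigma> v)) (i (out_edge \<sigma> v))) [1..<k + 1]))"


section \<open>The universal $\mathfrak{gl}$-weight system\<close>

text \<open>
  Polynomials in $C_0, C_1, C_2, \dots$: a monomial is the finitely supported function that
  gives the exponent of each variable.
\<close>

type_synonym cpoly = "(nat \<Rightarrow>\<^sub>0 nat) \<Rightarrow>\<^sub>0 complex"

definition C_var :: "nat \<Rightarrow> cpoly"
  where "C_var j = Poly_Mapping.single (Poly_Mapping.single j 1) 1"

definition poly_const :: "complex \<Rightarrow> cpoly"
  where "poly_const c = Poly_Mapping.single 0 c"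

definition perm_concat :: "nat \<Rightarrow> (nat \<Rightarrow> nat) \<Rightarrow> (nat \<Rightarrow> nat) \<Rightarrow> nat \<Rightarrow> nat"
  where "perm_concat k \<sigma> \<rho> x = (if x \<le> k then \<sigma> x else k + \<rho> (x - k))"

definition std_cycle :: "nat \<Rightarrow> nat \<Rightarrow> nat"
  where "std_cycle k x = (if x \<in> {1..<k} then x + 1 else if x = k then 1 else x)"

text \<open>
  \<open>squeeze v d\<close> is the order-preserving relabelling that closes the gap left by removing
  the \<open>d\<close> vertices \<open>v, \<dots>, v + d - 1\<close>; \<open>unsqueeze v d\<close> is its inverse.
\<close>

definition squeeze :: "nat \<Rightarrow> nat \<Rightarrow> nat \<Rightarrow> nat"
  where "squeeze v d x = (if x \<ge> v + d then x - d else x)"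

definition unsqueeze :: "nat \<Rightarrow> nat \<Rightarrow> nat \<Rightarrow> nat"
  where "unsqueeze v d x = (if x \<ge> v then x + d else x)"

definition D_perm :: "nat \<Rightarrow> (nat \<Rightarrow> nat) \<Rightarrow> nat \<Rightarrow> nat"
  where "D_perm l \<pi> = squeeze (l + 1) 1 \<circ>
    (\<lambda>x. if \<pi> x = l + 1 then \<pi> (l + 1) else \<pi> x) \<circ> unsqueeze (l + 1) 1"

definition rho_perm :: "nat \<Rightarrow> (nat \<Rightarrow> nat) \<Rightarrow> nat \<Rightarrow> nat"
  where "rho_perm l \<sigma> = squeeze l 2 \<circ>
    (\<lambda>x. if x = inv_into UNIV \<sigma> (l + 1) then \<sigma> l else \<sigma> x) \<circ> unsqueeze l 2"

text \<open>The merged vertex $l'$ takes the place of \<open>l\<close>.\<close>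

definition rho'_perm :: "nat \<Rightarrow> (nat \<Rightarrow> nat) \<Rightarrow> nat \<Rightarrow> nat"
  where "rho'_perm l \<sigma> = squeeze (l + 1) 1 \<circ>
    (\<lambda>x. if x = inv_into UNIV \<sigma> (l + 1) then l else if x = l then \<sigma> l else \<sigma> x) \<circ> unsqueeze (l + 1) 1"

text \<open>
  The case \<open>\<sigma> l = l + 1\<close>, \<open>\<sigma> (l + 1) \<noteq> l\<close> of the recurrence is the last case below with
  \<open>\<sigma>\<close> and \<open>\<sigma>'\<close> interchanged. The rules determine \<open>w k \<sigma>\<close> for all \<open>\<sigma> permutes {1..k}\<close>.
\<close>

definition universal_gl_weight_system :: "(nat \<Rightarrow> (nat \<Rightarrow> nat) \<Rightarrow> cpoly) \<Rightarrow> bool"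
  where "universal_gl_weight_system w \<longleftrightarrow>
    (\<forall>\<sigma>. \<sigma> permutes {1..0} \<longrightarrow> w 0 \<sigma> = 1) \<and>
    (\<forall>k j \<sigma> \<rho>. \<sigma> permutes {1..k} \<longrightarrow> \<rho> permutes {1..j} \<longrightarrow>
      w (k + j) (perm_concat k \<sigma> \<rho>) = w k \<sigma> * w j \<rho>) \<and>
    (\<forall>k\<ge>1. w k (std_cycle k) = C_var k) \<and>
    (\<forall>k l \<sigma>. \<sigma> permutes {1..k} \<longrightarrow> 1 \<le> l \<longrightarrow> l < k \<longrightarrow>
      (let \<tau> = transpose l (l + 1); \<sigma>' = \<tau> \<circ> \<sigma> \<circ> \<tau> in
        (\<sigma> l \<noteq> l + 1 \<and> \<sigma> (l + 1) \<noteq> l \<longrightarrow>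
          w k \<sigma> - w k \<sigma>' = w (k - 1) (D_perm l (\<sigma> \<circ> \<tau>)) - w (k - 1) (D_perm l (\<sigma>' \<circ> \<tau>))) \<and>
        (\<sigma> (l + 1) = l \<and> \<sigma> l \<noteq> l + 1 \<longrightarrow>
          w k \<sigma> - w k \<sigma>' =
            C_var 1 * w (k - 2) (rho_perm l \<sigma>) - C_var 0 * w (k - 1) (rho'_perm l \<sigma>))))"


section \<open>Substituting Casimir elements\<close>

text \<open>
  \<open>casimir_substitution m n \<Phi>\<close>: \<open>\<Phi>\<close> is a homomorphism of complex algebras (a ring
  homomorphism compatible with scalars) into the center of the universal enveloping algebra
  with the prescribed values on the variables.
\<close>

definition casimir_substitution ::
    "nat \<Rightarrow> nat \<Rightarrow> (cpoly \<Rightarrow> (nat \<times> nat) tensor set) \<Rightarrow> bool"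
  where "casimir_substitution m n \<Phi> \<longleftrightarrow>
    \<Phi> \<in> ring_hom class_ring (ZU_gl m n) \<and>
    (\<forall>c. \<Phi> (poly_const c) = U_proj m n (tensor_const c)) \<and>
    \<Phi> (C_var 0) = U_proj m n (tensor_const (of_nat m - of_nat n)) \<and>
    (\<forall>j\<ge>1. \<Phi> (C_var j) = casimir m n j)"

end

(*
  Write the product E_{i_1 i_{sigma(1)}} ... E_{i_k i_{sigma(k)}} as a word in the 2k edge endpoints.
  The sign is then the Koszul sign for sorting the odd letters of this word edge by edge, each head
  before its tail; it changes under transpositions of neighbouring vertices exactly by the sign
  of the super bracket. Hence w(sigma) - w(sigma') = M(sigma) - M(sigma'), where M(sigma) carries
  the first term of the bracket of the factors at l and l + 1. In M(sigma) the head of the edge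
  entering l + 1 cancels against the tail of the edge leaving l: if these are two edges, they merge
  into one; if they are the same edge, the sum over its label is the supertrace m - n of the
  identity, the value of C_0. Both cases of the recurrence follow, using that C_1 is central. The
  recurrence says that modulo smaller permutations only the conjugacy class matters, and every
  class contains a concatenation of standard cycles, for which the claim is multiplicativity.
*)
theory Submission
  imports Defs "HOL-Library.Z2" "HOL-Algebra.Subrings"
begin

text \<open>For fixed \<sigma>, the sign exponent is a quadratic form over the field with two
  elements in the parities of the edge labels: distinguished edges give its diagonal, alternation
  gives its polarization. Merging two edges with equal labels restricts the form to a subspace where
  two coordinates agree, so every sign change reduces to comparing endpoints. The remaining
  obstacles are noncommutative. In the exceptional case of the recurrence the factor
  \<open>\<Sum>c. mat_unit c c\<close> appears in the middle of a word, and a polynomial can be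
  evaluated only in a commutative target. Centrality of the Casimir elements settles both. It is
  proved for open paths instead of closed ones: the action of a matrix unit on a path satisfies a
  super Leibniz rule, which allows induction on the length, and closing the path makes the two
  boundary terms cancel. All computations are done with representatives in the tensor algebra modulo
  the ideal of relations; cosets enter only at the end.\<close>

declare add_bit_eq_xor [simp del] mult_bit_eq_and [simp del]

section \<open>Signs of chord diagrams\<close>

text \<open>Cancellation in characteristic 2. On \<open>bit\<close>, + and * are kept as ring
  operations instead of being rewritten to \<open>xor\<close> and \<open>and\<close>, so that the
  usual algebraic rewriting applies to exponents.\<close>

lemma bit_add_self [simp]: "x + x = (0::bit)" "x + (x + y) = (y::bit)"
  by (cases x; cases y; simp)+

text \<open>
  A chord \<open>x\<close> has tail \<open>t x\<close> and head \<open>h x\<close>. The form is chosen such that its value at \<open>(x, x)\<close> is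
  the indicator of \<open>t x < h x\<close> and its symmetrization indicates whether two chords alternate;
  summing over all ordered pairs of chords makes reindexing and deletion of chords immediate.
\<close>

definition koszul_form :: "('a \<Rightarrow> nat) \<Rightarrow> ('a \<Rightarrow> nat) \<Rightarrow> 'a \<Rightarrow> 'a \<Rightarrow> bit"
  where "koszul_form t h x y =
    of_bool (t x < t y) * of_bool (h y < h x) + of_bool (h x < t y) + of_bool (h x \<le> h y)"

definition koszul :: "'a set \<Rightarrow> ('a \<Rightarrow> nat) \<Rightarrow> ('a \<Rightarrow> nat) \<Rightarrow> ('a \<Rightarrow> bit) \<Rightarrow> bit"
  where "koszul X t h q = (\<Sum>x\<in>X. \<Sum>y\<in>X. koszul_form t h x y * (q x * q y))"

text \<open>The first and third summands together test whether \<open>t y\<close> separates the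
  endpoints of \<open>x\<close>, the other two whether \<open>h y\<close> does. For chords without
  common endpoints the sum is therefore 1 exactly when they alternate.\<close>

definition crossing :: "('a \<Rightarrow> nat) \<Rightarrow> ('a \<Rightarrow> nat) \<Rightarrow> 'a \<Rightarrow> 'a \<Rightarrow> bit"
  where "crossing t h x y =
    of_bool (t x < t y) + of_bool (t x < h y) + of_bool (h x < t y) + of_bool (h x < h y)"

text \<open>With A for \<open>t x < t y\<close> and D for \<open>h x < h y\<close>, the two products
  add up to A(1+D) + (1+A)D = A + D. The other four terms leave the two mixed comparisons, because
  the constants 1 cancel.\<close>

lemma koszul_form_sym:
  assumes "t x \<noteq> t y" "h x \<noteq> h y" "t x \<noteq> h y" "h x \<noteq> t y"
  shows "koszul_form t h x y + koszul_form t h y x = crossing t h x y"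
  using assms unfolding koszul_form_def crossing_def
  by (cases "t x < t y"; cases "h x < h y"; cases "t x < h y"; cases "h x < t y") auto

text \<open>Expansion of a quadratic form at a sum: its value on the old chords, its diagonal value
  at the new one, and the polarization between the two.\<close>

lemma koszul_insert:
  assumes "finite X" "c \<notin> X" "t c \<noteq> h c"
    and "\<And>x. x \<in> X \<Longrightarrow> t x \<noteq> t c \<and> h x \<noteq> h c \<and> t x \<noteq> h c \<and> h x \<noteq> t c"
  shows "koszul (insert c X) t h q =
    koszul X t h q + of_bool (t c < h c) * q c + (\<Sum>x\<in>X. crossing t h c x * (q c * q x))"
proof -
  let ?f = "\<lambda>x y. koszul_form t h x y * (q x * q y)"
  have "koszul (insert c X) t h q =
      ?f c c + (\<Sum>y\<in>X. ?f c y) + (\<Sum>x\<in>X. ?f x c + (\<Sum>y\<in>X. ?f x y))"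
    using assms(1,2) by (simp add: koszul_def)
  also have "\<dots> = koszul X t h q + ?f c c + (\<Sum>x\<in>X. ?f c x + ?f x c)"
    by (simp add: koszul_def sum.distrib ac_simps)
  also have "?f c c = of_bool (t c < h c) * q c"
    using assms(3) by (cases "q c"; cases "t c < h c") (auto simp: koszul_form_def)
  also have "(\<Sum>x\<in>X. ?f c x + ?f x c) = (\<Sum>x\<in>X. crossing t h c x * (q c * q x))"
  proof (rule sum.cong[OF refl])
    fix x assume "x \<in> X"
    then have "crossing t h c x = koszul_form t h c x + koszul_form t h x c"
      using assms(4)[of x] by (subst koszul_form_sym) auto
    then show "?f c x + ?f x c = crossing t h c x * (q c * q x)"
      by (simp add: algebra_simps)
  qed
  finally show ?thesis .
qed

text \<open>The form compares only tails with tails, heads with heads and a head with a later tail,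
  so preserving these three kinds of comparisons is enough.\<close>

lemma koszul_reindex:
  assumes "inj_on g X"
    and "\<And>x y. x \<in> X \<Longrightarrow> y \<in> X \<Longrightarrow> t' (g x) < t' (g y) \<longleftrightarrow> t x < t y"
    and "\<And>x y. x \<in> X \<Longrightarrow> y \<in> X \<Longrightarrow> h' (g x) < h' (g y) \<longleftrightarrow> h x < h y"
    and "\<And>x y. x \<in> X \<Longrightarrow> y \<in> X \<Longrightarrow> h' (g x) < t' (g y) \<longleftrightarrow> h x < t y"
    and "\<And>x. x \<in> X \<Longrightarrow> q' (g x) = q x"
  shows "koszul (g ` X) t' h' q' = koszul X t h q"
proof -
  have "koszul_form t' h' (g x) (g y) = koszul_form t h x y" if "x \<in> X" "y \<in> X" for x y
    using that assms(2-4) by (simp add: koszul_form_def flip: not_less)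
  then show ?thesis
    using assms(1,5) by (simp add: koszul_def sum.reindex)
qed

text \<open>No endpoint of another chord separates the ends of \<open>c\<close>, so \<open>c\<close>
  crosses nothing and contributes only its diagonal term.\<close>

lemma koszul_loop:
  assumes "finite X" "c \<in> X" "t c \<noteq> h c"
    and "\<And>x. x \<in> X - {c} \<Longrightarrow> t x \<noteq> t c \<and> h x \<noteq> h c \<and> t x \<noteq> h c \<and> h x \<noteq> t c"
    and "\<And>x. x \<in> X - {c} \<Longrightarrow> (t c < t x \<longleftrightarrow> h c < t x) \<and> (t c < h x \<longleftrightarrow> h c < h x)"
  shows "koszul X t h q = koszul (X - {c}) t h q + of_bool (t c < h c) * q c"
proof -
  have "X = insert c (X - {c})"
    using assms(2) by auto
  then have "koszul X t h q = koszul (insert c (X - {c})) t h q"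
    by simp
  also have "\<dots> = koszul (X - {c}) t h q + of_bool (t c < h c) * q c +
      (\<Sum>x\<in>X - {c}. crossing t h c x * (q c * q x))"
    by (rule koszul_insert) (use assms in auto)
  also have "(\<Sum>x\<in>X - {c}. crossing t h c x * (q c * q x)) = (\<Sum>x\<in>X - {c}. 0)"
  proof (rule sum.cong[OF refl])
    fix x assume "x \<in> X - {c}"
    from assms(5)[OF this] show "crossing t h c x * (q c * q x) = 0"
      by (simp add: crossing_def ac_simps)
  qed
  finally show ?thesis
    by simp
qed

lemma koszul_cong:
  assumes "\<And>x. x \<in> X \<Longrightarrow> t x = t' x" "\<And>x. x \<in> X \<Longrightarrow> h x = h' x" "\<And>x. x \<in> X \<Longrightarrow> q x = q' x"
  shows "koszul X t h q = koszul X t' h' q'"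
  unfolding koszul_def koszul_form_def using assms by (intro sum.cong refl) simp

text \<open>The tail of \<open>c\<close> and the head of \<open>a\<close> are neighbours on the line
  and both chords carry the same parity; joined, they run from \<open>t a\<close> to
  \<open>h c\<close>. Comparisons with the two vanished endpoints agree and hence cancel in pairs,
  in the crossings with a third chord as well as in the diagonal term.\<close>

lemma koszul_merge:
  assumes "finite X" "c \<in> X" "a \<in> X" "a \<noteq> c" "q c = q a" "t c < h a"
    and "\<And>x. x \<in> X \<Longrightarrow> x \<noteq> c \<Longrightarrow> t x \<noteq> t c"
    and "\<And>x. x \<in> X \<Longrightarrow> x \<noteq> a \<Longrightarrow> t x \<noteq> t a"
    and "\<And>x. x \<in> X \<Longrightarrow> x \<noteq> c \<Longrightarrow> h x \<noteq> h c"
    and "\<And>x. x \<in> X \<Longrightarrow> x \<noteq> a \<Longrightarrow> h x \<noteq> h a"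
    and "\<And>x y. x \<in> X \<Longrightarrow> y \<in> X \<Longrightarrow> t x \<noteq> h y"
    and "\<And>x. x \<in> X \<Longrightarrow> x \<noteq> c \<Longrightarrow> t c < t x \<longleftrightarrow> h a < t x"
    and "\<And>x. x \<in> X \<Longrightarrow> x \<noteq> a \<Longrightarrow> t c < h x \<longleftrightarrow> h a < h x"
  shows "koszul X t h q = koszul (X - {c}) t (h(a := h c)) q"
proof -
  define R where "R = X - {c, a}"
  have X: "X = insert c (insert a R)" and Xc: "X - {c} = insert a R"
    and R: "finite R" "a \<notin> R" "c \<notin> insert a R"
    using assms(1-4) by (auto simp: R_def)
  have RX: "x \<in> X \<and> x \<noteq> a \<and> x \<noteq> c" if "x \<in> R" for x
    using that by (auto simp: R_def)
  have ht: "h x \<noteq> t y" if "x \<in> X" "y \<in> X" for x y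
    using assms(11)[OF that(2,1)] by simp
  let ?h = "h(a := h c)"
  have "koszul X t h q = koszul R t h q + of_bool (t a < h a) * q a +
      (\<Sum>x\<in>R. crossing t h a x * (q a * q x)) +
      of_bool (t c < h c) * q c + (\<Sum>x\<in>insert a R. crossing t h c x * (q c * q x))"
  proof -
    have "koszul X t h q = koszul (insert a R) t h q + of_bool (t c < h c) * q c
        + (\<Sum>x\<in>insert a R. crossing t h c x * (q c * q x))"
      unfolding X by (rule koszul_insert) (use R assms(2-4,7-11) RX ht in auto)
    moreover have "koszul (insert a R) t h q = koszul R t h q + of_bool (t a < h a) * q a
        + (\<Sum>x\<in>R. crossing t h a x * (q a * q x))"
      by (rule koszul_insert) (use R assms(2-4,7-11) RX ht in auto)
    ultimately show ?thesis
      by simp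
  qed
  also have "\<dots> = koszul R t h q + q a * (of_bool (t a < h a) + of_bool (t c < h c) + crossing t h c a)
      + (\<Sum>x\<in>R. (crossing t h a x + crossing t h c x) * (q a * q x))"
    using R assms(5) by (cases "q a") (simp_all add: sum.distrib algebra_simps)
  also have "(\<Sum>x\<in>R. (crossing t h a x + crossing t h c x) * (q a * q x)) =
      (\<Sum>x\<in>R. crossing t ?h a x * (q a * q x))"
  proof (rule sum.cong[OF refl])
    fix x assume "x \<in> R"
    then have "crossing t h a x + crossing t h c x = crossing t ?h a x"
      using assms(12,13)[of x] RX[of x] by (simp add: crossing_def ac_simps)
    then show "(crossing t h a x + crossing t h c x) * (q a * q x) = crossing t ?h a x * (q a * q x)"
      by simp
  qed
  \<comment> \<open>As \<open>t c\<close> and \<open>h a\<close> are neighbours,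
    \<open>t c < t a\<close> is the negation of \<open>t a < h a\<close>, and
    \<open>h c < h a\<close> is the negation of \<open>t c < h c\<close>. With
    \<open>t c < h a\<close> true, the sum collapses to 1 plus the indicator of
    \<open>h c < t a\<close>.\<close>
  also have "of_bool (t a < h a) + of_bool (t c < h c) + crossing t h c a = of_bool (t a < ?h a)"
    using assms(6) assms(11)[of a a] assms(11)[of a c] assms(11)[of c c] assms(11)[of c a] assms(9)[of a] assms(13)[of c] assms(12)[of a] assms(2-4)
    by (auto simp: crossing_def of_bool_def)
  also have "koszul R t h q = koszul R t ?h q"
    by (rule koszul_cong) (use RX in auto)
  also have "koszul R t ?h q + q a * of_bool (t a < ?h a) +
      (\<Sum>x\<in>R. crossing t ?h a x * (q a * q x)) = koszul (X - {c}) t ?h q"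
  proof -
    have "koszul (insert a R) t ?h q = koszul R t ?h q + of_bool (t a < ?h a) * q a
        + (\<Sum>x\<in>R. crossing t ?h a x * (q a * q x))"
      by (rule koszul_insert) (use R assms(2-4,7-11) RX ht in auto)
    then show ?thesis
      unfolding Xc by (simp add: mult.commute)
  qed
  finally show ?thesis .
qed

section \<open>The sign exponent\<close>

text \<open>The integers 2x + 1 and 2y are ordered like the shifted endpoints x + 1/3 and y - 1/3:
  at each vertex the incoming head comes directly before the outgoing tail.\<close>

lemma alternate_eq_crossing:
  assumes "fst e \<noteq> fst e'" "snd e \<noteq> snd e'"
  shows "of_bool (alternate e e') = crossing (\<lambda>e. 2 * fst e + 1) (\<lambda>e. 2 * snd e) e e'"
proof -
  have tt: "tail_pt e < tail_pt e' \<longleftrightarrow> 2 * fst e + 1 < 2 * fst e' + 1" for e e' :: "nat \<times> nat"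
    by (simp add: tail_pt_def)
  have hh: "head_pt e < head_pt e' \<longleftrightarrow> 2 * snd e < 2 * snd e'" for e e' :: "nat \<times> nat"
    by (simp add: head_pt_def)
  have th: "tail_pt e < head_pt e' \<longleftrightarrow> 2 * fst e + 1 < 2 * snd e'" for e e' :: "nat \<times> nat"
  proof -
    have "real (fst e) + 1 / 3 < real (snd e') - 1 / 3 \<longleftrightarrow> fst e + 1 \<le> snd e'"
      using of_nat_le_iff[of "fst e + 1" "snd e'", where ?'a = real]
        of_nat_le_iff[of "snd e'" "fst e", where ?'a = real]
      by (auto simp: not_le not_less)
    then show ?thesis
      by (auto simp: tail_pt_def head_pt_def)
  qed
  have ht: "head_pt e < tail_pt e' \<longleftrightarrow> 2 * snd e < 2 * fst e' + 1" for e e' :: "nat \<times> nat"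
  proof -
    have "real (snd e) - 1 / 3 < real (fst e') + 1 / 3 \<longleftrightarrow> snd e \<le> fst e'"
      using of_nat_le_iff[of "snd e" "fst e'", where ?'a = real]
        of_nat_le_iff[of "fst e' + 1" "snd e", where ?'a = real]
      by (auto simp: not_le not_less)
    then show ?thesis
      by (auto simp: tail_pt_def head_pt_def)
  qed
  let ?a = "fst e < fst e'" and ?b = "fst e < snd e'" and ?c = "snd e \<le> fst e'" and ?d = "snd e < snd e'"
  have "(2 * fst e + 1 < 2 * fst e' + 1) = ?a" "(2 * fst e' + 1 < 2 * fst e + 1) = (\<not> ?a)"
    "(2 * fst e + 1 < 2 * snd e') = ?b" "(2 * snd e' < 2 * fst e + 1) = (\<not> ?b)"
    "(2 * snd e < 2 * fst e' + 1) = ?c" "(2 * fst e' + 1 < 2 * snd e) = (\<not> ?c)"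
    "(2 * snd e < 2 * snd e') = ?d" "(2 * snd e' < 2 * snd e) = (\<not> ?d)"
    using assms by arith+
  note cmp = this
  \<comment> \<open>A point lies between the endpoints of \<open>e\<close> iff exactly one of two
    comparisons holds, so both sides are the exclusive or of the same four truth values.\<close>
  show ?thesis
    unfolding alternate_def between_pts_def min_less_iff_disj less_max_iff_disj tt hh th ht crossing_def cmp
    by (cases ?a; cases ?b; cases ?c; cases ?d; simp only: simp_thms of_bool_eq bit_add_self add_0_left add_0_right)
qed

text \<open>Distinguished pairs for an arbitrary set of chords: after removing an edge for an
  induction step, the rest need no longer be the edge set of a permutation.\<close>

definition chord_pairs :: "(nat \<times> nat) set \<Rightarrow> (nat \<times> nat) set set"
  where "chord_pairs S = {{e, e'} | e e'. e \<in> S \<and> e' \<in> S \<and> e \<noteq> e' \<and> alternate e e'}"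

text \<open>Adding one chord changes both sides by the same amount: the chord itself if it is
  distinguished, and one product for each chord that it crosses. The right side is
  \<open>koszul_insert\<close>.\<close>

lemma sum_chords_eq_koszul:
  assumes "finite S" "inj_on fst S" "inj_on snd S"
  shows "of_nat ((\<Sum>e\<in>{e \<in> S. fst e < snd e}. p e) + (\<Sum>P\<in>chord_pairs S. \<Prod>e\<in>P. p e)) =
    koszul S (\<lambda>e. 2 * fst e + 1) (\<lambda>e. 2 * snd e) (\<lambda>e. of_nat (p e))"
  using assms
proof (induction S rule: finite_induct)
  case empty
  then show ?case
    by (simp add: chord_pairs_def koszul_def)
next
  case (insert c S)
  let ?t = "\<lambda>e. 2 * fst e + 1 :: nat" and ?h = "\<lambda>e. 2 * snd e :: nat"
  have ne: "fst e \<noteq> fst c" "snd e \<noteq> snd c" if "e \<in> S" for e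
  proof -
    have "fst c \<notin> fst ` S" "snd c \<notin> snd ` S"
      using insert.hyps(2) insert.prems by (simp_all add: inj_on_insert)
    then show "fst e \<noteq> fst c" "snd e \<noteq> snd c"
      using that by (metis imageI)+
  qed
  have par: "?t e \<noteq> ?h e'" "?h e \<noteq> ?t e'" for e e' :: "nat \<times> nat"
    by presburger+
  \<comment> \<open>Pairs are unordered while \<open>alternate\<close> is defined from the viewpoint
    of one chord. Symmetry follows because \<open>crossing\<close> is a symmetrization.\<close>
  have sym: "alternate c e \<longleftrightarrow> alternate e c" if "e \<in> S" for e
  proof -
    have "crossing ?t ?h c e = koszul_form ?t ?h c e + koszul_form ?t ?h e c"
      using ne[OF that] par by (subst koszul_form_sym) auto
    also have "\<dots> = crossing ?t ?h e c"
      using ne[OF that] par by (subst add.commute, subst koszul_form_sym) auto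
    finally have "of_bool (alternate c e) = (of_bool (alternate e c) :: bit)"
      by (simp only: alternate_eq_crossing[OF ne[OF that]] alternate_eq_crossing[OF ne[OF that, symmetric]])
    then show ?thesis
      by (simp only: of_bool_eq_iff)
  qed
  let ?N = "(\<lambda>e. {c, e}) ` {e \<in> S. alternate c e}"
  have pairs: "chord_pairs (insert c S) = chord_pairs S \<union> ?N"
  proof (intro Set.equalityI subsetI)
    fix P assume "P \<in> chord_pairs (insert c S)"
    then obtain e e' where P: "P = {e, e'}" "e \<in> insert c S" "e' \<in> insert c S" "e \<noteq> e'" "alternate e e'"
      unfolding chord_pairs_def by blast
    consider "e = c" "e' \<in> S" | "e' = c" "e \<in> S" | "e \<in> S" "e' \<in> S"
      using P by blast
    then show "P \<in> chord_pairs S \<union> ?N"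
    proof cases
      case 1
      then show ?thesis using P by blast
    next
      case 2
      then have "alternate c e" "P = {c, e}" using P sym by auto
      then show ?thesis using 2 by blast
    next
      case 3
      then show ?thesis using P unfolding chord_pairs_def by blast
    qed
  next
    fix P assume "P \<in> chord_pairs S \<union> ?N"
    then show "P \<in> chord_pairs (insert c S)"
    proof
      assume "P \<in> chord_pairs S"
      then show ?thesis unfolding chord_pairs_def by blast
    next
      assume "P \<in> ?N"
      then show ?thesis using insert.hyps(2) unfolding chord_pairs_def by blast
    qed
  qed
  have fin: "finite (chord_pairs S)"
    by (rule finite_subset[of _ "Pow S"]) (auto simp: chord_pairs_def insert.hyps(1))
  have disj: "chord_pairs S \<inter> ?N = {}"
  proof -
    have "P \<subseteq> S" if "P \<in> chord_pairs S" for P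
      using that unfolding chord_pairs_def by blast
    then show ?thesis
      using insert.hyps(2) by blast
  qed
  have inj: "inj_on (\<lambda>e. {c, e}) {e \<in> S. alternate c e}"
    by (rule inj_onI) (metis doubleton_eq_iff)
  have "(\<Sum>P\<in>chord_pairs (insert c S). \<Prod>e\<in>P. p e) =
      (\<Sum>P\<in>chord_pairs S. \<Prod>e\<in>P. p e) + (\<Sum>e\<in>{e \<in> S. alternate c e}. \<Prod>e'\<in>{c, e}. p e')"
  proof -
    have "finite ?N"
      using insert.hyps(1) by simp
    then show ?thesis
      unfolding pairs by (simp add: sum.union_disjoint[OF fin _ disj] sum.reindex[OF inj] del: prod.insert)
  qed
  also have "(\<Sum>e\<in>{e \<in> S. alternate c e}. \<Prod>e'\<in>{c, e}. p e') = (\<Sum>e\<in>S. of_bool (alternate c e) * (p c * p e))"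
    proof -
    have "prod p {c, e} = p c * p e" if "e \<in> S" for e
      using insert.hyps(2) that by (subst prod.insert) auto
    then show ?thesis
      unfolding sum.inter_filter[OF insert.hyps(1)] by (intro sum.cong refl) simp
  qed
  finally have 1: "(\<Sum>P\<in>chord_pairs (insert c S). \<Prod>e\<in>P. p e) =
      (\<Sum>P\<in>chord_pairs S. \<Prod>e\<in>P. p e) + (\<Sum>e\<in>S. of_bool (alternate c e) * (p c * p e))" .
  have "{e \<in> insert c S. fst e < snd e} = (if fst c < snd c then {c} else {}) \<union> {e \<in> S. fst e < snd e}"
    by auto
  then have 2: "(\<Sum>e\<in>{e \<in> insert c S. fst e < snd e}. p e) =
      of_bool (fst c < snd c) * p c + (\<Sum>e\<in>{e \<in> S. fst e < snd e}. p e)"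
    using insert.hyps by auto
  have 3: "koszul (insert c S) ?t ?h (\<lambda>e. of_nat (p e)) = koszul S ?t ?h (\<lambda>e. of_nat (p e))
      + of_bool (?t c < ?h c) * of_nat (p c)
      + (\<Sum>e\<in>S. crossing ?t ?h c e * (of_nat (p c) * of_nat (p e)))"
  proof (rule koszul_insert)
    show "?t e \<noteq> ?t c \<and> ?h e \<noteq> ?h c \<and> ?t e \<noteq> ?h c \<and> ?h e \<noteq> ?t c" if "e \<in> S" for e
      using ne[OF that] par by auto
  qed (use insert.hyps par in auto)
  have 4: "(\<Sum>e\<in>S. crossing ?t ?h c e * (of_nat (p c) * of_nat (p e))) =
      of_nat (\<Sum>e\<in>S. of_bool (alternate c e) * (p c * p e))"
    unfolding of_nat_sum
  proof (rule sum.cong[OF refl])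
    fix e assume "e \<in> S"
    then have "crossing ?t ?h c e = of_bool (alternate c e)"
      using ne[of e] by (subst alternate_eq_crossing) auto
    then show "crossing ?t ?h c e * (of_nat (p c) * of_nat (p e)) =
        of_nat (of_bool (alternate c e) * (p c * p e))"
      by simp
  qed
  have "?t c < ?h c \<longleftrightarrow> fst c < snd c"
    by presburger
  then show ?case
    using insert.IH insert.prems
    unfolding 1 2 3 4 of_nat_add by (simp add: ac_simps del: of_nat_sum)
qed

definition bit_sign :: "bit \<Rightarrow> 'a::ring_1"
  where "bit_sign b = (if b = 0 then 1 else -1)"

lemma bit_sign_0 [simp]: "bit_sign 0 = 1"
  and bit_sign_1 [simp]: "bit_sign 1 = -1"
  by (simp_all add: bit_sign_def)

lemma bit_sign_add: "bit_sign (a + b) = bit_sign a * bit_sign b"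
  by (cases a; cases b) simp_all

lemma bit_sign_of_nat: "bit_sign (of_nat n) = (-1) ^ n"
  by (induction n) (simp_all add: bit_sign_add)

lemma bit_sign_commute: "bit_sign b * x = x * bit_sign b"
  by (cases b) simp_all

definition parity :: "nat \<Rightarrow> nat \<Rightarrow> bit"
  where "parity m j = of_nat (par m j)"

text \<open>
  Here and below a labelling assigns to the vertex \<open>v\<close> the label of the edge entering \<open>v\<close>, so
  the edge leaving \<open>v\<close> has the label \<open>i (\<sigma> v)\<close>. The vertex set is an arbitrary finite set of
  natural numbers, which makes relabellings unnecessary when vertices are deleted.
\<close>

definition perm_sign :: "nat \<Rightarrow> nat set \<Rightarrow> (nat \<Rightarrow> nat) \<Rightarrow> (nat \<Rightarrow> nat) \<Rightarrow> bit"
  where "perm_sign m V \<sigma> i =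
    koszul V (\<lambda>x. 2 * x + 1) (\<lambda>x. 2 * \<sigma> x) (\<lambda>x. parity m (i (\<sigma> x)))"

text \<open>Only the exponent modulo 2 matters. Edges are reindexed by their tails; the edge with
  tail \<open>x\<close> has the label attached to its head \<open>\<sigma> x\<close>.\<close>

lemma sign_exponent_eq_perm_sign:
  assumes "\<sigma> permutes {1..k}"
  shows "of_nat (sign_exponent m k \<sigma> i) = perm_sign m {1..k} \<sigma> (\<lambda>v. i (in_edge \<sigma> v))"
proof -
  have edges: "edges k \<sigma> = (\<lambda>x. (x, \<sigma> x)) ` {1..k}"
    by (auto simp: edges_def)
  have inj: "inj \<sigma>"
    using assms permutes_inj by blast
  have "of_nat (sign_exponent m k \<sigma> i) =
      koszul (edges k \<sigma>) (\<lambda>e. 2 * fst e + 1) (\<lambda>e. 2 * snd e) (\<lambda>e. of_nat (par m (i e)))"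
    unfolding sign_exponent_def distinguished_edges_def distinguished_pairs_def
      chord_pairs_def[symmetric]
    by (rule sum_chords_eq_koszul) (auto simp: edges inj_on_def dest: injD[OF inj])
  also have "\<dots> = perm_sign m {1..k} \<sigma> (\<lambda>v. i (in_edge \<sigma> v))"
    unfolding edges perm_sign_def
    by (rule koszul_reindex) (auto simp: inj_on_def parity_def in_edge_def inv_f_f[OF inj])
  finally show ?thesis .
qed

lemma perm_sign_cong:
  assumes "\<And>x. x \<in> V \<Longrightarrow> \<sigma> x = \<pi> x" "\<And>x. x \<in> V \<Longrightarrow> i (\<pi> x) = j (\<pi> x)"
  shows "perm_sign m V \<sigma> i = perm_sign m V \<pi> j"
  unfolding perm_sign_def by (rule koszul_cong) (use assms in auto)

lemma perm_sign_relabel: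
  assumes "strict_mono_on V g" "\<sigma> ` V \<subseteq> V" "\<And>x. x \<in> V \<Longrightarrow> \<pi> (g x) = g (\<sigma> x)"
    and "\<And>x. x \<in> V \<Longrightarrow> j (g x) = i x"
  shows "perm_sign m (g ` V) \<pi> j = perm_sign m V \<sigma> i"
proof -
  have less: "g x < g y \<longleftrightarrow> x < y" if "x \<in> V" "y \<in> V" for x y
    using assms(1) that by (simp add: strict_mono_on_less)
  have \<sigma>: "\<sigma> x \<in> V" if "x \<in> V" for x
    using assms(2) that by blast
  have double: "2 * x < Suc (2 * y) \<longleftrightarrow> \<not> y < x" for x y :: nat
    by auto
  have inj: "inj_on g V"
    using assms(1) by (rule strict_mono_on_imp_inj_on)
  show ?thesis
    unfolding perm_sign_def
    by (rule koszul_reindex[OF inj]) (simp_all add: assms(3,4) \<sigma> less double)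
qed

section \<open>The sign under swapping, merging and deleting vertices\<close>

lemma sum_delta_pair:
  fixes F :: "'a \<Rightarrow> 'a \<Rightarrow> 'b::semiring_1"
  assumes "finite V" "a \<in> V" "b \<in> V"
  shows "(\<Sum>x\<in>V. \<Sum>y\<in>V. of_bool (x = a) * of_bool (y = b) * F x y) = F a b"
proof -
  have "(\<Sum>y\<in>V. of_bool (x = a) * of_bool (y = b) * F x y) = (if x = a then F a b else 0)" for x
    using assms(1,3) sum.delta[OF assms(1), of b "F a"] by (cases "x = a") (auto simp: of_bool_def if_distrib if_distribR cong: if_cong)
  then show ?thesis
    using assms(1,2) by (simp add: sum.delta)
qed

text \<open>This is Koszul's rule: conjugation by \<open>\<tau>\<close> exchanges the blocks of two
  neighbouring vertices, each consisting of an incoming head and an outgoing tail, and the added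
  term is the product of the parities of the two blocks, that is, of the two matrix units. Labels
  travel with their edges, hence \<open>i \<circ> \<tau>\<close>.\<close>

lemma perm_sign_swap:
  fixes l :: nat
  defines "\<tau> \<equiv> transpose l (l + 1)"
  assumes V: "finite V" "l \<in> V" "l + 1 \<in> V" and \<sigma>: "bij_betw \<sigma> V V"
  shows "perm_sign m V (\<tau> \<circ> \<sigma> \<circ> \<tau>) (i \<circ> \<tau>) = perm_sign m V \<sigma> i +
    (parity m (i l) + parity m (i (\<sigma> l))) * (parity m (i (l + 1)) + parity m (i (\<sigma> (l + 1))))"
proof -
  define q where "q = (\<lambda>x. parity m (i (\<sigma> x)))"
  define a where "a = inv_into V \<sigma> l"
  define b where "b = inv_into V \<sigma> (l + 1)"
  have im: "\<sigma> ` V = V" and inj: "inj_on \<sigma> V"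
    using \<sigma> by (auto simp: bij_betw_def)
  have a: "a \<in> V" "\<sigma> a = l" and b: "b \<in> V" "\<sigma> b = l + 1"
    unfolding a_def b_def using V im by (auto intro: inv_into_into f_inv_into_f)
  have \<sigma>a: "\<sigma> x = l \<longleftrightarrow> x = a" and \<sigma>b: "\<sigma> x = l + 1 \<longleftrightarrow> x = b" if "x \<in> V" for x
    using a b inj that by (metis inj_onD)+
  have "a \<noteq> b"
    using a b by auto
  have \<tau>V: "\<tau> ` V = V"
  proof -
    have "\<tau> permutes V"
      unfolding \<tau>_def using V by (intro permutes_swap_id)
    then show ?thesis
      by (rule permutes_image)
  qed
  have \<tau>\<tau>: "\<tau> (\<tau> x) = x" for x
    by (simp add: \<tau>_def)
  have "inj \<tau>"
    by (metis \<tau>\<tau> injI)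
  \<comment> \<open>\<open>d x y\<close> indicates that \<open>x\<close> and \<open>y\<close> are
    the two exchanged vertices in either order; these are the only pairs whose comparison
    \<open>\<tau>\<close> reverses.\<close>
  define d where "d = (\<lambda>x y. of_bool (x = l) * of_bool (y = l + 1)
    + of_bool (x = l + 1) * of_bool (y = l) :: bit)"
  have lt: "of_bool (\<tau> x < \<tau> y) = of_bool (x < y) + d x y"
    and le: "of_bool (\<tau> x \<le> \<tau> y) = of_bool (x \<le> y) + d x y" for x y
    unfolding \<tau>_def transpose_def d_def by (auto simp: of_bool_def)
  define kap where "kap = (\<lambda>x y. of_bool (x < y) * of_bool (\<sigma> y < \<sigma> x) + of_bool (\<sigma> x \<le> y)
    + of_bool (\<sigma> x \<le> \<sigma> y) :: bit)"
  define kap' where "kap' = (\<lambda>x y. of_bool (\<tau> x < \<tau> y) * of_bool (\<tau> (\<sigma> y) < \<tau> (\<sigma> x))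
    + of_bool (\<tau> (\<sigma> x) \<le> \<tau> y) + of_bool (\<tau> (\<sigma> x) \<le> \<tau> (\<sigma> y)) :: bit)"
  have double: "2 * x < 2 * y + 1 \<longleftrightarrow> x \<le> y" for x y :: nat
    by auto
  have 1: "perm_sign m V \<sigma> i = (\<Sum>x\<in>V. \<Sum>y\<in>V. kap x y * (q x * q y))"
    unfolding perm_sign_def koszul_def koszul_form_def kap_def q_def double by simp
  have "perm_sign m V (\<tau> \<circ> \<sigma> \<circ> \<tau>) (i \<circ> \<tau>) =
      koszul (\<tau> ` V) (\<lambda>x. 2 * x + 1) (\<lambda>x. 2 * (\<tau> \<circ> \<sigma> \<circ> \<tau>) x) (\<lambda>x. parity m ((i \<circ> \<tau>) ((\<tau> \<circ> \<sigma> \<circ> \<tau>) x)))"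
    by (simp add: perm_sign_def \<tau>V)
  also have "\<dots> = koszul V (\<lambda>x. 2 * \<tau> x + 1) (\<lambda>x. 2 * \<tau> (\<sigma> x)) q"
    by (rule koszul_reindex) (auto simp: \<tau>\<tau> q_def intro: inj_on_subset[OF \<open>inj \<tau>\<close>])
  also have "\<dots> = (\<Sum>x\<in>V. \<Sum>y\<in>V. kap' x y * (q x * q y))"
    unfolding koszul_def koszul_form_def kap'_def double by simp
  finally have 2: "perm_sign m V (\<tau> \<circ> \<sigma> \<circ> \<tau>) (i \<circ> \<tau>) = \<dots>" .
  have kap': "kap' x y = kap x y + (d x y * of_bool (\<sigma> y < \<sigma> x) + of_bool (x < y) * d (\<sigma> y) (\<sigma> x)
      + d x y * d (\<sigma> y) (\<sigma> x) + d (\<sigma> x) y + d (\<sigma> x) (\<sigma> y))" for x y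
    unfolding kap'_def kap_def lt le by (simp add: algebra_simps)
  have d1: "(\<Sum>x\<in>V. \<Sum>y\<in>V. d x y * F x y) = F l (l + 1) + F (l + 1) l" for F
    using sum_delta_pair[OF V(1,2,3), of F] sum_delta_pair[OF V(1,3,2), of F]
    by (simp add: d_def distrib_right sum.distrib)
  have d\<sigma>\<sigma>: "d (\<sigma> y) (\<sigma> x) = of_bool (x = a) * of_bool (y = b) + of_bool (x = b) * of_bool (y = a)"
    and d\<sigma>: "d (\<sigma> x) y = of_bool (x = a) * of_bool (y = l + 1) + of_bool (x = b) * of_bool (y = l)"
    if "x \<in> V" "y \<in> V" for x y
    unfolding d_def \<sigma>a[OF that(1)] \<sigma>b[OF that(1)] \<sigma>a[OF that(2)] \<sigma>b[OF that(2)]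
    by (simp_all add: ac_simps)
  have d2: "(\<Sum>x\<in>V. \<Sum>y\<in>V. d (\<sigma> y) (\<sigma> x) * F x y) = F a b + F b a" for F
  proof -
    have "(\<Sum>x\<in>V. \<Sum>y\<in>V. d (\<sigma> y) (\<sigma> x) * F x y) =
        (\<Sum>x\<in>V. \<Sum>y\<in>V. of_bool (x = a) * of_bool (y = b) * F x y + of_bool (x = b) * of_bool (y = a) * F x y)"
      by (intro sum.cong refl) (simp only: d\<sigma>\<sigma> distrib_right)
    then show ?thesis
      using sum_delta_pair[OF V(1) a(1) b(1), of F] sum_delta_pair[OF V(1) b(1) a(1), of F]
      by (simp add: sum.distrib)
  qed
  have d3: "(\<Sum>x\<in>V. \<Sum>y\<in>V. d (\<sigma> x) (\<sigma> y) * F x y) = F a b + F b a" for F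
  proof -
    have "d (\<sigma> x) (\<sigma> y) = d (\<sigma> y) (\<sigma> x)" for x y
      by (simp add: d_def ac_simps)
    then show ?thesis
      using d2 by simp
  qed
  have d4: "(\<Sum>x\<in>V. \<Sum>y\<in>V. d (\<sigma> x) y * F x y) = F a (l + 1) + F b l" for F
  proof -
    have "(\<Sum>x\<in>V. \<Sum>y\<in>V. d (\<sigma> x) y * F x y) =
        (\<Sum>x\<in>V. \<Sum>y\<in>V. of_bool (x = a) * of_bool (y = l + 1) * F x y + of_bool (x = b) * of_bool (y = l) * F x y)"
      by (intro sum.cong refl) (simp only: d\<sigma> distrib_right)
    then show ?thesis
      using sum_delta_pair[OF V(1) a(1) V(3), of F] sum_delta_pair[OF V(1) b(1) V(2), of F]
      by (simp add: sum.distrib)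
  qed
  have neq: "\<sigma> l \<noteq> \<sigma> (l + 1)"
    using inj V by (metis inj_onD n_not_Suc_n Suc_eq_plus1)
  \<comment> \<open>The reversed comparisons involve the two tails (\<open>s1\<close>), the two
    heads (\<open>s2\<close>) or a head and a tail (\<open>s4\<close>), which yields the four
    products of the expanded right side. In \<open>s3\<close> and \<open>s5\<close> both orders
    contribute equally and cancel.\<close>
  have s1: "(\<Sum>x\<in>V. \<Sum>y\<in>V. d x y * (of_bool (\<sigma> y < \<sigma> x) * (q x * q y))) = q l * q (l + 1)"
    unfolding d1 using neq by (cases "\<sigma> l < \<sigma> (l + 1)") (auto simp: ac_simps)
  have s2: "(\<Sum>x\<in>V. \<Sum>y\<in>V. d (\<sigma> y) (\<sigma> x) * (of_bool (x < y) * (q x * q y))) = q a * q b"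
    unfolding d2 using \<open>a \<noteq> b\<close> by (cases "a < b") (auto simp: ac_simps)
  have s3: "(\<Sum>x\<in>V. \<Sum>y\<in>V. d x y * (d (\<sigma> y) (\<sigma> x) * (q x * q y))) = 0"
    unfolding d1 by (simp add: d_def ac_simps)
  have s4: "(\<Sum>x\<in>V. \<Sum>y\<in>V. d (\<sigma> x) y * (q x * q y)) = q a * q (l + 1) + q b * q l"
    unfolding d4 by simp
  have s5: "(\<Sum>x\<in>V. \<Sum>y\<in>V. d (\<sigma> x) (\<sigma> y) * (q x * q y)) = 0"
    unfolding d3 by (simp add: ac_simps)
  have "(\<Sum>x\<in>V. \<Sum>y\<in>V. kap' x y * (q x * q y)) =
      (\<Sum>x\<in>V. \<Sum>y\<in>V. kap x y * (q x * q y) + d x y * (of_bool (\<sigma> y < \<sigma> x) * (q x * q y))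
        + d (\<sigma> y) (\<sigma> x) * (of_bool (x < y) * (q x * q y))
        + d x y * (d (\<sigma> y) (\<sigma> x) * (q x * q y)) + d (\<sigma> x) y * (q x * q y)
        + d (\<sigma> x) (\<sigma> y) * (q x * q y))"
    unfolding kap' by (intro sum.cong refl) (simp add: algebra_simps)
  also have "\<dots> = (\<Sum>x\<in>V. \<Sum>y\<in>V. kap x y * (q x * q y)) + q l * q (l + 1) + q a * q b
      + 0 + (q a * q (l + 1) + q b * q l) + 0"
    unfolding sum.distrib s1 s2 s3 s4 s5 ..
  also have "\<dots> = perm_sign m V \<sigma> i + (q a + q l) * (q b + q (l + 1))"
    unfolding 1 by (simp add: algebra_simps)
  finally show ?thesis
    unfolding 2 using a b by (simp add: q_def)
qed

text \<open>The inner map of \<open>D_perm\<close>: it bypasses \<open>l + 1\<close> but leaves the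
  gap in the vertex set open.\<close>

definition merge_perm :: "nat \<Rightarrow> (nat \<Rightarrow> nat) \<Rightarrow> nat \<Rightarrow> nat"
  where "merge_perm l \<pi> x = (if \<pi> x = l + 1 then \<pi> (l + 1) else \<pi> x)"

lemma transpose_image_remove:
  assumes "l \<in> V" "l + 1 \<in> V"
  shows "transpose l (l + 1) ` (V - {l + 1}) = V - {l}"
  using assms by (auto simp: transpose_def image_iff)

text \<open>The tail of the edge leaving \<open>l\<close> sits at 2l + 1 and the head of the edge
  entering \<open>l + 1\<close> at 2l + 2. They are consecutive, so equal labels make
  \<open>koszul_merge\<close> applicable.\<close>

lemma perm_sign_merge:
  fixes l :: nat
  defines "\<tau> \<equiv> transpose l (l + 1)"
  assumes V: "finite V" "l \<in> V" "l + 1 \<in> V" and \<sigma>: "bij_betw \<sigma> V V"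
    and "\<sigma> l \<noteq> l + 1" and eq: "i (l + 1) = i (\<sigma> l)"
  shows "perm_sign m V \<sigma> i = perm_sign m (V - {l + 1}) (merge_perm l (\<sigma> \<circ> \<tau>)) i"
proof -
  define a where "a = inv_into V \<sigma> (l + 1)"
  define t where "t = (\<lambda>x. 2 * x + 1 :: nat)"
  define h where "h = (\<lambda>x. 2 * \<sigma> x)"
  define q where "q = (\<lambda>x. parity m (i (\<sigma> x)))"
  have im: "\<sigma> ` V = V" and inj: "inj_on \<sigma> V"
    using \<sigma> by (auto simp: bij_betw_def)
  have a: "a \<in> V" "\<sigma> a = l + 1"
    unfolding a_def using V im by (auto intro: inv_into_into f_inv_into_f)
  have \<sigma>a: "\<sigma> x = l + 1 \<longleftrightarrow> x = a" if "x \<in> V" for x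
    using a inj that by (metis inj_onD)
  have "a \<noteq> l"
    using a assms(6) by auto
  have th: "t x \<noteq> h y" for x y
    unfolding t_def h_def by presburger
  have "perm_sign m V \<sigma> i = koszul V t h q"
    by (simp add: perm_sign_def t_def h_def q_def)
  also have "\<dots> = koszul (V - {l}) t (h(a := h l)) q"
  proof (rule koszul_merge)
    show "t l < t x \<longleftrightarrow> h a < t x" if "x \<in> V" "x \<noteq> l" for x
      using that a by (auto simp: t_def h_def)
    show "t l < h x \<longleftrightarrow> h a < h x" if "x \<in> V" "x \<noteq> a" for x
      using that \<sigma>a[OF that(1)] a by (auto simp: t_def h_def)
    show "h x \<noteq> h l" if "x \<in> V" "x \<noteq> l" for x
      using that inj V by (auto simp: h_def inj_on_def)
    show "h x \<noteq> h a" if "x \<in> V" "x \<noteq> a" for x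
      using that \<sigma>a[OF that(1)] a by (auto simp: h_def)
    show "q l = q a"
      using a eq by (simp add: q_def)
    show "t l < h a"
      using a by (simp add: t_def h_def)
  qed (use V a \<open>a \<noteq> l\<close> th in \<open>auto simp: t_def\<close>)
  \<comment> \<open>Merging removed the chord with tail at \<open>l\<close>. The chord that left
    \<open>l + 1\<close> now has to leave the merged vertex \<open>l\<close>, so the tails are
    renamed by \<open>\<tau>\<close>.\<close>
  also have "\<dots> = koszul (\<tau> ` (V - {l + 1})) t (h(a := h l)) q"
    unfolding \<tau>_def using V by (simp only: transpose_image_remove)
  also have "\<dots> = koszul (V - {l + 1}) t (\<lambda>x. 2 * merge_perm l (\<sigma> \<circ> \<tau>) x)
      (\<lambda>x. parity m (i (merge_perm l (\<sigma> \<circ> \<tau>) x)))"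
  proof (rule koszul_reindex)
    have \<tau>V: "\<tau> x \<in> V" if "x \<in> V" for x
      using V that by (auto simp: \<tau>_def transpose_def)
    have m: "merge_perm l (\<sigma> \<circ> \<tau>) x = (if \<tau> x = a then \<sigma> l else \<sigma> (\<tau> x))" if "x \<in> V" for x
      using \<sigma>a[OF \<tau>V[OF that]] by (simp add: merge_perm_def \<tau>_def)
    have m': "merge_perm l (\<sigma> \<circ> \<tau>) x \<noteq> l + 1" if "x \<in> V" for x
      using that m[OF that] \<sigma>a[OF \<tau>V[OF that]] assms(6) by auto
    have h': "(h(a := h l)) (\<tau> x) = 2 * merge_perm l (\<sigma> \<circ> \<tau>) x" if "x \<in> V" for x
      using m[OF that] by (simp add: h_def)
    fix x y assume xy: "x \<in> V - {l + 1}" "y \<in> V - {l + 1}"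
    show "t (\<tau> x) < t (\<tau> y) \<longleftrightarrow> t x < t y"
      using xy by (auto simp: t_def \<tau>_def transpose_def)
    show "(h(a := h l)) (\<tau> x) < (h(a := h l)) (\<tau> y) \<longleftrightarrow>
        2 * merge_perm l (\<sigma> \<circ> \<tau>) x < 2 * merge_perm l (\<sigma> \<circ> \<tau>) y"
      using xy h' by simp
    show "(h(a := h l)) (\<tau> x) < t (\<tau> y) \<longleftrightarrow> 2 * merge_perm l (\<sigma> \<circ> \<tau>) x < t y"
    proof -
      have "2 * v < t (\<tau> y) \<longleftrightarrow> 2 * v < t y" if "v \<noteq> l + 1" for v
        using that xy(2) by (auto simp: t_def \<tau>_def transpose_def)
      then show ?thesis
        using xy h'[of x] m'[of x] by simp
    qed
    show "q (\<tau> x) = parity m (i (merge_perm l (\<sigma> \<circ> \<tau>) x))"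
      using xy m[of x] a eq by (auto simp: q_def)
  qed (auto simp: \<tau>_def inj_on_def transpose_def split: if_splits)
  finally show ?thesis
    by (simp add: perm_sign_def t_def)
qed

text \<open>A fixed point has its head directly before its tail: it crosses nothing and is not
  distinguished.\<close>

lemma perm_sign_fixed:
  assumes V: "finite V" "l \<in> V" and \<sigma>: "bij_betw \<sigma> V V" and "\<sigma> l = l"
  shows "perm_sign m V \<sigma> i = perm_sign m (V - {l}) \<sigma> i"
proof -
  have ne: "\<sigma> x \<noteq> l" if "x \<in> V" "x \<noteq> l" for x
    using \<sigma> that assms(2,4) by (metis bij_betw_imp_inj_on inj_onD)
  have odd: "2 * x + 1 \<noteq> 2 * y" "2 * y \<noteq> 2 * x + 1" for x y :: nat
    by presburger+
  show ?thesis
    unfolding perm_sign_def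
    by (subst koszul_loop[OF V]) (use ne odd assms(4) in \<open>auto simp: less_Suc_eq_le le_less\<close>)
qed

text \<open>The edge from \<open>l\<close> to \<open>l + 1\<close> has its tail directly before its
  head: it crosses nothing but is distinguished, so its label still contributes a parity. This
  surviving sign turns the sum over the label into a supertrace.\<close>

lemma perm_sign_loop:
  fixes l :: nat
  defines "\<tau> \<equiv> transpose l (l + 1)"
  assumes V: "finite V" "l \<in> V" "l + 1 \<in> V" and \<sigma>: "bij_betw \<sigma> V V" and "\<sigma> l = l + 1"
  shows "perm_sign m V \<sigma> i = perm_sign m (V - {l + 1}) (\<sigma> \<circ> \<tau>) i + parity m (i (l + 1))"
proof -
  have ne: "\<sigma> x \<noteq> l + 1" if "x \<in> V" "x \<noteq> l" for x
    using \<sigma> that assms(3,6) by (metis bij_betw_imp_inj_on inj_onD)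
  have odd: "2 * x + 1 \<noteq> 2 * y" "2 * y \<noteq> 2 * x + 1" for x y :: nat
    by presburger+
  let ?t = "\<lambda>x. 2 * x + 1 :: nat"
  let ?k = "\<lambda>X. koszul X ?t (\<lambda>x. 2 * \<sigma> x) (\<lambda>x. parity m (i (\<sigma> x)))"
  have "?k V = ?k (V - {l}) + of_bool (?t l < 2 * \<sigma> l) * parity m (i (\<sigma> l))"
  proof (rule koszul_loop[OF V(1,2)])
    fix x assume x: "x \<in> V - {l}"
    then have "\<sigma> x \<noteq> l + 1"
      using ne by auto
    then show "?t x \<noteq> ?t l \<and> 2 * \<sigma> x \<noteq> 2 * \<sigma> l \<and> ?t x \<noteq> 2 * \<sigma> l \<and> 2 * \<sigma> x \<noteq> ?t l"
      using x odd assms(6) by auto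
    show "(?t l < ?t x \<longleftrightarrow> 2 * \<sigma> l < ?t x) \<and> (?t l < 2 * \<sigma> x \<longleftrightarrow> 2 * \<sigma> l < 2 * \<sigma> x)"
      using x \<open>\<sigma> x \<noteq> l + 1\<close> assms(6) by auto
  qed (use odd in auto)
  also have "?k (V - {l}) = ?k (\<tau> ` (V - {l + 1}))"
    unfolding \<tau>_def using V by (simp only: transpose_image_remove)
  also have "\<dots> = koszul (V - {l + 1}) ?t (\<lambda>x. 2 * (\<sigma> \<circ> \<tau>) x) (\<lambda>x. parity m (i ((\<sigma> \<circ> \<tau>) x)))"
  proof (rule koszul_reindex)
    fix x y assume xy: "x \<in> V - {l + 1}" "y \<in> V - {l + 1}"
    show "?t (\<tau> x) < ?t (\<tau> y) \<longleftrightarrow> ?t x < ?t y"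
      using xy by (auto simp: \<tau>_def transpose_def)
    have "\<tau> x \<in> V" "\<tau> x \<noteq> l"
      using xy V by (auto simp: \<tau>_def transpose_def)
    then have "\<sigma> (\<tau> x) \<noteq> l + 1"
      using ne by auto
    then show "2 * \<sigma> (\<tau> x) < ?t (\<tau> y) \<longleftrightarrow> 2 * (\<sigma> \<circ> \<tau>) x < ?t y"
      using xy by (auto simp: \<tau>_def transpose_def)
  qed (auto simp: \<tau>_def inj_on_def transpose_def split: if_splits)
  finally show ?thesis
    using assms(6) by (simp add: perm_sign_def)
qed

text \<open>Between the two blocks the form vanishes in both orders. From the second block to the
  first every summand is 0; from the first to the second \<open>h x < t y\<close> and
  \<open>h x \<le> h y\<close> are both 1 and cancel.\<close>

lemma perm_sign_concat:
  assumes "\<sigma> ` {1..k} \<subseteq> {1..k}" "\<rho> ` {1..j} \<subseteq> {1..j}"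
  shows "perm_sign m {1..k + j} (perm_concat k \<sigma> \<rho>) i =
    perm_sign m {1..k} \<sigma> i + perm_sign m {1..j} \<rho> (\<lambda>v. i (k + v))"
proof -
  let ?\<pi> = "perm_concat k \<sigma> \<rho>" and ?B = "(+) k ` {1..j}"
  let ?q = "\<lambda>x. parity m (i (?\<pi> x))"
  let ?f = "\<lambda>x y. koszul_form (\<lambda>x. 2 * x + 1) (\<lambda>x. 2 * ?\<pi> x) x y * (?q x * ?q y)"
  have AB: "{1..k + j} = {1..k} \<union> ?B" "{1..k} \<inter> ?B = {}"
    by (auto simp: image_iff)
  have split: "sum F {1..k + j} = sum F {1..k} + sum F ?B" for F :: "nat \<Rightarrow> bit"
    unfolding AB(1) by (rule sum.union_disjoint) (use AB(2) in auto)
  have \<pi>A: "?\<pi> x \<le> k" "1 \<le> ?\<pi> x" if "x \<in> {1..k}" for x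
    using assms(1) that by (auto simp: perm_concat_def image_subset_iff)
  have \<pi>B: "?\<pi> x > k" if "x \<in> ?B" for x
    using assms(2) that by (fastforce simp: perm_concat_def)
  have 0: "?f x y = 0" if "x \<in> ?B" "y \<in> {1..k}" for x y
    using that \<pi>A[of y] \<pi>B[of x] by (auto simp: koszul_form_def)
  have 1: "?f x y = 0" if "x \<in> {1..k}" "y \<in> ?B" for x y
    using that \<pi>A[of x] \<pi>B[of y] by (auto simp: koszul_form_def)
  have "perm_sign m {1..k + j} ?\<pi> i = perm_sign m {1..k} ?\<pi> i + perm_sign m ?B ?\<pi> i"
  proof -
    have "(\<Sum>x\<in>?B. \<Sum>y\<in>{1..k}. ?f x y) = 0" "(\<Sum>x\<in>{1..k}. \<Sum>y\<in>?B. ?f x y) = 0"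
      by (intro sum.neutral ballI 0 1; assumption)+
    then show ?thesis
      unfolding perm_sign_def koszul_def split sum.distrib by (simp only: add_0_left add_0_right)
  qed
  also have "perm_sign m {1..k} ?\<pi> i = perm_sign m {1..k} \<sigma> i"
    unfolding perm_sign_def by (rule koszul_cong) (auto simp: perm_concat_def)
  also have "perm_sign m ?B ?\<pi> i = perm_sign m {1..j} \<rho> (\<lambda>v. i (k + v))"
    by (rule perm_sign_relabel) (use assms(2) in \<open>auto simp: strict_mono_on_def perm_concat_def\<close>)
  finally show ?thesis .
qed

text \<open>Starting from the backward chord from \<open>k\<close> to 1, whose own contribution is
  0, the short chords from \<open>c\<close> to \<open>c + 1\<close> are added one by one. Each has
  adjacent endpoints and adds just its own parity. The subset \<open>Y\<close> is there for the
  induction.\<close>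

lemma koszul_std_cycle:
  assumes "k \<ge> 1" "finite Y" "Y \<subseteq> {1..<k}"
  shows "koszul (insert k Y) (\<lambda>x. 2 * x + 1) (\<lambda>x. 2 * std_cycle k x) q = (\<Sum>x\<in>Y. q x)"
  using assms(2,3)
proof (induction Y rule: finite_induct)
  case empty
  then show ?case
    using assms(1) by (simp add: koszul_def koszul_form_def std_cycle_def)
next
  case (insert c Y)
  let ?t = "\<lambda>x. 2 * x + 1 :: nat" and ?h = "\<lambda>x. 2 * std_cycle k x"
  have c: "std_cycle k c = c + 1" "1 \<le> c" "c < k"
    using insert.prems by (auto simp: std_cycle_def)
  have x: "std_cycle k x \<noteq> c + 1" if "x \<in> insert k Y" for x
    using that insert.prems insert.hyps c by (auto simp: std_cycle_def)
  have odd: "2 * x + 1 \<noteq> 2 * y" "2 * y \<noteq> 2 * x + 1" for x y :: nat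
    by presburger+
  have "koszul (insert k (insert c Y)) ?t ?h q =
      koszul (insert k (insert c Y) - {c}) ?t ?h q + of_bool (?t c < ?h c) * q c"
  proof (rule koszul_loop)
    fix x assume "x \<in> insert k (insert c Y) - {c}"
    then have "std_cycle k x \<noteq> c + 1" "x \<noteq> c"
      using x[of x] by auto
    then show "?t x \<noteq> ?t c \<and> ?h x \<noteq> ?h c \<and> ?t x \<noteq> ?h c \<and> ?h x \<noteq> ?t c"
      "(?t c < ?t x \<longleftrightarrow> ?h c < ?t x) \<and> (?t c < ?h x \<longleftrightarrow> ?h c < ?h x)"
      using odd c by auto
  qed (use insert.hyps odd in auto)
  also have "insert k (insert c Y) - {c} = insert k Y"
    using insert.hyps c by auto
  finally show ?case
    using insert c by simp
qed

text \<open>Only the edge entering vertex 1 is not distinguished; this is why the sign of the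
  Casimir element omits the first index.\<close>

lemma perm_sign_std_cycle:
  assumes "k \<ge> 1"
  shows "perm_sign m {1..k} (std_cycle k) i = (\<Sum>t\<in>{2..k}. parity m (i t))"
proof -
  have "{1..k} = insert k {1..<k}"
    using assms by auto
  then have "perm_sign m {1..k} (std_cycle k) i = (\<Sum>x\<in>{1..<k}. parity m (i (std_cycle k x)))"
    using assms by (simp only: perm_sign_def) (rule koszul_std_cycle; simp)
  also have "\<dots> = (\<Sum>x\<in>{1..<k}. parity m (i (x + 1)))"
    by (intro sum.cong refl) (simp add: std_cycle_def)
  also have "\<dots> = (\<Sum>t\<in>{2..k}. parity m (i t))"
    by (rule sum.reindex_bij_witness[of _ "\<lambda>t. t - 1" "\<lambda>x. x + 1"]) auto
  finally show ?thesis .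
qed

section \<open>The universal enveloping algebra as a congruence on the tensor algebra\<close>

lemma carrier_tensor_algebra:
  "p \<in> carrier (tensor_algebra B) \<longleftrightarrow> (\<forall>u\<in>Poly_Mapping.keys p. set (letters u) \<subseteq> B)"
  by (simp add: tensor_algebra_def)

lemma tensor_algebra_simps [simp]:
  "x \<otimes>\<^bsub>tensor_algebra B\<^esub> y = x * y" "x \<oplus>\<^bsub>tensor_algebra B\<^esub> y = x + y"
  "\<one>\<^bsub>tensor_algebra B\<^esub> = 1" "\<zero>\<^bsub>tensor_algebra B\<^esub> = 0"
  by (simp_all add: tensor_algebra_def class_ring_def)

lemma tensor_carrier_0 [simp]: "0 \<in> carrier (tensor_algebra B)"
  and tensor_carrier_1 [simp]: "1 \<in> carrier (tensor_algebra B)"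
  by (simp_all add: carrier_tensor_algebra zero_fword_def)

lemma tensor_carrier_add [simp]:
  "p \<in> carrier (tensor_algebra B) \<Longrightarrow> q \<in> carrier (tensor_algebra B) \<Longrightarrow>
    p + q \<in> carrier (tensor_algebra B)"
  using keys_add[of p q] by (auto simp: carrier_tensor_algebra)

lemma tensor_carrier_uminus [simp]:
  "p \<in> carrier (tensor_algebra B) \<Longrightarrow> - p \<in> carrier (tensor_algebra B)"
  by (simp add: carrier_tensor_algebra keys_def)

lemma tensor_carrier_diff [simp]:
  "p \<in> carrier (tensor_algebra B) \<Longrightarrow> q \<in> carrier (tensor_algebra B) \<Longrightarrow>
    p - q \<in> carrier (tensor_algebra B)"
  using tensor_carrier_add[of p B "- q"] by simp

lemma tensor_carrier_mult [simp]:
  assumes "p \<in> carrier (tensor_algebra B)" "q \<in> carrier (tensor_algebra B)"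
  shows "p * q \<in> carrier (tensor_algebra B)"
  unfolding carrier_tensor_algebra
proof
  fix u assume "u \<in> Poly_Mapping.keys (p * q)"
  then obtain a b where "u = a + b" "a \<in> Poly_Mapping.keys p" "b \<in> Poly_Mapping.keys q"
    using keys_mult by blast
  then show "set (letters u) \<subseteq> B"
    using assms by (auto simp: carrier_tensor_algebra plus_fword_def)
qed

lemma tensor_carrier_sum [simp]:
  "(\<And>x. x \<in> A \<Longrightarrow> f x \<in> carrier (tensor_algebra B)) \<Longrightarrow> sum f A \<in> carrier (tensor_algebra B)"
  by (induction A rule: infinite_finite_induct) auto

lemma tensor_carrier_prod_list:
  "(\<And>x. x \<in> set xs \<Longrightarrow> x \<in> carrier (tensor_algebra B)) \<Longrightarrow> prod_list xs \<in> carrier (tensor_algebra B)"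
  by (induction xs) auto

lemma tensor_carrier_const [simp]: "tensor_const c \<in> carrier (tensor_algebra B)"
  by (simp add: carrier_tensor_algebra tensor_const_def zero_fword_def)

lemma tensor_carrier_bit_sign [simp]: "bit_sign b \<in> carrier (tensor_algebra B)"
  by (simp add: bit_sign_def)

lemma ring_tensor_algebra: "ring (tensor_algebra B)"
proof (rule ringI)
  show "abelian_group (tensor_algebra B)"
  proof (rule abelian_groupI)
    show "\<exists>y\<in>carrier (tensor_algebra B). y \<oplus>\<^bsub>tensor_algebra B\<^esub> x = \<zero>\<^bsub>tensor_algebra B\<^esub>"
      if "x \<in> carrier (tensor_algebra B)" for x
      using that by (intro bexI[of _ "- x"]) auto
  qed (auto simp: add_ac)
  show "Group.monoid (tensor_algebra B)"
    by (rule monoidI) (auto simp: mult.assoc)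
qed (auto simp: algebra_simps)

lemma a_minus_tensor_algebra:
  assumes "p \<in> carrier (tensor_algebra B)" "q \<in> carrier (tensor_algebra B)"
  shows "p \<ominus>\<^bsub>tensor_algebra B\<^esub> q = p - q"
proof -
  interpret ring "tensor_algebra B" by (rule ring_tensor_algebra)
  have "\<ominus>\<^bsub>tensor_algebra B\<^esub> q = - q"
    by (rule minus_equality) (use assms in auto)
  then show ?thesis
    by (simp add: a_minus_def)
qed

lemma tensor_incl_superset:
  assumes "finite K" "Poly_Mapping.keys x \<subseteq> K"
  shows "tensor_incl x = (\<Sum>a\<in>K. Poly_Mapping.single (FWord [a]) (Poly_Mapping.lookup x a))"
  unfolding tensor_incl_def
  by (rule sum.mono_neutral_left) (use assms in \<open>auto simp: in_keys_iff\<close>)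

lemma tensor_incl_diff: "tensor_incl (x - y) = tensor_incl x - tensor_incl y"
proof -
  let ?K = "Poly_Mapping.keys x \<union> Poly_Mapping.keys y"
  have "Poly_Mapping.keys (x - y) \<subseteq> ?K"
    by (auto simp: in_keys_iff lookup_minus)
  then show ?thesis
    by (subst (1 2 3) tensor_incl_superset[of ?K])
      (auto simp: lookup_minus single_diff sum_subtractf)
qed

lemma tensor_incl_single:
  "tensor_incl (Poly_Mapping.single a c) = Poly_Mapping.single (FWord [a]) c"
  by (subst tensor_incl_superset[of "{a}"]) auto

lemma tensor_incl_0 [simp]: "tensor_incl 0 = 0"
  by (simp add: tensor_incl_def)

lemma mat_unit_eq: "mat_unit i j = Poly_Mapping.single (FWord [(i, j)]) 1"
  by (simp add: mat_unit_def tensor_incl_single)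

lemma poly_mapping_sum_single:
  "p = (\<Sum>k\<in>Poly_Mapping.keys p. Poly_Mapping.single k (Poly_Mapping.lookup p k))"
proof (rule poly_mapping_eqI)
  fix k
  show "Poly_Mapping.lookup p k =
      Poly_Mapping.lookup (\<Sum>k\<in>Poly_Mapping.keys p. Poly_Mapping.single k (Poly_Mapping.lookup p k)) k"
    by (cases "k \<in> Poly_Mapping.keys p")
      (auto simp: lookup_sum lookup_single when_def in_keys_iff sum.delta)
qed

lemma poly_mapping_induct [case_names zero single add]:
  fixes p :: "'a \<Rightarrow>\<^sub>0 'b::comm_monoid_add"
  assumes "P 0" "\<And>k v. P (Poly_Mapping.single k v)" "\<And>p q. P p \<Longrightarrow> P q \<Longrightarrow> P (p + q)"
  shows "P p"
proof -
  have "P (\<Sum>k\<in>A. Poly_Mapping.single k (f k))" for A and f :: "'a \<Rightarrow> 'b"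
    by (induction A rule: infinite_finite_induct) (auto intro: assms)
  then show ?thesis
    by (subst poly_mapping_sum_single)
qed

lemma tensor_const_mult:
  "tensor_const c * p = p * tensor_const c"
proof (induction p rule: poly_mapping_induct)
  case (single u d)
  then show ?case by (simp add: tensor_const_def mult_single mult.commute)
qed (simp_all only: distrib_left distrib_right mult_zero_left mult_zero_right)

lemma tensor_const_hom:
  "tensor_const 0 = 0" "tensor_const 1 = 1"
  "tensor_const (a + b) = tensor_const a + tensor_const b"
  "tensor_const (a - b) = tensor_const a - tensor_const b"
  "tensor_const (a * b) = tensor_const a * tensor_const b"
  by (simp_all add: tensor_const_def single_add single_diff mult_single)

lemma tensor_const_of_nat: "tensor_const (of_nat a) = of_nat a"
  by (induction a) (simp_all add: tensor_const_hom)

lemma mat_unit_carrier [simp]: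
  assumes "i \<in> {1..m + n}" "j \<in> {1..m + n}"
  shows "mat_unit i j \<in> carrier (T_gl m n)"
  using assms by (simp add: mat_unit_eq carrier_tensor_algebra gl_basis_def)

lemma tensor_incl_carrier:
  assumes "x \<in> gl m n"
  shows "tensor_incl x \<in> carrier (T_gl m n)"
  unfolding tensor_incl_def
proof (rule tensor_carrier_sum)
  fix a assume "a \<in> Poly_Mapping.keys x"
  then have "a \<in> gl_basis m n"
    using assms by (auto simp: gl_def)
  then show "Poly_Mapping.single (FWord [a]) (Poly_Mapping.lookup x a) \<in> carrier (T_gl m n)"
    by (simp add: carrier_tensor_algebra)
qed

lemma gl_0: "0 \<in> gl m n"
  by (simp add: gl_def)

lemma gl_add: "x \<in> gl m n \<Longrightarrow> y \<in> gl m n \<Longrightarrow> x + y \<in> gl m n"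
  using keys_add[of x y] by (auto simp: gl_def)

lemma gl_sum: "(\<And>a. a \<in> A \<Longrightarrow> f a \<in> gl m n) \<Longrightarrow> sum f A \<in> gl m n"
  by (induction A rule: infinite_finite_induct) (auto simp: gl_0 gl_add)

lemma gl_bracket_closed:
  assumes "x \<in> gl m n" "y \<in> gl m n"
  shows "gl_bracket m x y \<in> gl m n"
  unfolding gl_bracket_def
proof (intro gl_sum)
  fix a b assume "a \<in> Poly_Mapping.keys x" "b \<in> Poly_Mapping.keys y"
  then have "a \<in> gl_basis m n" "b \<in> gl_basis m n"
    using assms by (auto simp: gl_def)
  moreover obtain i j k l where "a = (i, j)" "b = (k, l)"
    by (metis surj_pair)
  ultimately have "Poly_Mapping.keys (unit_bracket m a b) \<subseteq> gl_basis m n"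
    by (auto simp: in_keys_iff lookup_minus lookup_single gl_basis_def when_def split: if_splits)
  then show "Poly_Mapping.map ((*) (Poly_Mapping.lookup x a * Poly_Mapping.lookup y b))
      (unit_bracket m a b) \<in> gl m n"
    by (auto simp: gl_def in_keys_iff map.rep_eq when_def split: if_splits)
qed

lemma U_relations_carrier: "U_relations m n \<subseteq> carrier (T_gl m n)"
proof
  fix r assume "r \<in> U_relations m n"
  then obtain x y d e where r: "r = tensor_incl x * tensor_incl y
      - (-1) ^ (d * e) * (tensor_incl y * tensor_incl x) - tensor_incl (gl_bracket m x y)"
    and "x \<in> gl m n" "y \<in> gl m n"
    unfolding U_relations_def by blast
  moreover have "(-1) ^ (d * e) \<in> carrier (T_gl m n)"
    by (cases "even (d * e)") auto
  ultimately show "r \<in> carrier (T_gl m n)"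
    by (simp add: tensor_incl_carrier gl_bracket_closed)
qed

lemma ideal_U_ideal: "ideal (U_ideal m n) (T_gl m n)"
  unfolding U_ideal_def
  by (rule ring.genideal_ideal[OF ring_tensor_algebra U_relations_carrier])

text \<open>Congruence of representatives. \<open>U_ideal m n\<close> is an ideal of the subring of
  words over \<open>gl_basis m n\<close>, while the type contains words in all index pairs;
  therefore the multiplicative rules ask for factors in the carrier and the additive ones do
  not.\<close>

definition U_eq :: "nat \<Rightarrow> nat \<Rightarrow> (nat \<times> nat) tensor \<Rightarrow> (nat \<times> nat) tensor \<Rightarrow> bool"
  where "U_eq m n p q \<longleftrightarrow> p - q \<in> U_ideal m n"

lemma U_proj_eq_iff:
  assumes "p \<in> carrier (T_gl m n)" "q \<in> carrier (T_gl m n)"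
  shows "U_proj m n p = U_proj m n q \<longleftrightarrow> U_eq m n p q"
  using ring.quotient_eq_iff_same_a_r_cos[OF ring_tensor_algebra ideal_U_ideal assms]
  by (simp add: U_eq_def U_proj_def a_minus_tensor_algebra[OF assms])

context
  fixes m n :: nat
begin

interpretation U: ideal "U_ideal m n" "T_gl m n"
  by (rule ideal_U_ideal)

lemma U_ideal_add: "p \<in> U_ideal m n \<Longrightarrow> q \<in> U_ideal m n \<Longrightarrow> p + q \<in> U_ideal m n"
  using additive_subgroup.a_closed[OF ideal.axioms(1)[OF ideal_U_ideal]] by simp

lemma U_ideal_0: "0 \<in> U_ideal m n"
  using additive_subgroup.zero_closed[OF ideal.axioms(1)[OF ideal_U_ideal]] by simp

lemma U_ideal_uminus: "p \<in> U_ideal m n \<Longrightarrow> - p \<in> U_ideal m n"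
  using U.I_l_closed[of p "- 1"] by simp

lemma U_eq_refl [simp]: "U_eq m n p p"
  by (simp add: U_eq_def U_ideal_0)

lemma U_eq_sym: "U_eq m n p q \<Longrightarrow> U_eq m n q p"
  using U_ideal_uminus[of "p - q"] by (simp add: U_eq_def)

lemma U_eq_trans [trans]: "U_eq m n p q \<Longrightarrow> U_eq m n q r \<Longrightarrow> U_eq m n p r"
  using U_ideal_add[of "p - q" "q - r"] by (simp add: U_eq_def)

lemma U_eq_add: "U_eq m n p q \<Longrightarrow> U_eq m n p' q' \<Longrightarrow> U_eq m n (p + p') (q + q')"
  using U_ideal_add[of "p - q" "p' - q'"] by (simp add: U_eq_def algebra_simps)

lemma U_eq_uminus: "U_eq m n p q \<Longrightarrow> U_eq m n (- p) (- q)"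
  using U_ideal_uminus[of "p - q"] by (simp add: U_eq_def)

lemma U_eq_diff: "U_eq m n p q \<Longrightarrow> U_eq m n p' q' \<Longrightarrow> U_eq m n (p - p') (q - q')"
  using U_eq_add[of p q "- p'" "- q'"] U_eq_uminus by simp

lemma U_eq_sum: "(\<And>x. x \<in> A \<Longrightarrow> U_eq m n (f x) (g x)) \<Longrightarrow> U_eq m n (sum f A) (sum g A)"
  by (induction A rule: infinite_finite_induct) (auto intro: U_eq_add)

lemma U_eq_mult_left:
  assumes "a \<in> carrier (T_gl m n)" "U_eq m n p q"
  shows "U_eq m n (a * p) (a * q)"
  using U.I_l_closed[of "p - q" a] assms by (simp add: U_eq_def right_diff_distrib)

lemma U_eq_mult_right:
  assumes "U_eq m n p q" "a \<in> carrier (T_gl m n)"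
  shows "U_eq m n (p * a) (q * a)"
  using U.I_r_closed[of "p - q" a] assms by (simp add: U_eq_def left_diff_distrib)

end

text \<open>The defining relation for two matrix units, with the super sign \<open>s\<close> pulled
  out of both the product and the second bracket term. In this shape each side is a difference whose
  second part belongs to the exchanged order.\<close>

lemma U_relation:
  assumes "i \<in> {1..m + n}" "j \<in> {1..m + n}" "k \<in> {1..m + n}" "l \<in> {1..m + n}"
  defines "s \<equiv> bit_sign ((parity m i + parity m j) * (parity m k + parity m l))"
  shows "U_eq m n (mat_unit i j * mat_unit k l - s * (mat_unit k l * mat_unit i j))
    ((if j = k then mat_unit i l else 0) - s * (if i = l then mat_unit k j else 0))"
proof -
  define x where "x = Poly_Mapping.single (i, j) (1 :: complex)"
  define y where "y = Poly_Mapping.single (k, l) (1 :: complex)"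
  define d where "d = (par m i + par m j) mod 2"
  define e where "e = (par m k + par m l) mod 2"
  have xy: "x \<in> gl m n" "y \<in> gl m n"
    using assms by (auto simp: gl_def gl_basis_def x_def y_def)
  have hom: "homogeneous m d x" "homogeneous m e y"
    by (auto simp: homogeneous_def x_def y_def d_def e_def)
  have par_mod: "of_nat (a mod 2) = (of_nat a :: bit)" for a :: nat
    by (cases "even a") (auto elim!: evenE oddE)
  have "s = bit_sign (of_nat (d * e))"
    by (simp add: s_def d_def e_def par_mod parity_def)
  then have s: "s = (-1) ^ (d * e)"
    by (simp only: bit_sign_of_nat)
  \<comment> \<open>In \<open>unit_bracket\<close> the sign is a complex coefficient, in the product
    relation it is a ring element; this reconciles the two.\<close>
  have s': "s * Poly_Mapping.single w 1 = Poly_Mapping.single w ((-1) ^ ((par m i + par m j) * (par m k + par m l)))"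
    for w :: "(nat \<times> nat) fword"
  proof -
    have "s = (-1) ^ ((par m i + par m j) * (par m k + par m l))"
      unfolding s_def parity_def by (simp flip: bit_sign_of_nat)
    then show ?thesis
      by (cases "even ((par m i + par m j) * (par m k + par m l))") (simp_all add: single_uminus)
  qed
  have "Poly_Mapping.map ((*) 1) z = z" for z :: "nat \<times> nat \<Rightarrow>\<^sub>0 complex"
    by (rule poly_mapping_eqI) (simp add: map.rep_eq when_def)
  then have "gl_bracket m x y = unit_bracket m (i, j) (k, l)"
    by (simp add: gl_bracket_def x_def y_def)
  then have br: "tensor_incl (gl_bracket m x y) =
      (if j = k then mat_unit i l else 0) - s * (if i = l then mat_unit k j else 0)"
    by (auto simp: tensor_incl_diff tensor_incl_single mat_unit_eq s')
  have "tensor_incl x * tensor_incl y - (-1) ^ (d * e) * (tensor_incl y * tensor_incl x)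
      - tensor_incl (gl_bracket m x y) \<in> U_relations m n"
    unfolding U_relations_def using xy hom by blast
  then have "tensor_incl x * tensor_incl y - (-1) ^ (d * e) * (tensor_incl y * tensor_incl x)
      - tensor_incl (gl_bracket m x y) \<in> U_ideal m n"
    unfolding U_ideal_def using ring.genideal_self[OF ring_tensor_algebra U_relations_carrier] by blast
  then show ?thesis
    unfolding U_eq_def br by (simp add: x_def y_def mat_unit_def s)
qed

section \<open>The weight system on permutations of finite vertex sets\<close>

definition label_word :: "(nat \<Rightarrow> nat) \<Rightarrow> (nat \<Rightarrow> nat) \<Rightarrow> nat list \<Rightarrow> (nat \<times> nat) tensor"
  where "label_word \<sigma> i vs = prod_list (map (\<lambda>v. mat_unit (i v) (i (\<sigma> v))) vs)"

text \<open>A tensor representative of the weight. It reads the vertices of \<open>V\<close> in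
  increasing order, so vertex sets with gaps are treated like initial segments.\<close>

definition weight :: "nat \<Rightarrow> nat \<Rightarrow> nat set \<Rightarrow> (nat \<Rightarrow> nat) \<Rightarrow> (nat \<times> nat) tensor"
  where "weight m n V \<sigma> = (\<Sum>i\<in>V \<rightarrow>\<^sub>E {1..m + n}.
    bit_sign (perm_sign m V \<sigma> i) * label_word \<sigma> i (sorted_list_of_set V))"

lemma label_word_append [simp]:
  "label_word \<sigma> i (us @ vs) = label_word \<sigma> i us * label_word \<sigma> i vs"
  and label_word_Nil [simp]: "label_word \<sigma> i [] = 1"
  and label_word_Cons [simp]: "label_word \<sigma> i (v # vs) = mat_unit (i v) (i (\<sigma> v)) * label_word \<sigma> i vs"
  by (simp_all add: label_word_def)

lemma label_word_cong:
  "(\<And>v. v \<in> set vs \<Longrightarrow> i v = j v) \<Longrightarrow> (\<And>v. v \<in> set vs \<Longrightarrow> i (\<sigma> v) = j (\<pi> v)) \<Longrightarrow>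
    label_word \<sigma> i vs = label_word \<pi> j vs"
  unfolding label_word_def by (intro arg_cong[of _ _ prod_list] map_cong) auto

lemma label_word_carrier:
  assumes "i ` V \<subseteq> {1..m + n}" "set vs \<subseteq> V" "\<sigma> ` V \<subseteq> V"
  shows "label_word \<sigma> i vs \<in> carrier (T_gl m n)"
  unfolding label_word_def
proof (rule tensor_carrier_prod_list)
  fix x assume "x \<in> set (map (\<lambda>v. mat_unit (i v) (i (\<sigma> v))) vs)"
  then obtain v where "v \<in> V" "\<sigma> v \<in> V" "x = mat_unit (i v) (i (\<sigma> v))"
    using assms(2,3) by auto
  then show "x \<in> carrier (T_gl m n)"
    using assms(1) by (simp only:) (rule mat_unit_carrier; blast)
qed

lemma PiE_label_range: "i \<in> V \<rightarrow>\<^sub>E N \<Longrightarrow> i ` V \<subseteq> N"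
  by auto

lemma weight_carrier:
  assumes "finite V" "\<sigma> ` V \<subseteq> V"
  shows "weight m n V \<sigma> \<in> carrier (T_gl m n)"
  unfolding weight_def
proof (intro tensor_carrier_sum tensor_carrier_mult tensor_carrier_bit_sign)
  fix i assume "i \<in> V \<rightarrow>\<^sub>E {1..m + n}"
  from label_word_carrier[OF PiE_label_range[OF this] _ assms(2)]
  show "label_word \<sigma> i (sorted_list_of_set V) \<in> carrier (T_gl m n)"
    using assms(1) by simp
qed

lemma weight_cong:
  assumes "finite V" "\<sigma> ` V \<subseteq> V" "\<And>x. x \<in> V \<Longrightarrow> \<sigma> x = \<pi> x"
  shows "weight m n V \<sigma> = weight m n V \<pi>"
  unfolding weight_def
  by (intro sum.cong refl arg_cong2[of _ _ _ _ "(*)"] arg_cong[of _ _ bit_sign] perm_sign_cong label_word_cong)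
    (use assms in auto)

lemma sorted_list_of_set_atLeastAtMost_1: "sorted_list_of_set {1..k} = [1..<k + 1]"
proof -
  have "{1..k} = {1..<k + 1}"
    by auto
  then show ?thesis
    by (simp only: sorted_list_of_set_range)
qed

text \<open>An edge of a permutation is determined by its head, so labellings of edges and of
  vertices correspond through \<open>in_edge\<close> and \<open>snd\<close>.\<close>

lemma w_super_eq_weight:
  assumes \<sigma>: "\<sigma> permutes {1..k}"
  shows "w_super m n k \<sigma> = U_proj m n (weight m n {1..k} \<sigma>)"
proof -
  define V where "V = {1..k}"
  define N where "N = {1..m + n}"
  let ?E = "edges k \<sigma>"
  have inj: "inj \<sigma>"
    using \<sigma> permutes_inj by blast
  have in_\<sigma>: "in_edge \<sigma> (\<sigma> x) = (x, \<sigma> x)" for x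
    by (simp add: in_edge_def inv_f_f[OF inj])
  have \<sigma>V: "\<sigma> v \<in> V" if "v \<in> V" for v
    using permutes_in_image[OF \<sigma>] that by (simp add: V_def)
  have E: "?E = (\<lambda>x. (x, \<sigma> x)) ` V"
    by (auto simp: edges_def V_def)
  have in_E: "in_edge \<sigma> v \<in> ?E" if "v \<in> V" for v
  proof -
    have "v \<in> \<sigma> ` V"
      using permutes_image[OF \<sigma>] that by (simp add: V_def)
    then obtain x where "x \<in> V" "v = \<sigma> x"
      by blast
    then show ?thesis
      by (simp add: in_\<sigma> E)
  qed
  have "(\<Sum>i\<in>?E \<rightarrow>\<^sub>E N. (-1) ^ sign_exponent m k \<sigma> i *
      prod_list (map (\<lambda>v. mat_unit (i (in_edge \<sigma> v)) (i (out_edge \<sigma> v))) [1..<k + 1])) =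
      (\<Sum>j\<in>V \<rightarrow>\<^sub>E N. bit_sign (perm_sign m V \<sigma> j) * label_word \<sigma> j [1..<k + 1])"
  proof (rule sum.reindex_bij_witness[of _
        "\<lambda>j. restrict (j \<circ> snd) ?E" "\<lambda>i. restrict (i \<circ> in_edge \<sigma>) V"])
    fix i assume i: "i \<in> ?E \<rightarrow>\<^sub>E N"
    let ?j = "restrict (i \<circ> in_edge \<sigma>) V"
    show "restrict (?j \<circ> snd) ?E = i"
    proof (rule extensionalityI[of _ ?E])
      show "restrict (?j \<circ> snd) ?E e = i e" if "e \<in> ?E" for e
        using that \<sigma>V by (auto simp: E in_\<sigma>)
    qed (use i in \<open>simp_all add: PiE_iff\<close>)
    show "?j \<in> V \<rightarrow>\<^sub>E N"
      using i in_E by (simp add: PiE_iff)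
    have "perm_sign m V \<sigma> ?j = of_nat (sign_exponent m k \<sigma> i)"
      unfolding sign_exponent_eq_perm_sign[OF \<sigma>] V_def[symmetric]
      by (rule perm_sign_cong) (simp_all add: \<sigma>V)
    then have sign: "bit_sign (perm_sign m V \<sigma> ?j) = ((-1) ^ sign_exponent m k \<sigma> i :: (nat \<times> nat) tensor)"
      by (simp only: bit_sign_of_nat)
    have word: "label_word \<sigma> ?j [1..<k + 1] =
        prod_list (map (\<lambda>v. mat_unit (i (in_edge \<sigma> v)) (i (out_edge \<sigma> v))) [1..<k + 1])"
      unfolding label_word_def
    proof (intro arg_cong[of _ _ prod_list] map_cong refl)
      fix v assume "v \<in> set [1..<k + 1]"
      then have "v \<in> V"
        by (auto simp: V_def)
      then show "mat_unit (?j v) (?j (\<sigma> v)) = mat_unit (i (in_edge \<sigma> v)) (i (out_edge \<sigma> v))"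
        by (simp add: \<sigma>V in_\<sigma> out_edge_def)
    qed
    show "bit_sign (perm_sign m V \<sigma> ?j) * label_word \<sigma> ?j [1..<k + 1] =
        (-1) ^ sign_exponent m k \<sigma> i *
        prod_list (map (\<lambda>v. mat_unit (i (in_edge \<sigma> v)) (i (out_edge \<sigma> v))) [1..<k + 1])"
      unfolding sign word ..
  next
    fix j assume j: "j \<in> V \<rightarrow>\<^sub>E N"
    show "restrict (restrict (j \<circ> snd) ?E \<circ> in_edge \<sigma>) V = j"
    proof (rule extensionalityI[of _ V])
      show "restrict (restrict (j \<circ> snd) ?E \<circ> in_edge \<sigma>) V v = j v" if "v \<in> V" for v
        using in_E[OF that] that by (simp add: in_edge_def)
    qed (use j in \<open>simp_all add: PiE_iff\<close>)
    show "restrict (j \<circ> snd) ?E \<in> ?E \<rightarrow>\<^sub>E N"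
      using j \<sigma>V by (auto simp: PiE_iff E)
  qed
  then show ?thesis
    unfolding w_super_def weight_def sorted_list_of_set_atLeastAtMost_1 V_def N_def by (simp only:)
qed

lemma sorted_list_of_set_split:
  fixes V :: "nat set"
  assumes "finite V" "l \<in> V"
  shows "sorted_list_of_set V =
    sorted_list_of_set (V \<inter> {..<l}) @ l # sorted_list_of_set (V \<inter> {l<..})"
proof (rule sorted_distinct_set_unique)
  show "sorted (sorted_list_of_set (V \<inter> {..<l}) @ l # sorted_list_of_set (V \<inter> {l<..}))"
    using assms by (auto simp: sorted_append)
  show "set (sorted_list_of_set V) =
      set (sorted_list_of_set (V \<inter> {..<l}) @ l # sorted_list_of_set (V \<inter> {l<..}))"
    using assms by auto
  show "distinct (sorted_list_of_set (V \<inter> {..<l}) @ l # sorted_list_of_set (V \<inter> {l<..}))"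
    using assms by auto
qed auto

lemma sorted_list_of_set_split2:
  fixes V :: "nat set"
  assumes "finite V" "l \<in> V" "l + 1 \<in> V"
  shows "sorted_list_of_set V =
    sorted_list_of_set (V \<inter> {..<l}) @ l # (l + 1) # sorted_list_of_set (V \<inter> {l + 1<..})"
    and "sorted_list_of_set (V - {l + 1}) =
    sorted_list_of_set (V \<inter> {..<l}) @ l # sorted_list_of_set (V \<inter> {l + 1<..})"
proof -
  have "V \<inter> {l<..} \<inter> {..<l + 1} = {}" "V \<inter> {l<..} \<inter> {l + 1<..} = V \<inter> {l + 1<..}"
    by auto
  then show "sorted_list_of_set V =
    sorted_list_of_set (V \<inter> {..<l}) @ l # (l + 1) # sorted_list_of_set (V \<inter> {l + 1<..})"
    using sorted_list_of_set_split[OF assms(1,2)] sorted_list_of_set_split[of "V \<inter> {l<..}" "l + 1"] assms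
    by simp
  have "(V - {l + 1}) \<inter> {..<l} = V \<inter> {..<l}" "(V - {l + 1}) \<inter> {l<..} = V \<inter> {l + 1<..}"
    by auto
  then show "sorted_list_of_set (V - {l + 1}) =
    sorted_list_of_set (V \<inter> {..<l}) @ l # sorted_list_of_set (V \<inter> {l + 1<..})"
    using sorted_list_of_set_split[of "V - {l + 1}" l] assms by simp
qed

section \<open>Exchange and contraction of neighbouring vertices\<close>

lemma sum_PiE_insert:
  assumes "a \<notin> V"
  shows "(\<Sum>i\<in>insert a V \<rightarrow>\<^sub>E N. f i) = (\<Sum>j\<in>V \<rightarrow>\<^sub>E N. \<Sum>c\<in>N. f (j(a := c)))"
proof -
  have "(\<Sum>i\<in>insert a V \<rightarrow>\<^sub>E N. f i) = (\<Sum>(c, j)\<in>N \<times> (V \<rightarrow>\<^sub>E N). f (j(a := c)))"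
    unfolding PiE_insert_eq using sum.reindex[OF inj_combinator[OF assms, of "\<lambda>_. N"], of f]
    by (simp add: case_prod_beta o_def)
  also have "\<dots> = (\<Sum>c\<in>N. \<Sum>j\<in>V \<rightarrow>\<^sub>E N. f (j(a := c)))"
    by (rule sum.cartesian_product[symmetric])
  also have "\<dots> = (\<Sum>j\<in>V \<rightarrow>\<^sub>E N. \<Sum>c\<in>N. f (j(a := c)))"
    by (rule sum.swap)
  finally show ?thesis .
qed

text \<open>
  The part of the weight in which the word $E_{i_l i_{\sigma(l)}} E_{i_{l+1} i_{\sigma(l+1)}}$ is
  replaced by the first term of the bracket of its two factors.
\<close>

definition contracted_weight ::
    "nat \<Rightarrow> nat \<Rightarrow> nat set \<Rightarrow> nat \<Rightarrow> (nat \<Rightarrow> nat) \<Rightarrow> (nat \<times> nat) tensor"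
  where "contracted_weight m n V l \<sigma> = (\<Sum>i\<in>V \<rightarrow>\<^sub>E {1..m + n}. bit_sign (perm_sign m V \<sigma> i) *
    (label_word \<sigma> i (sorted_list_of_set (V \<inter> {..<l})) *
      (if i (\<sigma> l) = i (l + 1) then mat_unit (i l) (i (\<sigma> (l + 1))) else 0) *
      label_word \<sigma> i (sorted_list_of_set (V \<inter> {l + 1<..}))))"

lemma sum_labels_permute:
  assumes "\<tau> permutes V"
  shows "(\<Sum>i\<in>V \<rightarrow>\<^sub>E N. f (i \<circ> \<tau>)) = (\<Sum>i\<in>V \<rightarrow>\<^sub>E N. f i)"
proof (rule sum.reindex_bij_witness[of _ "\<lambda>i. i \<circ> inv_into UNIV \<tau>" "\<lambda>i. i \<circ> \<tau>"])
  have "i \<circ> p \<in> V \<rightarrow>\<^sub>E N" if "i \<in> V \<rightarrow>\<^sub>E N" "p permutes V" for i p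
    using that permutes_in_image[OF that(2)] unfolding PiE_iff extensional_def by (simp add: permutes_not_in[OF that(2)])
  then show "i \<circ> \<tau> \<in> V \<rightarrow>\<^sub>E N" "i \<circ> inv_into UNIV \<tau> \<in> V \<rightarrow>\<^sub>E N" if "i \<in> V \<rightarrow>\<^sub>E N" for i
    using that assms permutes_inv[OF assms] by blast+
  show "i \<circ> inv_into UNIV \<tau> \<circ> \<tau> = i" "i \<circ> \<tau> \<circ> inv_into UNIV \<tau> = i"
    if "i \<in> V \<rightarrow>\<^sub>E N" for i
    by (simp_all only: comp_assoc permutes_inv_o[OF assms] comp_id)
qed simp

text \<open>The sign from \<open>perm_sign_swap\<close> is exactly the sign in the super commutator
  of the factors at \<open>l\<close> and \<open>l + 1\<close>, so the relation of the enveloping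
  algebra applies term by term, whatever the position of \<open>\<sigma> l\<close> and
  \<open>\<sigma> (l + 1)\<close>.\<close>

lemma weight_swap:
  fixes l :: nat
  defines "\<tau> \<equiv> transpose l (l + 1)"
  assumes V: "finite V" "l \<in> V" "l + 1 \<in> V" and \<sigma>: "bij_betw \<sigma> V V"
  shows "U_eq m n (weight m n V \<sigma> - weight m n V (\<tau> \<circ> \<sigma> \<circ> \<tau>))
    (contracted_weight m n V l \<sigma> - contracted_weight m n V l (\<tau> \<circ> \<sigma> \<circ> \<tau>))"
proof -
  let ?A = "sorted_list_of_set (V \<inter> {..<l})" and ?B = "sorted_list_of_set (V \<inter> {l + 1<..})"
  let ?L = "V \<rightarrow>\<^sub>E {1..m + n}" and ?s = "\<lambda>i. bit_sign (perm_sign m V \<sigma> i) :: (nat \<times> nat) tensor"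
  let ?e = "\<lambda>i. bit_sign ((parity m (i l) + parity m (i (\<sigma> l))) *
    (parity m (i (l + 1)) + parity m (i (\<sigma> (l + 1))))) :: (nat \<times> nat) tensor"
  let ?P = "\<lambda>i. label_word \<sigma> i ?A" and ?S = "\<lambda>i. label_word \<sigma> i ?B"
  let ?X = "\<lambda>i. mat_unit (i l) (i (\<sigma> l)) * mat_unit (i (l + 1)) (i (\<sigma> (l + 1)))"
  let ?Y = "\<lambda>i. mat_unit (i (l + 1)) (i (\<sigma> (l + 1))) * mat_unit (i l) (i (\<sigma> l))"
  let ?X' = "\<lambda>i. if i (\<sigma> l) = i (l + 1) then mat_unit (i l) (i (\<sigma> (l + 1))) else 0"
  let ?Y' = "\<lambda>i. if i l = i (\<sigma> (l + 1)) then mat_unit (i (l + 1)) (i (\<sigma> l)) else 0"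
  have \<tau>: "\<tau> permutes V"
    unfolding \<tau>_def using V by (intro permutes_swap_id)
  have \<tau>\<tau>: "\<tau> (\<tau> x) = x" for x
    by (simp add: \<tau>_def)
  have \<tau>l: "\<tau> l = l + 1" "\<tau> (l + 1) = l"
    by (simp_all add: \<tau>_def)
  have \<tau>x: "\<tau> x = x" if "x \<in> set ?A \<union> set ?B" for x
    using that V by (auto simp: \<tau>_def transpose_def)
  have PS: "label_word (\<tau> \<circ> \<sigma> \<circ> \<tau>) (i \<circ> \<tau>) ?A = ?P i" "label_word (\<tau> \<circ> \<sigma> \<circ> \<tau>) (i \<circ> \<tau>) ?B = ?S i" for i
    by (rule label_word_cong; simp only: \<tau>x \<tau>\<tau> o_apply UnI1 UnI2)+
  have s: "bit_sign (perm_sign m V (\<tau> \<circ> \<sigma> \<circ> \<tau>) (i \<circ> \<tau>)) = ?s i * ?e i" for i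
    unfolding \<tau>_def perm_sign_swap[OF V \<sigma>] bit_sign_add ..
  have 1: "weight m n V \<sigma> = (\<Sum>i\<in>?L. ?s i * (?P i * ?X i * ?S i))"
    unfolding weight_def sorted_list_of_set_split2(1)[OF V] by (simp add: mult.assoc)
  \<comment> \<open>Substituting \<open>i \<circ> \<tau>\<close> for \<open>i\<close> gives
    corresponding edges the same label in both permutations. The two words then differ only in the
    order of the factors at \<open>l\<close> and \<open>l + 1\<close>.\<close>
  have "weight m n V (\<tau> \<circ> \<sigma> \<circ> \<tau>) = (\<Sum>i\<in>?L. bit_sign (perm_sign m V (\<tau> \<circ> \<sigma> \<circ> \<tau>) (i \<circ> \<tau>)) *
      label_word (\<tau> \<circ> \<sigma> \<circ> \<tau>) (i \<circ> \<tau>) (?A @ l # (l + 1) # ?B))"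
    unfolding weight_def sorted_list_of_set_split2(1)[OF V] by (rule sum_labels_permute[OF \<tau>, symmetric])
  then have 2: "weight m n V (\<tau> \<circ> \<sigma> \<circ> \<tau>) = (\<Sum>i\<in>?L. ?s i * ?e i * (?P i * ?Y i * ?S i))"
    unfolding s label_word_append label_word_Cons PS by (simp only: o_apply \<tau>\<tau> \<tau>l mult.assoc)
  have 3: "contracted_weight m n V l \<sigma> = (\<Sum>i\<in>?L. ?s i * (?P i * ?X' i * ?S i))"
    unfolding contracted_weight_def ..
  \<comment> \<open>Under the same substitution the first bracket term for the conjugate permutation
    becomes the second bracket term for \<open>\<sigma>\<close>.\<close>
  have "contracted_weight m n V l (\<tau> \<circ> \<sigma> \<circ> \<tau>) = (\<Sum>i\<in>?L. bit_sign (perm_sign m V (\<tau> \<circ> \<sigma> \<circ> \<tau>) (i \<circ> \<tau>)) *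
      (label_word (\<tau> \<circ> \<sigma> \<circ> \<tau>) (i \<circ> \<tau>) ?A *
        (if (i \<circ> \<tau>) ((\<tau> \<circ> \<sigma> \<circ> \<tau>) l) = (i \<circ> \<tau>) (l + 1)
          then mat_unit ((i \<circ> \<tau>) l) ((i \<circ> \<tau>) ((\<tau> \<circ> \<sigma> \<circ> \<tau>) (l + 1))) else 0) *
        label_word (\<tau> \<circ> \<sigma> \<circ> \<tau>) (i \<circ> \<tau>) ?B))"
    unfolding contracted_weight_def by (rule sum_labels_permute[OF \<tau>, symmetric])
  then have 4: "contracted_weight m n V l (\<tau> \<circ> \<sigma> \<circ> \<tau>) = (\<Sum>i\<in>?L. ?s i * ?e i * (?P i * ?Y' i * ?S i))"
    unfolding s PS by (simp only: o_apply \<tau>\<tau> \<tau>l eq_commute)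
  have term_eq: "U_eq m n (?s i * (?P i * ?X i * ?S i) - ?s i * ?e i * (?P i * ?Y i * ?S i))
      (?s i * (?P i * ?X' i * ?S i) - ?s i * ?e i * (?P i * ?Y' i * ?S i))" if i: "i \<in> ?L" for i
  proof -
    have \<sigma>V: "\<sigma> ` V \<subseteq> V"
      using \<sigma> by (auto simp: bij_betw_def)
    have PSc: "?P i \<in> carrier (T_gl m n)" "?S i \<in> carrier (T_gl m n)"
      by (rule label_word_carrier[OF PiE_label_range[OF i] _ \<sigma>V]; use V in auto)+
    have iV: "i v \<in> {1..m + n}" if "v \<in> V" for v
      using i that by auto
    have "U_eq m n (?X i - ?e i * ?Y i) (?X' i - ?e i * ?Y' i)"
      using V \<sigma>V by (intro U_relation iV) auto
    then have "U_eq m n (?s i * (?P i * (?X i - ?e i * ?Y i) * ?S i)) (?s i * (?P i * (?X' i - ?e i * ?Y' i) * ?S i))"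
      by (intro U_eq_mult_left U_eq_mult_right PSc tensor_carrier_bit_sign)
    moreover have "?s i * (?P i * (x - ?e i * y) * ?S i) =
        ?s i * (?P i * x * ?S i) - ?s i * ?e i * (?P i * y * ?S i)" for x y
    proof -
      have "?P i * (?e i * y) = ?e i * (?P i * y)"
        by (simp only: mult.assoc[symmetric] bit_sign_commute[of _ "?P i"])
      then show ?thesis
        by (simp only: left_diff_distrib right_diff_distrib mult.assoc)
    qed
    ultimately show ?thesis
      by (simp only:)
  qed
  show ?thesis
    unfolding 1 2 3 4 sum_subtractf[symmetric] by (rule U_eq_sum) (rule term_eq)
qed

lemma sum_label_insert:
  assumes "a \<in> V"
  shows "(\<Sum>i\<in>V \<rightarrow>\<^sub>E N. f i) = (\<Sum>j\<in>(V - {a}) \<rightarrow>\<^sub>E N. \<Sum>c\<in>N. f (j(a := c)))"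
  using sum_PiE_insert[of a "V - {a}" f N] assms by (simp add: insert_absorb)

text \<open>The Kronecker delta of the bracket identifies the labels of two different edges. It
  removes one summation and joins the edges, with signs matching by
  \<open>perm_sign_merge\<close>.\<close>

lemma contracted_weight_merge:
  fixes l :: nat
  defines "\<tau> \<equiv> transpose l (l + 1)"
  assumes V: "finite V" "l \<in> V" "l + 1 \<in> V" and \<sigma>: "bij_betw \<sigma> V V" and ne: "\<sigma> l \<noteq> l + 1"
  shows "contracted_weight m n V l \<sigma> = weight m n (V - {l + 1}) (merge_perm l (\<sigma> \<circ> \<tau>))"
proof -
  let ?A = "sorted_list_of_set (V \<inter> {..<l})" and ?B = "sorted_list_of_set (V \<inter> {l + 1<..})"
  let ?\<pi> = "merge_perm l (\<sigma> \<circ> \<tau>)" and ?N = "{1..m + n}" and ?V = "V - {l + 1}"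
  have \<sigma>V: "\<sigma> v \<in> V" if "v \<in> V" for v
    using \<sigma> that by (auto simp: bij_betw_def)
  have \<tau>l: "\<tau> l = l + 1" "\<tau> (l + 1) = l"
    by (simp_all add: \<tau>_def)
  have \<pi>: "?\<pi> v = (if \<sigma> v = l + 1 then \<sigma> l else \<sigma> v)" if "v \<noteq> l" "v \<noteq> l + 1" for v
  proof -
    have "\<tau> v = v"
      using that by (simp add: \<tau>_def transpose_def)
    then show ?thesis
      by (simp only: merge_perm_def o_apply \<tau>l)
  qed
  have \<pi>l: "?\<pi> l = (if \<sigma> (l + 1) = l + 1 then \<sigma> l else \<sigma> (l + 1))"
    by (simp only: merge_perm_def o_apply \<tau>l)
  have \<pi>ne: "?\<pi> v \<noteq> l + 1" for v
    unfolding merge_perm_def o_apply \<tau>l using ne by simp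
  define F where "F = (\<lambda>i. bit_sign (perm_sign m V \<sigma> i) * (label_word \<sigma> i ?A *
      (if i (\<sigma> l) = i (l + 1) then mat_unit (i l) (i (\<sigma> (l + 1))) else 0) * label_word \<sigma> i ?B))"
  have *: "(\<Sum>c\<in>?N. F (j(l + 1 := c))) =
      bit_sign (perm_sign m ?V ?\<pi> j) * label_word ?\<pi> j (sorted_list_of_set ?V)"
    if j: "j \<in> ?V \<rightarrow>\<^sub>E ?N" for j
  proof -
    let ?i = "j(l + 1 := j (\<sigma> l))"
    \<comment> \<open>As \<open>\<sigma> l\<close> differs from \<open>l + 1\<close>, the label
      \<open>j (\<sigma> l)\<close> does not depend on \<open>c\<close>, and only one value of
      \<open>c\<close> survives.\<close>
    have Fc: "F (j(l + 1 := c)) = (if c = j (\<sigma> l) then F ?i else 0)" for c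
      using ne by (cases "c = j (\<sigma> l)") (simp_all add: F_def)
    have "(\<Sum>c\<in>?N. F (j(l + 1 := c))) = (\<Sum>c\<in>?N. if c = j (\<sigma> l) then F ?i else 0)"
      by (rule sum.cong[OF refl]) (rule Fc)
    also have "\<dots> = (if j (\<sigma> l) \<in> ?N then F ?i else 0)"
      by (rule sum.delta) simp
    also have "j (\<sigma> l) \<in> ?N"
      using PiE_mem[OF j, of "\<sigma> l"] \<sigma>V[OF V(2)] ne by simp
    then have "(if j (\<sigma> l) \<in> ?N then F ?i else 0) = F ?i"
      by (rule if_P)
    also have "F ?i = bit_sign (perm_sign m V \<sigma> ?i) *
        (label_word \<sigma> ?i ?A * mat_unit (?i l) (?i (\<sigma> (l + 1))) * label_word \<sigma> ?i ?B)"
      using ne by (simp add: F_def)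
    also have "perm_sign m V \<sigma> ?i = perm_sign m ?V ?\<pi> ?i"
      unfolding \<tau>_def by (rule perm_sign_merge[OF V \<sigma> ne]) (use ne in simp)
    also have "\<dots> = perm_sign m ?V ?\<pi> j"
      by (rule perm_sign_cong) (use \<pi>ne in simp_all)
    also have "mat_unit (?i l) (?i (\<sigma> (l + 1))) = mat_unit (j l) (j (?\<pi> l))"
      using ne by (simp add: \<pi>l)
    also have "label_word \<sigma> ?i ?A = label_word ?\<pi> j ?A"
      by (rule label_word_cong) (use V ne \<pi> in auto)
    also have "label_word \<sigma> ?i ?B = label_word ?\<pi> j ?B"
      by (rule label_word_cong) (use V ne \<pi> in auto)
    finally show ?thesis
      unfolding sorted_list_of_set_split2(2)[OF V] label_word_append label_word_Cons
      by (simp only: mult.assoc)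
  qed
  have "contracted_weight m n V l \<sigma> = (\<Sum>j\<in>?V \<rightarrow>\<^sub>E ?N. \<Sum>c\<in>?N. F (j(l + 1 := c)))"
    unfolding contracted_weight_def F_def by (rule sum_label_insert[OF V(3)])
  also have "\<dots> = weight m n ?V ?\<pi>"
    unfolding weight_def by (rule sum.cong[OF refl]) (rule *)
  finally show ?thesis .
qed

text \<open>The supertrace of the identity matrix.\<close>

lemma sum_parity_sign:
  "(\<Sum>c\<in>{1..m + n}. bit_sign (parity m c)) = (of_nat m - of_nat n :: 'a::ring_1)"
proof (induction n)
  case 0
  have "(\<Sum>c\<in>{1..m}. bit_sign (parity m c)) = (\<Sum>c\<in>{1..m}. 1 :: 'a)"
    by (intro sum.cong refl) (simp add: parity_def par_def)
  then show ?case
    by simp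
next
  case (Suc n)
  then show ?case
    by (simp add: parity_def par_def)
qed

text \<open>Here the Kronecker delta compares the label of one edge with itself and imposes nothing.
  The label occurs in no factor of the word but only in the sign, so its sum splits off as the
  supertrace.\<close>

lemma contracted_weight_loop:
  fixes l :: nat
  defines "\<tau> \<equiv> transpose l (l + 1)"
  assumes V: "finite V" "l \<in> V" "l + 1 \<in> V" and \<sigma>: "bij_betw \<sigma> V V" and eq: "\<sigma> l = l + 1"
  shows "contracted_weight m n V l \<sigma> =
    (of_nat m - of_nat n) * weight m n (V - {l + 1}) (\<sigma> \<circ> \<tau>)"
proof -
  let ?A = "sorted_list_of_set (V \<inter> {..<l})" and ?B = "sorted_list_of_set (V \<inter> {l + 1<..})"
  let ?\<pi> = "\<sigma> \<circ> \<tau>" and ?N = "{1..m + n}" and ?V = "V - {l + 1}"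
  let ?w = "\<lambda>j. label_word ?\<pi> j ?A * mat_unit (j l) (j (\<sigma> (l + 1))) * label_word ?\<pi> j ?B"
  have ne: "\<sigma> v \<noteq> l + 1" if "v \<in> V" "v \<noteq> l" for v
    using \<sigma> that V eq by (metis bij_betw_imp_inj_on inj_onD)
  have \<tau>l: "\<tau> l = l + 1" "\<tau> (l + 1) = l"
    by (simp_all add: \<tau>_def)
  have \<tau>V: "\<tau> v \<in> V \<and> \<tau> v \<noteq> l" if "v \<in> ?V" for v
    using that V by (auto simp: \<tau>_def transpose_def)
  have \<tau>v: "\<tau> v = v" if "v \<noteq> l" "v \<noteq> l + 1" for v
    using that by (simp add: \<tau>_def transpose_def)
  define F where "F = (\<lambda>i. bit_sign (perm_sign m V \<sigma> i) * (label_word \<sigma> i ?A *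
      (if i (\<sigma> l) = i (l + 1) then mat_unit (i l) (i (\<sigma> (l + 1))) else 0) * label_word \<sigma> i ?B))"
  have F: "F (j(l + 1 := c)) = bit_sign (parity m c) * (bit_sign (perm_sign m ?V ?\<pi> j) * ?w j)"
    for j c
  proof -
    let ?i = "j(l + 1 := c)"
    have "perm_sign m V \<sigma> ?i = perm_sign m ?V ?\<pi> ?i + parity m c"
      unfolding \<tau>_def by (subst perm_sign_loop[OF V \<sigma> eq]) simp
    also have "perm_sign m ?V ?\<pi> ?i = perm_sign m ?V ?\<pi> j"
      by (rule perm_sign_cong) (use \<tau>V ne in auto)
    also have "bit_sign (perm_sign m ?V ?\<pi> j + parity m c) =
        bit_sign (parity m c) * (bit_sign (perm_sign m ?V ?\<pi> j) :: (nat \<times> nat) tensor)"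
      by (subst add.commute) (rule bit_sign_add)
    finally have s: "bit_sign (perm_sign m V \<sigma> ?i) =
        bit_sign (parity m c) * (bit_sign (perm_sign m ?V ?\<pi> j) :: (nat \<times> nat) tensor)" .
    have "label_word \<sigma> ?i ?A = label_word ?\<pi> j ?A"
      by (rule label_word_cong) (use V ne in \<open>auto simp: \<tau>v\<close>)
    moreover have "label_word \<sigma> ?i ?B = label_word ?\<pi> j ?B"
      by (rule label_word_cong) (use V ne in \<open>auto simp: \<tau>v\<close>)
    ultimately show ?thesis
      unfolding F_def s using ne[OF V(3)] eq by (simp add: mult.assoc)
  qed
  have "contracted_weight m n V l \<sigma> = (\<Sum>j\<in>?V \<rightarrow>\<^sub>E ?N. \<Sum>c\<in>?N. F (j(l + 1 := c)))"
    unfolding contracted_weight_def F_def by (rule sum_label_insert[OF V(3)])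
  also have "\<dots> = (\<Sum>c\<in>?N. bit_sign (parity m c)) * (\<Sum>j\<in>?V \<rightarrow>\<^sub>E ?N. bit_sign (perm_sign m ?V ?\<pi> j) * ?w j)"
    unfolding F sum_distrib_left sum_distrib_right ..
  also have "(\<Sum>j\<in>?V \<rightarrow>\<^sub>E ?N. bit_sign (perm_sign m ?V ?\<pi> j) * ?w j) = weight m n ?V ?\<pi>"
    unfolding weight_def sorted_list_of_set_split2(2)[OF V] by (simp add: mult.assoc \<tau>l)
  finally show ?thesis
    unfolding sum_parity_sign .
qed

text \<open>The label of a fixed point is independent of all others and does not affect the sign, so
  its sum yields the first Casimir element at position \<open>l\<close> of the word. The assumption
  \<open>central\<close> moves it to the front; it is supplied later by
  \<open>U_central_weight_std_cycle\<close>.\<close>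

lemma weight_fixed_point:
  assumes V: "finite V" "l \<in> V" and \<sigma>: "bij_betw \<sigma> V V" and fixed: "\<sigma> l = l"
    and central: "\<And>p. p \<in> carrier (T_gl m n) \<Longrightarrow>
      U_eq m n (p * (\<Sum>c\<in>{1..m + n}. mat_unit c c)) ((\<Sum>c\<in>{1..m + n}. mat_unit c c) * p)"
  shows "U_eq m n (weight m n V \<sigma>) ((\<Sum>c\<in>{1..m + n}. mat_unit c c) * weight m n (V - {l}) \<sigma>)"
proof -
  let ?A = "sorted_list_of_set (V \<inter> {..<l})" and ?B = "sorted_list_of_set (V \<inter> {l<..})"
  let ?N = "{1..m + n}" and ?V = "V - {l}"
  let ?C = "\<Sum>c\<in>?N. mat_unit c c"
  let ?s = "\<lambda>j. bit_sign (perm_sign m ?V \<sigma> j) :: (nat \<times> nat) tensor"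
  have ne: "\<sigma> v \<noteq> l" if "v \<in> V" "v \<noteq> l" for v
    using \<sigma> that V fixed by (metis bij_betw_imp_inj_on inj_onD)
  have \<sigma>V: "\<sigma> ` ?V \<subseteq> ?V"
    using \<sigma> ne by (auto simp: bij_betw_def)
  have split: "sorted_list_of_set V = ?A @ l # ?B" "sorted_list_of_set ?V = ?A @ ?B"
  proof -
    show "sorted_list_of_set V = ?A @ l # ?B"
      by (rule sorted_list_of_set_split[OF V])
    then show "sorted_list_of_set ?V = ?A @ ?B"
      using V by (simp add: sorted_list_of_set_remove remove1_append)
  qed
  define F where "F = (\<lambda>i. bit_sign (perm_sign m V \<sigma> i) * label_word \<sigma> i (sorted_list_of_set V))"
  have F: "F (j(l := c)) = ?s j * (label_word \<sigma> j ?A * mat_unit c c * label_word \<sigma> j ?B)" for j c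
  proof -
    let ?i = "j(l := c)"
    have "perm_sign m V \<sigma> ?i = perm_sign m ?V \<sigma> ?i"
      by (rule perm_sign_fixed[OF V \<sigma> fixed])
    also have "\<dots> = perm_sign m ?V \<sigma> j"
      by (rule perm_sign_cong) (use ne in auto)
    finally have s: "perm_sign m V \<sigma> ?i = perm_sign m ?V \<sigma> j" .
    have "label_word \<sigma> ?i ?A = label_word \<sigma> j ?A"
      by (rule label_word_cong) (use V ne in auto)
    moreover have "label_word \<sigma> ?i ?B = label_word \<sigma> j ?B"
      by (rule label_word_cong) (use V ne in auto)
    ultimately show ?thesis
      unfolding F_def s split(1) by (simp add: mult.assoc fixed)
  qed
  have 1: "weight m n V \<sigma> = (\<Sum>j\<in>?V \<rightarrow>\<^sub>E ?N. \<Sum>c\<in>?N. F (j(l := c)))"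
    unfolding weight_def F_def by (rule sum_label_insert[OF V(2)])
  have 2: "(\<Sum>c\<in>?N. F (j(l := c))) = ?s j * (label_word \<sigma> j ?A * ?C * label_word \<sigma> j ?B)" for j
    unfolding F by (simp only: sum_distrib_left sum_distrib_right)
  have 3: "?C * weight m n ?V \<sigma> = (\<Sum>j\<in>?V \<rightarrow>\<^sub>E ?N. ?s j * (?C * label_word \<sigma> j ?A * label_word \<sigma> j ?B))"
    unfolding weight_def split(2) label_word_append sum_distrib_left[of ?C]
  proof (intro sum.cong refl)
    fix j
    show "?C * (?s j * (label_word \<sigma> j ?A * label_word \<sigma> j ?B)) =
        ?s j * (?C * label_word \<sigma> j ?A * label_word \<sigma> j ?B)"
      by (simp only: mult.assoc[symmetric] bit_sign_commute[of _ ?C])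
  qed
  show ?thesis
    unfolding 1 2 3
  proof (rule U_eq_sum)
    fix j assume "j \<in> ?V \<rightarrow>\<^sub>E ?N"
    note carrier = label_word_carrier[OF PiE_label_range[OF this] _ \<sigma>V]
    have "label_word \<sigma> j ?A \<in> carrier (T_gl m n)" "label_word \<sigma> j ?B \<in> carrier (T_gl m n)"
      by (rule carrier; use V in auto)+
    then show "U_eq m n (?s j * (label_word \<sigma> j ?A * ?C * label_word \<sigma> j ?B))
        (?s j * (?C * label_word \<sigma> j ?A * label_word \<sigma> j ?B))"
      by (intro U_eq_mult_left U_eq_mult_right central tensor_carrier_bit_sign)
  qed
qed

section \<open>Relabelling and concatenation of weights\<close>

lemma sorted_list_of_set_strict_mono_image:
  fixes g :: "nat \<Rightarrow> nat"
  assumes "finite V" "strict_mono_on V g"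
  shows "sorted_list_of_set (g ` V) = map g (sorted_list_of_set V)"
proof (rule sorted_distinct_set_unique)
  have mono: "g x \<le> g y" if "x \<in> V" "y \<in> V" "x \<le> y" for x y
    using assms(2) that by (metis le_less strict_mono_onD)
  show "sorted (map g (sorted_list_of_set V))"
    unfolding sorted_map using assms(1) mono
    by (intro sorted_wrt_mono_rel[OF _ sorted_sorted_list_of_set]) auto
  show "distinct (map g (sorted_list_of_set V))"
    using assms strict_mono_on_imp_inj_on by (auto simp: distinct_map)
qed (use assms in auto)

lemma weight_relabel:
  assumes V: "finite V" "\<sigma> ` V \<subseteq> V" and g: "strict_mono_on V g"
    and \<pi>: "\<And>x. x \<in> V \<Longrightarrow> \<pi> (g x) = g (\<sigma> x)"
  shows "weight m n (g ` V) \<pi> = weight m n V \<sigma>"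
  unfolding weight_def
proof (rule sum.reindex_bij_witness[of _
      "\<lambda>i. restrict (i \<circ> inv_into V g) (g ` V)" "\<lambda>j. restrict (j \<circ> g) V"])
  have inj: "inj_on g V"
    using g by (rule strict_mono_on_imp_inj_on)
  have \<sigma>V: "\<sigma> x \<in> V" if "x \<in> V" for x
    using V(2) that by blast
  show "restrict (restrict (i \<circ> inv_into V g) (g ` V) \<circ> g) V = i" if "i \<in> V \<rightarrow>\<^sub>E {1..m + n}" for i
    by (rule extensionalityI[of _ V]) (use that inj in \<open>simp_all add: PiE_iff\<close>)
  show "restrict (i \<circ> inv_into V g) (g ` V) \<in> g ` V \<rightarrow>\<^sub>E {1..m + n}" if "i \<in> V \<rightarrow>\<^sub>E {1..m + n}" for i
    using that by (simp add: PiE_iff inj)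
  fix j assume j: "j \<in> g ` V \<rightarrow>\<^sub>E {1..m + n}"
  let ?i = "restrict (j \<circ> g) V"
  show "restrict (?i \<circ> inv_into V g) (g ` V) = j"
    by (rule extensionalityI[of _ "g ` V"]) (use j inj in \<open>auto simp: PiE_iff\<close>)
  show "?i \<in> V \<rightarrow>\<^sub>E {1..m + n}"
    using j by (simp add: PiE_iff)
  have s: "perm_sign m V \<sigma> ?i = perm_sign m (g ` V) \<pi> j"
    by (rule perm_sign_relabel[OF g V(2) \<pi>, symmetric]) auto
  have w: "label_word \<sigma> ?i (sorted_list_of_set V) = label_word \<pi> j (map g (sorted_list_of_set V))"
    unfolding label_word_def map_map
    by (intro arg_cong[of _ _ prod_list] map_cong refl) (use V(1) \<sigma>V \<pi> in simp)
  show "bit_sign (perm_sign m V \<sigma> ?i) * label_word \<sigma> ?i (sorted_list_of_set V) =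
      bit_sign (perm_sign m (g ` V) \<pi> j) * label_word \<pi> j (sorted_list_of_set (g ` V))"
    unfolding s w sorted_list_of_set_strict_mono_image[OF V(1) g] ..
qed

text \<open>The vertices of the second block follow those of the first, so words concatenate and
  labellings split into pairs. The signs multiply, and the second one can be moved past the first
  word.\<close>

lemma weight_concat:
  assumes \<sigma>: "\<sigma> ` {1..k} \<subseteq> {1..k}" and \<rho>: "\<rho> ` {1..j} \<subseteq> {1..j}"
  shows "weight m n {1..k + j} (perm_concat k \<sigma> \<rho>) = weight m n {1..k} \<sigma> * weight m n {1..j} \<rho>"
proof -
  define K J KJ N where "K = {1..k}" and "J = {1..j}" and "KJ = {1..k + j}" and "N = {1..m + n}"
  let ?\<pi> = "perm_concat k \<sigma> \<rho>"
  let ?l = "\<lambda>i. restrict i K" and ?r = "\<lambda>i. restrict (\<lambda>v. i (k + v)) J"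
  have \<sigma>K: "\<sigma> v \<in> K" if "v \<in> K" for v
    using \<sigma> that unfolding K_def by blast
  have \<rho>J: "\<rho> v \<in> J" if "v \<in> J" for v
    using \<rho> that unfolding J_def by blast
  have \<pi>K: "?\<pi> v = \<sigma> v" if "v \<in> K" for v
    using that by (simp add: perm_concat_def K_def)
  have \<pi>J: "?\<pi> (k + v) = k + \<rho> v" if "v \<in> J" for v
    using that by (simp add: perm_concat_def J_def)
  have lists: "set [1..<k + 1] = K" "set [1..<j + 1] = J"
    by (auto simp: K_def J_def)
  have list: "[1..<k + j + 1] = [1..<k + 1] @ map ((+) k) [1..<j + 1]"
    by (rule nth_equalityI) (auto simp: nth_append simp del: upt_Suc)
  have "(\<Sum>i\<in>KJ \<rightarrow>\<^sub>E N. bit_sign (perm_sign m KJ ?\<pi> i) * label_word ?\<pi> i [1..<k + j + 1]) =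
      (\<Sum>(a, b)\<in>(K \<rightarrow>\<^sub>E N) \<times> (J \<rightarrow>\<^sub>E N).
        (bit_sign (perm_sign m K \<sigma> a) * label_word \<sigma> a [1..<k + 1]) *
        (bit_sign (perm_sign m J \<rho> b) * label_word \<rho> b [1..<j + 1]))"
  proof (rule sum.reindex_bij_witness[of _
        "\<lambda>(a, b). restrict (\<lambda>v. if v \<le> k then a v else b (v - k)) KJ" "\<lambda>i. (?l i, ?r i)"])
    fix i assume i: "i \<in> KJ \<rightarrow>\<^sub>E N"
    show "(case (?l i, ?r i) of (a, b) \<Rightarrow> restrict (\<lambda>v. if v \<le> k then a v else b (v - k)) KJ) = i"
      unfolding prod.case
      by (rule extensionalityI[of _ KJ]) (use i in \<open>auto simp: PiE_iff KJ_def K_def J_def\<close>)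
    show "(?l i, ?r i) \<in> (K \<rightarrow>\<^sub>E N) \<times> (J \<rightarrow>\<^sub>E N)"
      using i by (simp add: PiE_iff KJ_def K_def J_def)
    have "perm_sign m KJ ?\<pi> i = perm_sign m K \<sigma> i + perm_sign m J \<rho> (\<lambda>v. i (k + v))"
      unfolding KJ_def K_def J_def by (rule perm_sign_concat[OF \<sigma> \<rho>])
    also have "perm_sign m K \<sigma> i = perm_sign m K \<sigma> (?l i)"
      by (rule perm_sign_cong) (use \<sigma>K in auto)
    also have "perm_sign m J \<rho> (\<lambda>v. i (k + v)) = perm_sign m J \<rho> (?r i)"
      by (rule perm_sign_cong) (use \<rho>J in auto)
    finally have s: "bit_sign (perm_sign m KJ ?\<pi> i) =
        (bit_sign (perm_sign m K \<sigma> (?l i)) * bit_sign (perm_sign m J \<rho> (?r i)) :: (nat \<times> nat) tensor)"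
      by (simp only: bit_sign_add)
    have w1: "label_word ?\<pi> i [1..<k + 1] = label_word \<sigma> (?l i) [1..<k + 1]"
      by (rule label_word_cong; simp only: lists \<pi>K \<sigma>K restrict_apply' if_True)
    have w2: "label_word ?\<pi> i (map ((+) k) [1..<j + 1]) = label_word \<rho> (?r i) [1..<j + 1]"
      unfolding label_word_def map_map
      by (intro arg_cong[of _ _ prod_list] map_cong refl) (simp only: lists o_apply \<pi>J \<rho>J restrict_apply')
    have commute: "(a * b) * (x * y) = (a * x) * (b * y)" if "b * x = x * b" for a b x y :: "(nat \<times> nat) tensor"
      using that by (metis mult.assoc)
    show "(case (?l i, ?r i) of (a, b) \<Rightarrow>
        (bit_sign (perm_sign m K \<sigma> a) * label_word \<sigma> a [1..<k + 1]) *
        (bit_sign (perm_sign m J \<rho> b) * label_word \<rho> b [1..<j + 1])) =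
        bit_sign (perm_sign m KJ ?\<pi> i) * label_word ?\<pi> i [1..<k + j + 1]"
      unfolding prod.case list label_word_append w1 w2 s
      by (rule commute[symmetric]) (rule bit_sign_commute)
  next
    fix p assume "p \<in> (K \<rightarrow>\<^sub>E N) \<times> (J \<rightarrow>\<^sub>E N)"
    then obtain a b where p: "p = (a, b)" and a: "a \<in> K \<rightarrow>\<^sub>E N" and b: "b \<in> J \<rightarrow>\<^sub>E N"
      by blast
    let ?i = "restrict (\<lambda>v. if v \<le> k then a v else b (v - k)) KJ"
    have "?l ?i = a"
      by (rule extensionalityI[of _ K]) (use a in \<open>auto simp: PiE_iff KJ_def K_def\<close>)
    moreover have "?r ?i = b"
      by (rule extensionalityI[of _ J]) (use b in \<open>auto simp: PiE_iff KJ_def J_def\<close>)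
    ultimately show "(?l (case p of (a, b) \<Rightarrow> restrict (\<lambda>v. if v \<le> k then a v else b (v - k)) KJ),
        ?r (case p of (a, b) \<Rightarrow> restrict (\<lambda>v. if v \<le> k then a v else b (v - k)) KJ)) = p"
      by (simp only: p prod.case)
    have "(if v \<le> k then a v else b (v - k)) \<in> N" if v: "v \<in> KJ" for v
    proof (cases "v \<le> k")
      case True
      then show ?thesis
        using v PiE_mem[OF a, of v] by (simp add: KJ_def K_def)
    next
      case False
      then have "v - k \<in> J"
        using v by (auto simp: KJ_def J_def)
      then show ?thesis
        using False PiE_mem[OF b] by simp
    qed
    then show "(case p of (a, b) \<Rightarrow> restrict (\<lambda>v. if v \<le> k then a v else b (v - k)) KJ) \<in> KJ \<rightarrow>\<^sub>E N"
      unfolding p prod.case by (intro restrict_PiE_iff[THEN iffD2] ballI)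
  qed
  also have "\<dots> = (\<Sum>a\<in>K \<rightarrow>\<^sub>E N. bit_sign (perm_sign m K \<sigma> a) * label_word \<sigma> a [1..<k + 1]) *
      (\<Sum>b\<in>J \<rightarrow>\<^sub>E N. bit_sign (perm_sign m J \<rho> b) * label_word \<rho> b [1..<j + 1])"
    unfolding sum_product sum.cartesian_product ..
  finally show ?thesis
    unfolding weight_def sorted_list_of_set_atLeastAtMost_1 K_def J_def KJ_def N_def .
qed

section \<open>Centrality of the Casimir elements\<close>

text \<open>
  Open paths of length \<open>j + 1\<close> from \<open>a\<close> to \<open>c\<close>; the traces of these matrices are the
  Casimir elements. Up to a sign the matrix entries transform under the adjoint action like the
  matrix units themselves.
\<close>

primrec path_entry :: "nat \<Rightarrow> nat \<Rightarrow> nat \<Rightarrow> nat \<Rightarrow> nat \<Rightarrow> (nat \<times> nat) tensor"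
  where "path_entry m n 0 a c = mat_unit a c"
  | "path_entry m n (Suc j) a c =
      (\<Sum>b\<in>{1..m + n}. bit_sign (parity m b) * (path_entry m n j a b * mat_unit b c))"

lemma path_entry_carrier:
  assumes "a \<in> {1..m + n}" "c \<in> {1..m + n}"
  shows "path_entry m n j a c \<in> carrier (T_gl m n)"
  using assms(2)
proof (induction j arbitrary: c)
  case 0
  then show ?case
    using assms(1) by (simp only: path_entry.simps mat_unit_carrier)
next
  case (Suc j)
  then show ?case
    by (simp only: path_entry.simps)
      (intro tensor_carrier_sum tensor_carrier_mult tensor_carrier_bit_sign mat_unit_carrier Suc)
qed

text \<open>Induction with the super Leibniz rule: the action on a path splits into the action on
  the shorter path and the action on the last matrix unit. The signs
  \<open>bit_sign (parity m b)\<close> at the inner indices are what makes the two contributions at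
  the joint cancel.\<close>

lemma path_entry_commutator:
  assumes "k \<in> {1..m + n}" "l \<in> {1..m + n}" "a \<in> {1..m + n}" "c \<in> {1..m + n}"
  defines "s \<equiv> \<lambda>a c. bit_sign ((parity m k + parity m l) * (parity m a + parity m c))"
  shows "U_eq m n (mat_unit k l * path_entry m n j a c - s a c * (path_entry m n j a c * mat_unit k l))
    ((if l = a then path_entry m n j k c else 0) - s a c * (if k = c then path_entry m n j a l else 0))"
  using assms(4)
proof (induction j arbitrary: c)
  case 0
  show ?case
    unfolding s_def path_entry.simps by (rule U_relation[OF assms(1-3) 0])
next
  case (Suc j)
  define N where "N = {1..m + n}"
  define T where "T = path_entry m n j"
  let ?e = "\<lambda>b. bit_sign (parity m b) :: (nat \<times> nat) tensor"
  let ?E = mat_unit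
  have T': "path_entry m n (Suc j) a c = (\<Sum>b\<in>N. ?e b * (T a b * ?E b c))" for a c
    by (simp add: T_def N_def)
  \<comment> \<open>\<open>X b\<close> is the Leibniz expansion of the commutator with the summand
    for \<open>b\<close>: the terms with \<open>s a b\<close> in the middle cancel, and the outer
    sign is \<open>s a b * s b c = s a c\<close>. \<open>Y b\<close> has both commutators replaced
    by their values.\<close>
  define X where "X = (\<lambda>b. ?e b * ((?E k l * T a b - s a b * (T a b * ?E k l)) * ?E b c)
    + ?e b * (s a b * (T a b * (?E k l * ?E b c - s b c * (?E b c * ?E k l)))))"
  define Y where "Y = (\<lambda>b. ?e b * (((if l = a then T k b else 0) - s a b * (if k = b then T a l else 0)) * ?E b c)
    + ?e b * (s a b * (T a b * ((if l = b then ?E k c else 0) - s b c * (if k = c then ?E b l else 0)))))"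
  have s_mult: "s a b * s b c = s a c" for b
  proof -
    have "(parity m k + parity m l) * (parity m a + parity m c) =
        (parity m k + parity m l) * (parity m a + parity m b) + (parity m k + parity m l) * (parity m b + parity m c)"
      by (simp add: algebra_simps)
    then show ?thesis
      unfolding s_def by (simp only: bit_sign_add)
  qed
  have bit_sign_cases: "bit_sign z = (1 :: (nat \<times> nat) tensor) \<or> bit_sign z = (-1 :: (nat \<times> nat) tensor)" for z
    by (simp add: bit_sign_def)
  then have sgn: "s x y = 1 \<or> s x y = -1" for x y
    unfolding s_def by blast
  have X: "?E k l * (?e b * (T a b * ?E b c)) - s a c * (?e b * (T a b * ?E b c) * ?E k l) = X b" for b
    unfolding X_def s_mult[symmetric, of b]
    using bit_sign_cases[of "parity m b"] sgn[of a b] sgn[of b c]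
    by (elim disjE) (simp_all add: mult.assoc distrib_left distrib_right left_diff_distrib right_diff_distrib)
  \<comment> \<open>The first and the last piece sum to the path entries of the claim. The two
    middle pieces live at \<open>b = k\<close> and \<open>b = l\<close> only.\<close>
  have Y: "Y b = ?e b * ((if l = a then T k b else 0) * ?E b c)
      - (if k = b then ?e k * s a k * (T a l * ?E k c) else 0)
      + (if l = b then ?e l * s a l * (T a l * ?E k c) else 0)
      - s a c * (?e b * (T a b * (if k = c then ?E b l else 0)))" for b
    unfolding Y_def s_mult[symmetric, of b]
    using bit_sign_cases[of "parity m b"] sgn[of a b] sgn[of b c]
    by (cases "k = b"; cases "l = b"; elim disjE)
      (simp_all add: mult.assoc distrib_left distrib_right left_diff_distrib right_diff_distrib)
  have XY: "U_eq m n (X b) (Y b)" if b: "b \<in> N" for b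
  proof -
    have N: "b \<in> {1..m + n}"
      using b by (simp only: N_def)
    have Tc: "T a b \<in> carrier (T_gl m n)"
      unfolding T_def by (rule path_entry_carrier[OF assms(3) N])
    have sc: "s x y \<in> carrier (T_gl m n)" for x y
      unfolding s_def by (rule tensor_carrier_bit_sign)
    show ?thesis
      unfolding X_def Y_def
      by (intro U_eq_add U_eq_mult_left U_eq_mult_right tensor_carrier_bit_sign sc Tc
          mat_unit_carrier N Suc.prems Suc.IH[OF N, folded T_def])
        (use U_relation[OF assms(1,2) N Suc.prems] in \<open>simp only: s_def\<close>)
  qed
  \<comment> \<open>With p and q the parities of \<open>k\<close> and \<open>l\<close>, the
    exponents differ by (p + q) + (p + q)(p + q), which is 0 in characteristic 2.\<close>
  have cancel: "?e k * s a k = ?e l * s a l"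
    unfolding s_def bit_sign_add[symmetric]
    by (cases "parity m k"; cases "parity m l"; cases "parity m a") simp_all
  have "mat_unit k l * path_entry m n (Suc j) a c - s a c * (path_entry m n (Suc j) a c * mat_unit k l) = (\<Sum>b\<in>N. X b)"
    unfolding T' sum_distrib_left sum_distrib_right sum_subtractf[symmetric] X ..
  also have "U_eq m n (\<Sum>b\<in>N. X b) (\<Sum>b\<in>N. Y b)"
    by (rule U_eq_sum) (rule XY)
  also have "(\<Sum>b\<in>N. Y b) = (\<Sum>b\<in>N. ?e b * ((if l = a then T k b else 0) * ?E b c))
      - ?e k * s a k * (T a l * ?E k c) + ?e l * s a l * (T a l * ?E k c)
      - s a c * (\<Sum>b\<in>N. ?e b * (T a b * (if k = c then ?E b l else 0)))"
  proof -
    have "(\<Sum>b\<in>N. if k = b then z else 0) = z" "(\<Sum>b\<in>N. if l = b then z else 0) = z" for z :: "(nat \<times> nat) tensor"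
      using assms(1,2) by (simp_all add: N_def)
    then show ?thesis
      unfolding Y sum.distrib sum_subtractf sum_distrib_left by (simp only:)
  qed
  also have "\<dots> = (if l = a then path_entry m n (Suc j) k c else 0) - s a c * (if k = c then path_entry m n (Suc j) a l else 0)"
    unfolding cancel T' by simp
  finally show ?case .
qed

definition U_central :: "nat \<Rightarrow> nat \<Rightarrow> (nat \<times> nat) tensor \<Rightarrow> bool"
  where "U_central m n z \<longleftrightarrow> (\<forall>p\<in>carrier (T_gl m n). U_eq m n (p * z) (z * p))"

text \<open>The matrix units generate the tensor algebra over the central constants: commutation
  passes letter by letter to words and then additively to all elements.\<close>

lemma U_centralI:
  assumes z: "z \<in> carrier (T_gl m n)"
    and gen: "\<And>k l. k \<in> {1..m + n} \<Longrightarrow> l \<in> {1..m + n} \<Longrightarrow> U_eq m n (mat_unit k l * z) (z * mat_unit k l)"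
  shows "U_central m n z"
  unfolding U_central_def
proof
  have word: "U_eq m n (Poly_Mapping.single (FWord us) c * z) (z * Poly_Mapping.single (FWord us) c)"
    if "set us \<subseteq> gl_basis m n" for us c
    using that
  proof (induction us)
    case Nil
    have "Poly_Mapping.single (FWord []) c = (tensor_const c :: (nat \<times> nat) tensor)"
      by (simp add: tensor_const_def zero_fword_def)
    then show ?case
      by (simp only: tensor_const_mult U_eq_refl)
  next
    case (Cons a us)
    obtain k l where a: "a = (k, l)"
      by (cases a)
    then have kl: "k \<in> {1..m + n}" "l \<in> {1..m + n}" and us: "set us \<subseteq> gl_basis m n"
      using Cons.prems by (auto simp: gl_basis_def)
    let ?w = "Poly_Mapping.single (FWord us) c"
    have w: "?w \<in> carrier (T_gl m n)"
      using us by (simp add: carrier_tensor_algebra)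
    have eq: "Poly_Mapping.single (FWord (a # us)) c = mat_unit k l * ?w"
      by (simp add: a mat_unit_eq mult_single plus_fword_def)
    have "U_eq m n (mat_unit k l * (?w * z)) (mat_unit k l * (z * ?w))"
      by (intro U_eq_mult_left mat_unit_carrier kl Cons.IH us)
    also have "mat_unit k l * (z * ?w) = mat_unit k l * z * ?w"
      by (simp only: mult.assoc)
    also have "U_eq m n (mat_unit k l * z * ?w) (z * mat_unit k l * ?w)"
      by (intro U_eq_mult_right gen kl w)
    finally show ?case
      unfolding eq by (simp only: mult.assoc)
  qed
  fix p assume p: "p \<in> carrier (T_gl m n)"
  have "U_eq m n ((\<Sum>u\<in>Poly_Mapping.keys p. Poly_Mapping.single u (Poly_Mapping.lookup p u)) * z)
      (z * (\<Sum>u\<in>Poly_Mapping.keys p. Poly_Mapping.single u (Poly_Mapping.lookup p u)))"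
    unfolding sum_distrib_left sum_distrib_right
  proof (rule U_eq_sum)
    fix u assume "u \<in> Poly_Mapping.keys p"
    then have "set (letters u) \<subseteq> gl_basis m n"
      using p by (simp add: carrier_tensor_algebra)
    from word[OF this] show "U_eq m n (Poly_Mapping.single u (Poly_Mapping.lookup p u) * z)
        (z * Poly_Mapping.single u (Poly_Mapping.lookup p u))"
      by simp
  qed
  then show "U_eq m n (p * z) (z * p)"
    by (simp only: poly_mapping_sum_single[symmetric])
qed

text \<open>For a closed path the sign \<open>s a a\<close> is 1, so
  \<open>path_entry_commutator\<close> gives ordinary commutators. Summed over \<open>a\<close>, its
  two boundary terms are both the entry from \<open>k\<close> to \<open>l\<close> and
  cancel.\<close>

lemma U_central_trace: "U_central m n (\<Sum>a\<in>{1..m + n}. path_entry m n j a a)"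
proof (rule U_centralI)
  show "(\<Sum>a\<in>{1..m + n}. path_entry m n j a a) \<in> carrier (T_gl m n)"
    by (intro tensor_carrier_sum path_entry_carrier)
  fix k l assume kl: "k \<in> {1..m + n}" "l \<in> {1..m + n}"
  let ?T = "path_entry m n j" and ?E = "mat_unit k l"
  have "U_eq m n (\<Sum>a\<in>{1..m + n}. ?E * ?T a a - ?T a a * ?E)
      (\<Sum>a\<in>{1..m + n}. (if l = a then ?T k a else 0) - (if k = a then ?T a l else 0))"
  proof (rule U_eq_sum)
    fix a assume "a \<in> {1..m + n}"
    from path_entry_commutator[OF kl this this, of j]
    show "U_eq m n (?E * ?T a a - ?T a a * ?E) ((if l = a then ?T k a else 0) - (if k = a then ?T a l else 0))"
      by simp
  qed
  also have "(\<Sum>a\<in>{1..m + n}. (if l = a then ?T k a else 0) - (if k = a then ?T a l else 0)) = 0"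
    using kl by (simp add: sum_subtractf)
  finally show "U_eq m n (?E * (\<Sum>a\<in>{1..m + n}. ?T a a)) ((\<Sum>a\<in>{1..m + n}. ?T a a) * ?E)"
    unfolding U_eq_def by (simp add: sum_distrib_left sum_distrib_right sum_subtractf)
qed

text \<open>A path is the word of the successor map on the vertices from 1 to \<open>j + 1\<close>.
  The labels at 1 and \<open>j + 2\<close> are pinned to the ends of the path; only the inner labels
  are summed and signed.\<close>

lemma path_entry_eq_sum:
  "path_entry m n j a c = (\<Sum>i\<in>{2..j + 1} \<rightarrow>\<^sub>E {1..m + n}.
    bit_sign (\<Sum>t\<in>{2..j + 1}. parity m (i t)) * label_word Suc (i(1 := a, j + 2 := c)) [1..<j + 2])"
proof (induction j arbitrary: c)
  case 0
  have "[1..<0 + 2] = [1::nat]"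
    by (simp add: upt_rec)
  then show ?case
    by (simp add: numeral_2_eq_2)
next
  case (Suc j)
  let ?N = "{1..m + n}" and ?I = "{2..j + 1} \<rightarrow>\<^sub>E {1..m + n}"
  let ?F = "\<lambda>i. bit_sign (\<Sum>t\<in>{2..Suc j + 1}. parity m (i t)) *
    label_word Suc (i(1 := a, Suc j + 2 := c)) [1..<Suc j + 2]"
  let ?G = "\<lambda>i b. bit_sign (\<Sum>t\<in>{2..j + 1}. parity m (i t)) *
    label_word Suc (i(1 := a, j + 2 := b)) [1..<j + 2] :: (nat \<times> nat) tensor"
  have I: "{2..Suc j + 1} - {j + 2} = {2..j + 1}"
    by auto
  have F: "?F (i(j + 2 := b)) = bit_sign (parity m b) * (?G i b * mat_unit b c)" for i b
  proof -
    have "{2..Suc j + 1} = insert (j + 2) {2..j + 1}"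
      by auto
    then have "(\<Sum>t\<in>{2..Suc j + 1}. parity m ((i(j + 2 := b)) t)) =
        parity m b + (\<Sum>t\<in>{2..j + 1}. parity m ((i(j + 2 := b)) t))"
      by (simp only:) (subst sum.insert, auto)
    also have "(\<Sum>t\<in>{2..j + 1}. parity m ((i(j + 2 := b)) t)) = (\<Sum>t\<in>{2..j + 1}. parity m (i t))"
      by (intro sum.cong refl) auto
    finally have s: "(\<Sum>t\<in>{2..Suc j + 1}. parity m ((i(j + 2 := b)) t)) =
        parity m b + (\<Sum>t\<in>{2..j + 1}. parity m (i t))" .
    have "[1..<Suc j + 2] = [1..<j + 2] @ [j + 2]"
      by simp
    moreover have "label_word Suc (i(j + 2 := b, 1 := a, Suc j + 2 := c)) [1..<j + 2] =
        label_word Suc (i(1 := a, j + 2 := b)) [1..<j + 2]"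
      by (rule label_word_cong) auto
    ultimately have w: "label_word Suc (i(j + 2 := b, 1 := a, Suc j + 2 := c)) [1..<Suc j + 2] =
        label_word Suc (i(1 := a, j + 2 := b)) [1..<j + 2] * mat_unit b c"
      by (simp del: upt_Suc)
    show ?thesis
      unfolding s w bit_sign_add by (simp only: mult.assoc)
  qed
  have "(\<Sum>i\<in>{2..Suc j + 1} \<rightarrow>\<^sub>E ?N. ?F i) = (\<Sum>i\<in>?I. \<Sum>b\<in>?N. ?F (i(j + 2 := b)))"
    by (subst sum_label_insert[of "j + 2"]) (simp, simp only: I)
  also have "\<dots> = (\<Sum>b\<in>?N. \<Sum>i\<in>?I. bit_sign (parity m b) * (?G i b * mat_unit b c))"
    unfolding F by (rule sum.swap)
  also have "\<dots> = (\<Sum>b\<in>?N. bit_sign (parity m b) * ((\<Sum>i\<in>?I. ?G i b) * mat_unit b c))"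
    by (simp only: sum_distrib_left sum_distrib_right)
  also have "\<dots> = path_entry m n (Suc j) a c"
    unfolding path_entry.simps Suc.IH ..
  finally show ?case ..
qed

text \<open>The cycle is cut at the edge entering vertex 1. Its label \<open>a\<close> then appears
  at both ends of an open path, once as label 1 and once as label \<open>j + 2\<close>.\<close>

lemma weight_std_cycle:
  "weight m n {1..j + 1} (std_cycle (j + 1)) = (\<Sum>a\<in>{1..m + n}. path_entry m n j a a)"
proof -
  let ?N = "{1..m + n}" and ?I = "{2..j + 1} \<rightarrow>\<^sub>E {1..m + n}"
  let ?F = "\<lambda>i. bit_sign (perm_sign m {1..j + 1} (std_cycle (j + 1)) i) *
    label_word (std_cycle (j + 1)) i [1..<(j + 1) + 1] :: (nat \<times> nat) tensor"
  have I: "{1..j + 1} - {1} = {2..j + 1}"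
    by auto
  have F: "?F (i(1 := a)) = bit_sign (\<Sum>t\<in>{2..j + 1}. parity m (i t)) *
      label_word Suc (i(1 := a, j + 2 := a)) [1..<j + 2]" for i a
  proof -
    have s: "perm_sign m {1..j + 1} (std_cycle (j + 1)) (i(1 := a)) = (\<Sum>t\<in>{2..j + 1}. parity m (i t))"
      by (subst perm_sign_std_cycle) (auto intro!: sum.cong)
    have "label_word (std_cycle (j + 1)) (i(1 := a)) [1..<j + 2] =
        label_word Suc (i(1 := a, j + 2 := a)) [1..<j + 2]"
      by (rule label_word_cong) (auto simp: std_cycle_def)
    moreover have "(j + 1) + 1 = j + 2"
      by simp
    ultimately show ?thesis
      unfolding s by (simp only:)
  qed
  have "weight m n {1..j + 1} (std_cycle (j + 1)) = (\<Sum>i\<in>{1..j + 1} \<rightarrow>\<^sub>E ?N. ?F i)"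
    unfolding weight_def sorted_list_of_set_atLeastAtMost_1 ..
  also have "\<dots> = (\<Sum>i\<in>?I. \<Sum>a\<in>?N. ?F (i(1 := a)))"
    by (subst sum_label_insert[of 1]) (simp, simp only: I)
  also have "\<dots> = (\<Sum>a\<in>?N. path_entry m n j a a)"
    unfolding F path_entry_eq_sum by (rule sum.swap)
  finally show ?thesis .
qed

lemma casimir_eq_weight:
  assumes "j \<ge> 1"
  shows "casimir m n j = U_proj m n (weight m n {1..j} (std_cycle j))"
proof -
  have "(-1) ^ (\<Sum>t\<in>{2..j}. par m (i t)) *
      prod_list (map (\<lambda>t. mat_unit (i t) (i (if t = j then 1 else t + 1))) [1..<j + 1]) =
      bit_sign (perm_sign m {1..j} (std_cycle j) i) * label_word (std_cycle j) i [1..<j + 1]" for i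
  proof -
    have "perm_sign m {1..j} (std_cycle j) i = of_nat (\<Sum>t\<in>{2..j}. par m (i t))"
      using perm_sign_std_cycle[OF assms] by (simp add: parity_def)
    then have "bit_sign (perm_sign m {1..j} (std_cycle j) i) =
        ((-1) ^ (\<Sum>t\<in>{2..j}. par m (i t)) :: (nat \<times> nat) tensor)"
      by (simp only: bit_sign_of_nat)
    moreover have "prod_list (map (\<lambda>t. mat_unit (i t) (i (if t = j then 1 else t + 1))) [1..<j + 1]) =
        label_word (std_cycle j) i [1..<j + 1]"
      unfolding label_word_def
      by (intro arg_cong[of _ _ prod_list] map_cong refl) (auto simp: std_cycle_def)
    ultimately show ?thesis
      by (simp only:)
  qed
  then show ?thesis
    unfolding casimir_def weight_def sorted_list_of_set_atLeastAtMost_1 by (simp only:)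
qed

lemma U_central_weight_std_cycle: "j \<ge> 1 \<Longrightarrow> U_central m n (weight m n {1..j} (std_cycle j))"
  using U_central_trace[of m n "j - 1"] weight_std_cycle[of m n "j - 1"] by simp

section \<open>Homomorphisms from the polynomial ring\<close>

lemma class_ring_simps [simp]:
  "carrier class_ring = UNIV" "x \<otimes>\<^bsub>class_ring\<^esub> y = x * y" "x \<oplus>\<^bsub>class_ring\<^esub> y = x + y"
  "\<one>\<^bsub>class_ring\<^esub> = 1" "\<zero>\<^bsub>class_ring\<^esub> = 0"
  by (simp_all add: class_ring_def)

lemma cpoly_hom_unique:
  assumes "\<Phi> \<in> ring_hom class_ring Z" "\<Psi> \<in> ring_hom class_ring Z"
    and const: "\<And>c. \<Phi> (poly_const c) = \<Psi> (poly_const c)"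
    and var: "\<And>j. \<Phi> (C_var j) = \<Psi> (C_var j)"
  shows "\<Phi> = \<Psi>"
proof
  have mult: "\<Phi> (p * q) = \<Psi> (p * q)" if "\<Phi> p = \<Psi> p" "\<Phi> q = \<Psi> q" for p q
    using ring_hom_mult[OF assms(1), of p q] ring_hom_mult[OF assms(2), of p q] that by simp
  have plus: "\<Phi> (p + q) = \<Psi> (p + q)" if "\<Phi> p = \<Psi> p" "\<Phi> q = \<Psi> q" for p q
    using ring_hom_add[OF assms(1), of p q] ring_hom_add[OF assms(2), of p q] that by simp
  have one: "\<Phi> 1 = \<Psi> 1"
    using const[of 1] by (simp add: poly_const_def)
  have mono: "\<Phi> (Poly_Mapping.single \<mu> 1) = \<Psi> (Poly_Mapping.single \<mu> 1)" for \<mu> :: "nat \<Rightarrow>\<^sub>0 nat"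
  proof (induction \<mu> rule: poly_mapping_induct)
    case zero
    then show ?case
      using one by simp
  next
    case (single j e)
    show ?case
    proof (induction e)
      case 0
      then show ?case
        using one by simp
    next
      case (Suc e)
      have "Poly_Mapping.single (Poly_Mapping.single j (Suc e)) 1 =
          C_var j * (Poly_Mapping.single (Poly_Mapping.single j e) 1 :: cpoly)"
        by (simp add: C_var_def mult_single flip: single_add)
      then show ?case
        using mult[OF var Suc] by (simp only:)
    qed
  next
    case (add \<mu> \<nu>)
    have "Poly_Mapping.single (\<mu> + \<nu>) 1 = (Poly_Mapping.single \<mu> 1 * Poly_Mapping.single \<nu> 1 :: cpoly)"
      by (simp add: mult_single)
    then show ?case
      using mult[OF add] by (simp only:)
  qed
  fix p
  show "\<Phi> p = \<Psi> p"
  proof (induction p rule: poly_mapping_induct)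
    case zero
    have zero: "(0 :: cpoly) = poly_const 0"
      by (simp add: poly_const_def)
    show ?case
      unfolding zero by (rule const)
  next
    case (single \<mu> c)
    have "Poly_Mapping.single \<mu> c = poly_const c * (Poly_Mapping.single \<mu> 1 :: cpoly)"
      by (simp add: poly_const_def mult_single)
    then show ?case
      using mult[OF const mono] by (simp only:)
  next
    case (add p q)
    then show ?case
      by (rule plus)
  qed
qed

section \<open>Evaluation homomorphisms into a commutative ring\<close>

context cring
begin

definition monomial_value :: "(nat \<Rightarrow> 'a) \<Rightarrow> (nat \<Rightarrow>\<^sub>0 nat) \<Rightarrow> 'a"
  where "monomial_value v \<mu> = (\<Otimes>j\<in>Poly_Mapping.keys \<mu>. v j [^] Poly_Mapping.lookup \<mu> j)"

text \<open>The evaluation homomorphism with the variables sent to \<open>v\<close>. The target is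
  only a ring with a carrier, so its complex scalars are supplied by a separate ring homomorphism
  \<open>h\<close>.\<close>

definition poly_value :: "(complex \<Rightarrow> 'a) \<Rightarrow> (nat \<Rightarrow> 'a) \<Rightarrow> cpoly \<Rightarrow> 'a"
  where "poly_value h v p =
    (\<Oplus>\<mu>\<in>Poly_Mapping.keys p. h (Poly_Mapping.lookup p \<mu>) \<otimes> monomial_value v \<mu>)"

context
  fixes h :: "complex \<Rightarrow> 'a" and v :: "nat \<Rightarrow> 'a"
  assumes h: "h \<in> ring_hom class_ring R" and v: "\<And>j. v j \<in> carrier R"
begin

lemma h_hom: "h c \<in> carrier R" "h 0 = \<zero>" "h 1 = \<one>" "h (c + d) = h c \<oplus> h d" "h (c * d) = h c \<otimes> h d"
proof -
  show "h c \<in> carrier R" for c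
    using ring_hom_closed[OF h] by simp
  show add: "h (c + d) = h c \<oplus> h d" for c d
    using ring_hom_add[OF h, of c d] by simp
  show "h 1 = \<one>"
    using ring_hom_one[OF h] by simp
  show "h (c * d) = h c \<otimes> h d"
    using ring_hom_mult[OF h, of c d] by simp
  show "h 0 = \<zero>"
    using add[of 0 0] \<open>h 0 \<in> carrier R\<close> by (metis add.l_cancel_one' add_0_left)
qed

lemma monomial_value_closed: "monomial_value v \<mu> \<in> carrier R"
  unfolding monomial_value_def by (rule finprod_closed) (simp add: v)

lemma monomial_value_superset:
  assumes "finite K" "Poly_Mapping.keys \<mu> \<subseteq> K"
  shows "monomial_value v \<mu> = (\<Otimes>j\<in>K. v j [^] Poly_Mapping.lookup \<mu> j)"
  unfolding monomial_value_def
  by (rule finprod_mono_neutral_cong_left) (use assms v in \<open>auto simp: in_keys_iff\<close>)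

lemma monomial_value_add:
  "monomial_value v (\<mu> + \<nu>) = monomial_value v \<mu> \<otimes> monomial_value v \<nu>"
proof -
  let ?K = "Poly_Mapping.keys \<mu> \<union> Poly_Mapping.keys \<nu>"
  have "monomial_value v (\<mu> + \<nu>) = (\<Otimes>j\<in>?K. v j [^] Poly_Mapping.lookup (\<mu> + \<nu>) j)"
    by (rule monomial_value_superset) (use keys_add[of \<mu> \<nu>] in auto)
  also have "\<dots> = (\<Otimes>j\<in>?K. v j [^] Poly_Mapping.lookup \<mu> j \<otimes> v j [^] Poly_Mapping.lookup \<nu> j)"
    by (simp add: lookup_add nat_pow_mult v)
  also have "\<dots> = (\<Otimes>j\<in>?K. v j [^] Poly_Mapping.lookup \<mu> j) \<otimes> (\<Otimes>j\<in>?K. v j [^] Poly_Mapping.lookup \<nu> j)"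
    by (rule finprod_multf) (auto simp: v)
  also have "\<dots> = monomial_value v \<mu> \<otimes> monomial_value v \<nu>"
    by (subst (1 2) monomial_value_superset[of ?K, symmetric]) auto
  finally show ?thesis .
qed

lemma poly_value_superset:
  assumes "finite K" "Poly_Mapping.keys p \<subseteq> K"
  shows "poly_value h v p = (\<Oplus>\<mu>\<in>K. h (Poly_Mapping.lookup p \<mu>) \<otimes> monomial_value v \<mu>)"
  unfolding poly_value_def
  by (rule add.finprod_mono_neutral_cong_left)
    (use assms monomial_value_closed h_hom in \<open>auto simp: in_keys_iff\<close>)

lemma poly_value_closed: "poly_value h v p \<in> carrier R"
  unfolding poly_value_def by (rule finsum_closed) (auto simp: monomial_value_closed h_hom)

lemma poly_value_add: "poly_value h v (p + q) = poly_value h v p \<oplus> poly_value h v q"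
proof -
  let ?K = "Poly_Mapping.keys p \<union> Poly_Mapping.keys q"
  have "poly_value h v (p + q) = (\<Oplus>\<mu>\<in>?K. h (Poly_Mapping.lookup (p + q) \<mu>) \<otimes> monomial_value v \<mu>)"
    by (rule poly_value_superset) (use keys_add[of p q] in auto)
  also have "\<dots> = (\<Oplus>\<mu>\<in>?K. h (Poly_Mapping.lookup p \<mu>) \<otimes> monomial_value v \<mu> \<oplus>
      h (Poly_Mapping.lookup q \<mu>) \<otimes> monomial_value v \<mu>)"
    by (simp add: lookup_add h_hom l_distr monomial_value_closed)
  also have "\<dots> = (\<Oplus>\<mu>\<in>?K. h (Poly_Mapping.lookup p \<mu>) \<otimes> monomial_value v \<mu>) \<oplus>
      (\<Oplus>\<mu>\<in>?K. h (Poly_Mapping.lookup q \<mu>) \<otimes> monomial_value v \<mu>)"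
    by (rule finsum_addf) (auto simp: monomial_value_closed h_hom)
  also have "\<dots> = poly_value h v p \<oplus> poly_value h v q"
    by (subst (1 2) poly_value_superset[of ?K, symmetric]) auto
  finally show ?thesis .
qed

lemma poly_value_single: "poly_value h v (Poly_Mapping.single \<mu> c) = h c \<otimes> monomial_value v \<mu>"
  by (subst poly_value_superset[of "{\<mu>}"]) (auto simp: monomial_value_closed h_hom)

lemma poly_value_0: "poly_value h v 0 = \<zero>"
  by (simp add: poly_value_def)

lemma poly_value_mult: "poly_value h v (p * q) = poly_value h v p \<otimes> poly_value h v q"
proof (induction p rule: poly_mapping_induct)
  case zero
  then show ?case
    by (simp add: poly_value_0 poly_value_closed)
next
  case (single \<mu> c)
  show ?case
  proof (induction q rule: poly_mapping_induct)
    case zero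
    then show ?case
      by (simp add: poly_value_0 poly_value_closed)
  next
    case (single \<nu> d)
    show ?case
      by (simp add: mult_single poly_value_single monomial_value_add h_hom monomial_value_closed m_ac)
  next
    case (add p q)
    then show ?case
      by (simp add: distrib_left poly_value_add r_distr poly_value_closed)
  qed
next
  case (add p p')
  then show ?case
    by (simp add: distrib_right poly_value_add l_distr poly_value_closed)
qed

lemma cpoly_hom_exists:
  "\<exists>\<Phi>\<in>ring_hom class_ring R. (\<forall>c. \<Phi> (poly_const c) = h c) \<and> (\<forall>j. \<Phi> (C_var j) = v j)"
proof (rule bexI[of _ "poly_value h v"])
  have mon0: "monomial_value v 0 = \<one>"
    by (simp add: monomial_value_def)
  have const: "poly_value h v (poly_const c) = h c" for c
    by (simp add: poly_const_def poly_value_single mon0 h_hom)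
  have mon1: "monomial_value v (Poly_Mapping.single j 1) = v j" for j
    by (subst monomial_value_superset[of "{j}"]) (auto simp: v)
  then show "(\<forall>c. poly_value h v (poly_const c) = h c) \<and> (\<forall>j. poly_value h v (C_var j) = v j)"
    using const by (simp add: C_var_def poly_value_single h_hom v)
  have "poly_value h v 1 = \<one>"
    using const[of 1] by (simp add: poly_const_def h_hom)
  then show "poly_value h v \<in> ring_hom class_ring R"
    by (intro ring_hom_memI) (simp_all add: poly_value_closed poly_value_mult poly_value_add)
qed

end

end

section \<open>The center of the universal enveloping algebra\<close>

lemma center_ring_simps [simp]:
  "x \<otimes>\<^bsub>center_ring R\<^esub> y = x \<otimes>\<^bsub>R\<^esub> y" "x \<oplus>\<^bsub>center_ring R\<^esub> y = x \<oplus>\<^bsub>R\<^esub> y"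
  "\<one>\<^bsub>center_ring R\<^esub> = \<one>\<^bsub>R\<^esub>" "\<zero>\<^bsub>center_ring R\<^esub> = \<zero>\<^bsub>R\<^esub>"
  by (simp_all add: center_ring_def)

lemma carrier_center_ring:
  "z \<in> carrier (center_ring R) \<longleftrightarrow> z \<in> carrier R \<and> (\<forall>x\<in>carrier R. z \<otimes>\<^bsub>R\<^esub> x = x \<otimes>\<^bsub>R\<^esub> z)"
  by (simp add: center_ring_def)

lemma cring_center_ring:
  assumes "ring R"
  shows "cring (center_ring R)"
proof -
  interpret ring R by (rule assms)
  let ?H = "{z \<in> carrier R. \<forall>x\<in>carrier R. z \<otimes>\<^bsub>R\<^esub> x = x \<otimes>\<^bsub>R\<^esub> z}"
  have "subring ?H R"
  proof (rule subringI)
    show "\<ominus>\<^bsub>R\<^esub> a \<in> ?H" if "a \<in> ?H" for a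
      using that by (auto simp: l_minus r_minus)
    show "a \<otimes>\<^bsub>R\<^esub> b \<in> ?H" if "a \<in> ?H" "b \<in> ?H" for a b
    proof -
      have ab: "a \<in> carrier R" "b \<in> carrier R"
        using that by simp_all
      have "(a \<otimes>\<^bsub>R\<^esub> b) \<otimes>\<^bsub>R\<^esub> x = x \<otimes>\<^bsub>R\<^esub> (a \<otimes>\<^bsub>R\<^esub> b)" if x: "x \<in> carrier R" for x
      proof -
        have "(a \<otimes>\<^bsub>R\<^esub> b) \<otimes>\<^bsub>R\<^esub> x = a \<otimes>\<^bsub>R\<^esub> (b \<otimes>\<^bsub>R\<^esub> x)"
          by (rule m_assoc[OF ab x])
        also have "b \<otimes>\<^bsub>R\<^esub> x = x \<otimes>\<^bsub>R\<^esub> b"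
          using \<open>b \<in> ?H\<close> x by simp
        also have "a \<otimes>\<^bsub>R\<^esub> (x \<otimes>\<^bsub>R\<^esub> b) = (a \<otimes>\<^bsub>R\<^esub> x) \<otimes>\<^bsub>R\<^esub> b"
          by (rule m_assoc[OF ab(1) x ab(2), symmetric])
        also have "a \<otimes>\<^bsub>R\<^esub> x = x \<otimes>\<^bsub>R\<^esub> a"
          using \<open>a \<in> ?H\<close> x by simp
        also have "(x \<otimes>\<^bsub>R\<^esub> a) \<otimes>\<^bsub>R\<^esub> b = x \<otimes>\<^bsub>R\<^esub> (a \<otimes>\<^bsub>R\<^esub> b)"
          by (rule m_assoc[OF x ab])
        finally show ?thesis .
      qed
      then show ?thesis
        using ab by simp
    qed
    show "a \<oplus>\<^bsub>R\<^esub> b \<in> ?H" if "a \<in> ?H" "b \<in> ?H" for a b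
      using that by (auto simp: l_distr r_distr)
  qed auto
  then have "subcring ?H R"
  proof (rule subcringI)
    show "a \<otimes>\<^bsub>R\<^esub> b = b \<otimes>\<^bsub>R\<^esub> a" if "a \<in> ?H" "b \<in> ?H" for a b
      using that by blast
  qed
  then show ?thesis
    unfolding center_ring_def by (subst (asm) subcring_iff) blast+
qed

lemma ring_U_gl: "ring (U_gl m n)"
  unfolding U_gl_def by (rule ideal.quotient_is_ring[OF ideal_U_ideal])

lemma U_proj_ring_hom: "U_proj m n \<in> ring_hom (T_gl m n) (U_gl m n)"
  using ideal.rcos_ring_hom[OF ideal_U_ideal, of m n] unfolding U_gl_def
  by (simp add: U_proj_def[abs_def])

lemma carrier_U_gl: "carrier (U_gl m n) = U_proj m n ` carrier (T_gl m n)"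
  by (auto simp: U_gl_def FactRing_def A_RCOSETS_def' U_proj_def)

lemma U_proj_hom:
  assumes "p \<in> carrier (T_gl m n)" "q \<in> carrier (T_gl m n)"
  shows "U_proj m n (p * q) = U_proj m n p \<otimes>\<^bsub>U_gl m n\<^esub> U_proj m n q"
    and "U_proj m n (p + q) = U_proj m n p \<oplus>\<^bsub>U_gl m n\<^esub> U_proj m n q"
  using ring_hom_mult[OF U_proj_ring_hom assms] ring_hom_add[OF U_proj_ring_hom assms] by simp_all

lemma U_proj_1: "U_proj m n 1 = \<one>\<^bsub>U_gl m n\<^esub>"
  using ring_hom_one[OF U_proj_ring_hom] by simp

lemma U_proj_center:
  assumes z: "z \<in> carrier (T_gl m n)" and "U_central m n z"
  shows "U_proj m n z \<in> carrier (ZU_gl m n)"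
  unfolding carrier_center_ring carrier_U_gl
proof (intro conjI ballI imageI z)
  fix x assume "x \<in> U_proj m n ` carrier (T_gl m n)"
  then obtain p where p: "p \<in> carrier (T_gl m n)" "x = U_proj m n p"
    by blast
  have "U_eq m n (z * p) (p * z)"
    using assms(2) p(1) by (simp add: U_central_def U_eq_sym)
  then show "U_proj m n z \<otimes>\<^bsub>U_gl m n\<^esub> x = x \<otimes>\<^bsub>U_gl m n\<^esub> U_proj m n z"
    unfolding p(2) U_proj_hom(1)[OF z p(1), symmetric] U_proj_hom(1)[OF p(1) z, symmetric]
    by (subst U_proj_eq_iff) (use z p in auto)
qed

lemma U_central_const: "U_central m n (tensor_const c)"
  unfolding U_central_def by (intro ballI) (simp only: tensor_const_mult U_eq_refl)

lemma std_cycle_image: "std_cycle k ` {1..k} \<subseteq> {1..k}"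
  by (auto simp: std_cycle_def)

lemma casimir_center:
  assumes "j \<ge> 1"
  shows "casimir m n j \<in> carrier (ZU_gl m n)"
  unfolding casimir_eq_weight[OF assms]
  by (intro U_proj_center weight_carrier U_central_weight_std_cycle std_cycle_image assms) simp

text \<open>Since the prescribed values are central, evaluation takes place in the center, which is
  commutative. Uniqueness holds because constants and variables generate the polynomial
  ring.\<close>

lemma casimir_substitution_unique_existence: "\<exists>!\<Phi>. casimir_substitution m n \<Phi>"
proof (rule ex_ex1I)
  interpret Z: cring "ZU_gl m n"
    by (rule cring_center_ring[OF ring_U_gl])
  let ?h = "\<lambda>c. U_proj m n (tensor_const c)"
  let ?v = "\<lambda>j. if j = 0 then U_proj m n (tensor_const (of_nat m - of_nat n)) else casimir m n j"
  have const: "?h c \<in> carrier (ZU_gl m n)" for c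
    by (rule U_proj_center[OF tensor_carrier_const U_central_const])
  have "?h \<in> ring_hom class_ring (ZU_gl m n)"
    by (rule ring_hom_memI) (simp_all add: const tensor_const_hom U_proj_hom U_proj_1)
  moreover have "?v j \<in> carrier (ZU_gl m n)" for j
    using const casimir_center by simp
  ultimately obtain \<Phi> where "\<Phi> \<in> ring_hom class_ring (ZU_gl m n)"
      "\<forall>c. \<Phi> (poly_const c) = ?h c" "\<forall>j. \<Phi> (C_var j) = ?v j"
    using Z.cpoly_hom_exists[of ?h ?v] by blast
  then show "\<exists>\<Phi>. casimir_substitution m n \<Phi>"
    unfolding casimir_substitution_def by (intro exI[of _ \<Phi>]) auto
next
  fix \<Phi> \<Psi> assume \<Phi>: "casimir_substitution m n \<Phi>" and \<Psi>: "casimir_substitution m n \<Psi>"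
  show "\<Phi> = \<Psi>"
  proof (rule cpoly_hom_unique[where Z = "ZU_gl m n"])
    show "\<Phi> (C_var j) = \<Psi> (C_var j)" for j
      using \<Phi> \<Psi> by (cases "j = 0") (simp_all add: casimir_substitution_def)
  qed (use \<Phi> \<Psi> in \<open>simp_all add: casimir_substitution_def\<close>)
qed

section \<open>The recurrence\<close>

lemma permutes_transpose_conj:
  assumes "\<sigma> permutes S" "a \<in> S" "b \<in> S"
  shows "transpose a b \<circ> \<sigma> \<circ> transpose a b permutes S"
  by (intro permutes_compose permutes_swap_id assms)

lemma finite_endo_permutes:
  assumes "finite S" "\<And>x. x \<in> S \<Longrightarrow> p x \<in> S" "\<And>x. x \<notin> S \<Longrightarrow> p x = x" "inj_on p S"
  shows "p permutes S"
proof (rule bij_imp_permutes)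
  show "bij_betw p S S"
    using assms endo_inj_surj[of S p] by (auto simp: bij_betw_def)
qed (use assms(3) in auto)

text \<open>Maps are built on a vertex set with a gap and the gap is closed only here. Since
  \<open>permutes\<close> demands the identity outside the range, the behaviour of \<open>f\<close>
  outside the original range has to be carried along.\<close>

lemma squeeze_conj_permutes:
  assumes V: "V = {1..k} - {v..<v + d}" "1 \<le> v" "v + d \<le> k + 1"
    and f: "\<And>x. x \<in> V \<Longrightarrow> f x \<in> V" "inj_on f V" "\<And>x. x \<notin> {1..k} \<Longrightarrow> f x = x"
  shows "squeeze v d \<circ> f \<circ> unsqueeze v d permutes {1..k - d}"
proof (rule finite_endo_permutes)
  have un: "unsqueeze v d x \<in> V" if "x \<in> {1..k - d}" for x
    using that assms(2,3) unfolding V(1) by (auto simp: unsqueeze_def)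
  have sq: "squeeze v d x \<in> {1..k - d}" if "x \<in> V" for x
    using that assms(2,3) unfolding V(1) by (auto simp: squeeze_def)
  show "(squeeze v d \<circ> f \<circ> unsqueeze v d) x \<in> {1..k - d}" if "x \<in> {1..k - d}" for x
    unfolding o_apply by (intro sq f un that)
  show "(squeeze v d \<circ> f \<circ> unsqueeze v d) x = x" if "x \<notin> {1..k - d}" for x
  proof -
    \<comment> \<open>A point beyond \<open>k - d\<close> is at least \<open>v\<close>, so
      \<open>unsqueeze\<close> shifts it beyond \<open>k\<close>; 0 stays where it is.\<close>
    have "x = 0 \<or> k < x + d"
      using that by auto
    then have out: "unsqueeze v d x \<notin> {1..k}" and id: "squeeze v d (unsqueeze v d x) = x"
      using assms(2,3) by (auto simp: unsqueeze_def squeeze_def)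
    show ?thesis
      unfolding o_apply f(3)[OF out] by (rule id)
  qed
  have sq_inj: "inj_on (squeeze v d) V"
    unfolding V(1) by (auto simp: squeeze_def inj_on_def)
  have un_inj: "inj_on (unsqueeze v d) {1..k - d}"
    by (auto simp: unsqueeze_def inj_on_def)
  show "inj_on (squeeze v d \<circ> f \<circ> unsqueeze v d) {1..k - d}"
  proof (intro comp_inj_on un_inj)
    show "inj_on f (unsqueeze v d ` {1..k - d})"
      by (rule inj_on_subset[OF f(2)]) (use un in auto)
    show "inj_on (squeeze v d) (f ` unsqueeze v d ` {1..k - d})"
      by (rule inj_on_subset[OF sq_inj]) (use un f(1) in auto)
  qed
qed simp

text \<open>\<open>squeeze\<close> is strictly increasing on the vertex set with the gap, so closing
  the gap is an order-preserving relabelling and \<open>weight_relabel\<close> applies.\<close>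

lemma weight_squeeze:
  assumes V: "V = {1..k} - {v..<v + d}" "1 \<le> v" "v + d \<le> k + 1"
    and f: "\<And>x. x \<in> V \<Longrightarrow> f x \<in> V"
  shows "weight m n {1..k - d} (squeeze v d \<circ> f \<circ> unsqueeze v d) = weight m n V f"
proof -
  have un: "unsqueeze v d (squeeze v d x) = x" if "x \<in> V" for x
    using that unfolding V(1) by (auto simp: squeeze_def unsqueeze_def)
  have "squeeze v d ` V = {1..k - d}"
  proof (intro Set.equalityI subsetI)
    show "x \<in> {1..k - d}" if "x \<in> squeeze v d ` V" for x
      using that V(2,3) unfolding V(1) by (auto simp: squeeze_def)
    show "x \<in> squeeze v d ` V" if "x \<in> {1..k - d}" for x
    proof (rule image_eqI)
      show "x = squeeze v d (unsqueeze v d x)" "unsqueeze v d x \<in> V"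
        using that V(2,3) unfolding V(1) by (auto simp: squeeze_def unsqueeze_def)
    qed
  qed
  moreover have "weight m n (squeeze v d ` V) (squeeze v d \<circ> f \<circ> unsqueeze v d) = weight m n V f"
  proof (rule weight_relabel)
    show "finite V"
      unfolding V(1) by simp
    show "f ` V \<subseteq> V"
      using f by blast
    show "strict_mono_on V (squeeze v d)"
      unfolding V(1) by (auto simp: squeeze_def strict_mono_on_def)
    show "(squeeze v d \<circ> f \<circ> unsqueeze v d) (squeeze v d x) = squeeze v d (f x)" if "x \<in> V" for x
      by (simp only: o_apply un that)
  qed
  ultimately show ?thesis
    by (simp only:)
qed

lemma merge_perm_closed:
  assumes \<pi>: "\<pi> permutes V" and ne: "\<pi> (l + 1) \<noteq> l + 1"
  shows "x \<in> V - {l + 1} \<Longrightarrow> merge_perm l \<pi> x \<in> V - {l + 1}"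
    and "inj_on (merge_perm l \<pi>) (V - {l + 1})"
    and "x \<notin> V \<Longrightarrow> l + 1 \<in> V \<Longrightarrow> merge_perm l \<pi> x = x"
proof -
  have in_V: "\<pi> y \<in> V \<longleftrightarrow> y \<in> V" for y
    using \<pi> by (rule permutes_in_image)
  have inj: "\<pi> y = \<pi> z \<longleftrightarrow> y = z" for y z
    using permutes_inj[OF \<pi>] by (simp add: inj_eq)
  show "merge_perm l \<pi> x \<in> V - {l + 1}" if "x \<in> V - {l + 1}"
  proof (cases "\<pi> x = l + 1")
    case True
    then have "l + 1 \<in> V"
      using that in_V[of x] by simp
    then show ?thesis
      using True ne in_V[of "l + 1"] by (simp add: merge_perm_def)
  next
    case False
    then show ?thesis
      using that in_V[of x] by (simp add: merge_perm_def)
  qed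
  show "inj_on (merge_perm l \<pi>) (V - {l + 1})"
  proof (rule inj_onI)
    fix y z assume yz: "y \<in> V - {l + 1}" "z \<in> V - {l + 1}" "merge_perm l \<pi> y = merge_perm l \<pi> z"
    show "y = z"
    proof (cases "\<pi> y = l + 1 \<or> \<pi> z = l + 1")
      case True
      then show ?thesis
        using yz inj[of y z] inj[of y "l + 1"] inj[of "l + 1" z] by (auto simp: merge_perm_def split: if_splits)
    next
      case False
      then show ?thesis
        using yz inj[of y z] by (simp add: merge_perm_def)
    qed
  qed
  show "merge_perm l \<pi> x = x" if "x \<notin> V" "l + 1 \<in> V"
    using permutes_not_in[OF \<pi> that(1)] that by (auto simp: merge_perm_def)
qed

lemma D_perm_eq: "D_perm l \<pi> = squeeze (l + 1) 1 \<circ> merge_perm l \<pi> \<circ> unsqueeze (l + 1) 1"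
  by (simp add: D_perm_def merge_perm_def[abs_def])

context
  fixes k l :: nat and \<sigma> \<tau> \<sigma>' :: "nat \<Rightarrow> nat"
  assumes \<sigma>: "\<sigma> permutes {1..k}" and l: "1 \<le> l" "l < k"
  defines "\<tau> \<equiv> transpose l (l + 1)"
  defines "\<sigma>' \<equiv> \<tau> \<circ> \<sigma> \<circ> \<tau>"
begin

lemma lV: "finite {1..k}" "l \<in> {1..k}" "l + 1 \<in> {1..k}"
  using l by auto

lemma \<tau>_permutes: "\<tau> permutes {1..k}"
  unfolding \<tau>_def by (rule permutes_swap_id) (use l in auto)

lemma \<sigma>'_permutes: "\<sigma>' permutes {1..k}"
  unfolding \<sigma>'_def by (intro permutes_compose \<sigma> \<tau>_permutes)

lemma \<tau>_simps: "\<tau> l = l + 1" "\<tau> (l + 1) = l" "\<tau> (\<tau> x) = x" "x \<noteq> l \<Longrightarrow> x \<noteq> l + 1 \<Longrightarrow> \<tau> x = x"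
  by (simp_all add: \<tau>_def transpose_def)

lemma weight_swap_range:
  "U_eq m n (weight m n {1..k} \<sigma> - weight m n {1..k} \<sigma>')
    (contracted_weight m n {1..k} l \<sigma> - contracted_weight m n {1..k} l \<sigma>')"
  unfolding \<sigma>'_def \<tau>_def by (rule weight_swap[OF lV permutes_imp_bij[OF \<sigma>]])

lemma delete_range: "{1..k} - {l + 1} = {1..k} - {l + 1..<l + 1 + 1}" "1 \<le> l + 1" "l + 1 + 1 \<le> k + 1"
  using l by auto

lemma D_perm_permutes:
  assumes "\<sigma> l \<noteq> l + 1"
  shows "D_perm l (\<sigma> \<circ> \<tau>) permutes {1..k - 1}"
proof -
  have "\<sigma> \<circ> \<tau> permutes {1..k}"
    by (intro permutes_compose \<sigma> \<tau>_permutes)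
  moreover have "(\<sigma> \<circ> \<tau>) (l + 1) \<noteq> l + 1"
    unfolding o_apply \<tau>_simps(2) by (rule assms)
  ultimately show ?thesis
    unfolding D_perm_eq
    by (intro squeeze_conj_permutes[OF delete_range]) (erule (1) merge_perm_closed | use lV in simp)+
qed

lemma contracted_weight_D_perm:
  assumes "\<sigma> l \<noteq> l + 1"
  shows "contracted_weight m n {1..k} l \<sigma> = weight m n {1..k - 1} (D_perm l (\<sigma> \<circ> \<tau>))"
proof -
  have \<pi>: "\<sigma> \<circ> \<tau> permutes {1..k}"
    by (intro permutes_compose \<sigma> \<tau>_permutes)
  have ne: "(\<sigma> \<circ> \<tau>) (l + 1) \<noteq> l + 1"
    unfolding o_apply \<tau>_simps(2) by (rule assms)
  have "weight m n {1..k - 1} (D_perm l (\<sigma> \<circ> \<tau>)) = weight m n ({1..k} - {l + 1}) (merge_perm l (\<sigma> \<circ> \<tau>))"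
    unfolding D_perm_eq by (rule weight_squeeze[OF delete_range]) (rule merge_perm_closed(1)[OF \<pi> ne])
  then show ?thesis
    unfolding \<tau>_def using contracted_weight_merge[OF lV permutes_imp_bij[OF \<sigma>] assms] by simp
qed

section \<open>The exceptional case: an edge from \<open>l + 1\<close> back to
  \<open>l\<close>\<close>

context
  assumes ret: "\<sigma> (l + 1) = l" and ne: "\<sigma> l \<noteq> l + 1"
begin

lemma \<sigma>_facts:
  "k \<ge> 3" "\<sigma> x = l \<longleftrightarrow> x = l + 1" "\<sigma> l \<noteq> l" "\<sigma> l \<in> {1..k}" "x \<in> {1..k} \<Longrightarrow> \<sigma> x \<in> {1..k}"
  "\<sigma> (inv_into UNIV \<sigma> (l + 1)) = l + 1"
  "x = inv_into UNIV \<sigma> (l + 1) \<longleftrightarrow> \<sigma> x = l + 1"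
  "inv_into UNIV \<sigma> (l + 1) \<in> {1..k}"
proof -
  have inj: "\<sigma> y = \<sigma> z \<longleftrightarrow> y = z" for y z
    using permutes_inj[OF \<sigma>] by (simp add: inj_eq)
  have in_V: "\<sigma> y \<in> {1..k} \<longleftrightarrow> y \<in> {1..k}" for y
    using \<sigma> by (rule permutes_in_image)
  show x: "\<sigma> x = l \<longleftrightarrow> x = l + 1" for x
    using inj[of x "l + 1"] ret by simp
  show "\<sigma> l \<noteq> l"
    using x[of l] by simp
  show "\<sigma> l \<in> {1..k}" "x \<in> {1..k} \<Longrightarrow> \<sigma> x \<in> {1..k}"
    using in_V lV by blast+
  show "k \<ge> 3"
  proof (rule ccontr)
    assume "\<not> k \<ge> 3"
    then have "k = 2" "l = 1"
      using l by auto
    then show False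
      using \<open>\<sigma> l \<in> {1..k}\<close> \<open>\<sigma> l \<noteq> l\<close> ne by auto
  qed
  show a: "\<sigma> (inv_into UNIV \<sigma> (l + 1)) = l + 1"
    using permutes_surj[OF \<sigma>] by (intro f_inv_into_f) simp
  show "x = inv_into UNIV \<sigma> (l + 1) \<longleftrightarrow> \<sigma> x = l + 1"
    using inj[of x "inv_into UNIV \<sigma> (l + 1)"] a by simp
  show "inv_into UNIV \<sigma> (l + 1) \<in> {1..k}"
    using in_V[of "inv_into UNIV \<sigma> (l + 1)"] a lV(3) by simp
qed

text \<open>The inner map of \<open>rho_perm\<close> before relabelling, on the vertices other than
  \<open>l\<close> and \<open>l + 1\<close>.\<close>

definition rho_core :: "nat \<Rightarrow> nat"
  where "rho_core x = (if x = inv_into UNIV \<sigma> (l + 1) then \<sigma> l else \<sigma> x)"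

definition rho'_core :: "nat \<Rightarrow> nat"
  where "rho'_core x = (if x = inv_into UNIV \<sigma> (l + 1) then l else if x = l then \<sigma> l else \<sigma> x)"

text \<open>The deletion is written in two stages because it arises in two stages: merging drops
  \<open>l + 1\<close>, then the fixed point \<open>l\<close> is split off.\<close>

lemma delete_range2: "{1..k} - {l + 1} - {l} = {1..k} - {l..<l + 2}" "l + 2 \<le> k + 1"
  using l by auto

lemma rho_core_eq: "rho_core x = (if \<sigma> x = l + 1 then \<sigma> l else \<sigma> x)"
  unfolding rho_core_def \<sigma>_facts(7) ..

lemma rho'_core_eq: "rho'_core x = (if \<sigma> x = l + 1 then l else \<sigma> x)"
  unfolding rho'_core_def \<sigma>_facts(7) by simp

lemma \<sigma>_inj: "\<sigma> y = \<sigma> z \<longleftrightarrow> y = z"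
  using permutes_inj[OF \<sigma>] by (simp add: inj_eq)

lemma \<sigma>_outside: "x \<notin> {1..k} \<Longrightarrow> \<sigma> x = x \<and> \<sigma> x \<noteq> l + 1"
  using permutes_not_in[OF \<sigma>, of x] lV(3) by auto

lemma rho_core:
  "x \<in> {1..k} - {l + 1} - {l} \<Longrightarrow> rho_core x \<in> {1..k} - {l + 1} - {l}"
  "inj_on rho_core ({1..k} - {l + 1} - {l})" "x \<notin> {1..k} \<Longrightarrow> rho_core x = x"
proof -
  show "rho_core x \<in> {1..k} - {l + 1} - {l}" if x: "x \<in> {1..k} - {l + 1} - {l}"
  proof (cases "\<sigma> x = l + 1")
    case True
    then have "rho_core x = \<sigma> l"
      by (simp add: rho_core_eq)
    then show ?thesis
      using ne \<sigma>_facts(3,4) by simp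
  next
    case False
    moreover have "\<sigma> x \<noteq> l" "\<sigma> x \<in> {1..k}"
      using x \<sigma>_facts(2)[of x] \<sigma>_facts(5)[of x] by blast+
    ultimately show ?thesis
      by (simp add: rho_core_eq)
  qed
  show "inj_on rho_core ({1..k} - {l + 1} - {l})"
  proof (rule inj_onI)
    fix y z assume yz: "y \<in> {1..k} - {l + 1} - {l}" "z \<in> {1..k} - {l + 1} - {l}" "rho_core y = rho_core z"
    show "y = z"
      using yz \<sigma>_inj[of y z] \<sigma>_inj[of y l] \<sigma>_inj[of l z]
      by (cases "\<sigma> y = l + 1"; cases "\<sigma> z = l + 1") (simp_all add: rho_core_eq)
  qed
  show "rho_core x = x" if "x \<notin> {1..k}"
    using \<sigma>_outside[OF that] by (simp add: rho_core_eq)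
qed

lemma rho'_core:
  "x \<in> {1..k} - {l + 1} \<Longrightarrow> rho'_core x \<in> {1..k} - {l + 1}"
  "inj_on rho'_core ({1..k} - {l + 1})" "x \<notin> {1..k} \<Longrightarrow> rho'_core x = x"
proof -
  show "rho'_core x \<in> {1..k} - {l + 1}" if x: "x \<in> {1..k} - {l + 1}"
  proof (cases "\<sigma> x = l + 1")
    case True
    then show ?thesis
      using lV(2) by (simp add: rho'_core_eq)
  next
    case False
    moreover have "\<sigma> x \<in> {1..k}"
      using x \<sigma>_facts(5)[of x] by blast
    ultimately show ?thesis
      by (simp add: rho'_core_eq)
  qed
  show "inj_on rho'_core ({1..k} - {l + 1})"
  proof (rule inj_onI)
    fix y z assume yz: "y \<in> {1..k} - {l + 1}" "z \<in> {1..k} - {l + 1}" "rho'_core y = rho'_core z"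
    have "\<sigma> y \<noteq> l" "\<sigma> z \<noteq> l"
      using yz(1,2) \<sigma>_facts(2)[of y] \<sigma>_facts(2)[of z] by blast+
    then show "y = z"
      using yz(3) \<sigma>_inj[of y z]
      by (cases "\<sigma> y = l + 1"; cases "\<sigma> z = l + 1") (simp_all add: rho'_core_eq)
  qed
  show "rho'_core x = x" if "x \<notin> {1..k}"
    using \<sigma>_outside[OF that] by (simp add: rho'_core_eq)
qed

lemma rho_perm_eq: "rho_perm l \<sigma> = squeeze l 2 \<circ> rho_core \<circ> unsqueeze l 2"
  by (simp add: rho_perm_def rho_core_def[abs_def])

lemma rho'_perm_eq: "rho'_perm l \<sigma> = squeeze (l + 1) 1 \<circ> rho'_core \<circ> unsqueeze (l + 1) 1"
  by (simp add: rho'_perm_def rho'_core_def[abs_def])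

lemma rho_perm_permutes: "rho_perm l \<sigma> permutes {1..k - 2}"
  unfolding rho_perm_eq
  by (rule squeeze_conj_permutes[OF delete_range2(1) l(1) delete_range2(2)]) (use rho_core in auto)

lemma rho'_perm_permutes: "rho'_perm l \<sigma> permutes {1..k - 1}"
  unfolding rho'_perm_eq
  by (rule squeeze_conj_permutes[OF delete_range]) (use rho'_core in auto)

text \<open>After merging, the edge from \<open>l + 1\<close> to \<open>l\<close> becomes a fixed
  point at the merged vertex. By \<open>weight_fixed_point\<close> it contributes the first Casimir
  element, and what remains is \<open>rho_perm\<close>.\<close>

lemma contracted_weight_rho_perm:
  "U_eq m n (contracted_weight m n {1..k} l \<sigma>)
    (weight m n {1..1} (std_cycle 1) * weight m n {1..k - 2} (rho_perm l \<sigma>))"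
proof -
  let ?\<pi> = "merge_perm l (\<sigma> \<circ> \<tau>)" and ?V = "{1..k} - {l + 1}"
  let ?C = "\<Sum>c\<in>{1..m + n}. mat_unit c c"
  have C: "weight m n {1..1} (std_cycle 1) = ?C"
    using weight_std_cycle[of m n 0] by simp
  have \<pi>\<tau>: "\<sigma> \<circ> \<tau> permutes {1..k}"
    by (intro permutes_compose \<sigma> \<tau>_permutes)
  have \<pi>ne: "(\<sigma> \<circ> \<tau>) (l + 1) \<noteq> l + 1"
    unfolding o_apply \<tau>_simps(2) by (rule ne)
  have fin: "finite ?V" and lV': "l \<in> ?V"
    using lV by auto
  have bij: "bij_betw ?\<pi> ?V ?V"
  proof -
    have "?\<pi> ` ?V \<subseteq> ?V"
      by (rule image_subsetI) (rule merge_perm_closed(1)[OF \<pi>\<tau> \<pi>ne])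
    from endo_inj_surj[OF fin this merge_perm_closed(2)[OF \<pi>\<tau> \<pi>ne]] show ?thesis
      by (rule bij_betw_imageI[OF merge_perm_closed(2)[OF \<pi>\<tau> \<pi>ne]])
  qed
  have fixed: "?\<pi> l = l"
    by (simp only: merge_perm_def o_apply \<tau>_simps ret) simp
  have central: "U_eq m n (p * ?C) (?C * p)" if "p \<in> carrier (T_gl m n)" for p
    using U_central_weight_std_cycle[of 1 m n] that unfolding C U_central_def by simp
  have core: "?\<pi> x = rho_core x" if "x \<in> ?V - {l}" for x
  proof -
    have "\<tau> x = x"
      using that by (intro \<tau>_simps) auto
    then have "?\<pi> x = (if \<sigma> x = l + 1 then \<sigma> l else \<sigma> x)"
      by (simp only: merge_perm_def o_apply \<tau>_simps)
    then show ?thesis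
      by (simp only: rho_core_def \<sigma>_facts(7))
  qed
  have "contracted_weight m n {1..k} l \<sigma> = weight m n ?V ?\<pi>"
    unfolding \<tau>_def by (rule contracted_weight_merge[OF lV permutes_imp_bij[OF \<sigma>] ne])
  also have "U_eq m n \<dots> (?C * weight m n (?V - {l}) ?\<pi>)"
    by (rule weight_fixed_point[OF fin lV' bij fixed central])
  also have "weight m n (?V - {l}) ?\<pi> = weight m n (?V - {l}) rho_core"
    by (rule weight_cong) (use fin core rho_core in auto)
  also have "\<dots> = weight m n {1..k - 2} (rho_perm l \<sigma>)"
    unfolding rho_perm_eq
    by (rule weight_squeeze[OF delete_range2(1) l(1) delete_range2(2), symmetric]) (rule rho_core)
  finally show ?thesis
    unfolding C .
qed

text \<open>In the conjugate permutation the returning edge runs from \<open>l\<close> to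
  \<open>l + 1\<close>, so the contraction pairs the tail and the head of one and the same edge and
  yields the supertrace.\<close>

lemma contracted_weight_rho'_perm:
  "contracted_weight m n {1..k} l \<sigma>' =
    tensor_const (of_nat m - of_nat n) * weight m n {1..k - 1} (rho'_perm l \<sigma>)"
proof -
  let ?V = "{1..k} - {l + 1}"
  have loop: "\<sigma>' l = l + 1"
    unfolding \<sigma>'_def by (simp only: o_apply \<tau>_simps ret)
  have core: "(\<sigma>' \<circ> \<tau>) x = rho'_core x" if "x \<in> ?V" for x
  proof -
    have x: "x \<noteq> l + 1"
      using that by simp
    have "(\<sigma>' \<circ> \<tau>) x = \<tau> (\<sigma> x)"
      unfolding \<sigma>'_def by (simp only: o_apply \<tau>_simps)
    also have "\<dots> = rho'_core x"
    proof (cases "\<sigma> x = l + 1")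
      case True
      then show ?thesis
        using \<sigma>_facts(7)[of x] by (simp add: rho'_core_def \<tau>_simps(2)[unfolded Suc_eq_plus1[symmetric]])
    next
      case False
      then have "\<tau> (\<sigma> x) = \<sigma> x"
        using x \<sigma>_facts(2)[of x] by (intro \<tau>_simps) auto
      then show ?thesis
        using False \<sigma>_facts(7)[of x] by (simp add: rho'_core_def)
    qed
    finally show ?thesis .
  qed
  have "contracted_weight m n {1..k} l \<sigma>' = (of_nat m - of_nat n) * weight m n ?V (\<sigma>' \<circ> \<tau>)"
    unfolding \<tau>_def by (rule contracted_weight_loop[OF lV permutes_imp_bij[OF \<sigma>'_permutes] loop])
  also have "weight m n ?V (\<sigma>' \<circ> \<tau>) = weight m n ?V rho'_core"
    by (rule weight_cong) (use core rho'_core(1) in auto)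
  also have "\<dots> = weight m n {1..k - 1} (rho'_perm l \<sigma>)"
    unfolding rho'_perm_eq by (rule weight_squeeze[OF delete_range, symmetric]) (rule rho'_core)
  finally show ?thesis
    by (simp add: tensor_const_hom tensor_const_of_nat)
qed

end

end

section \<open>Comparison with the universal weight system\<close>

text \<open>The transposition of \<open>a\<close> and \<open>b + 1\<close> is the one of
  \<open>a\<close> and \<open>b\<close> conjugated by the adjacent one of \<open>b\<close> and
  \<open>b + 1\<close>; induction on the distance reduces every transposition to adjacent
  ones.\<close>

lemma transpose_conj_invariant:
  fixes k :: nat
  assumes adj: "\<And>l \<sigma>. \<sigma> permutes {1..k} \<Longrightarrow> 1 \<le> l \<Longrightarrow> l < k \<Longrightarrow> Q \<sigma> \<Longrightarrow>
      Q (transpose l (l + 1) \<circ> \<sigma> \<circ> transpose l (l + 1))"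
    and "1 \<le> a" "a + d + 1 \<le> k" "\<sigma> permutes {1..k}" "Q \<sigma>"
  shows "Q (transpose a (a + d + 1) \<circ> \<sigma> \<circ> transpose a (a + d + 1))"
  using assms(3-5)
proof (induction d arbitrary: \<sigma>)
  case 0
  then have "Q (transpose a (a + 1) \<circ> \<sigma> \<circ> transpose a (a + 1))"
    using assms(2) by (intro adj) auto
  then show ?case
    by (simp only: add_0_right)
next
  case (Suc d)
  let ?b = "a + d + 1"
  let ?t = "transpose ?b (?b + 1)" and ?u = "transpose a ?b"
  have conj: "transpose a (?b + 1) = ?t \<circ> ?u \<circ> ?t"
    by (auto simp: fun_eq_iff transpose_def)
  have b: "1 \<le> ?b" "?b < k" "?b \<in> {1..k}" "?b + 1 \<in> {1..k}" "a \<in> {1..k}"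
    using Suc.prems(1) assms(2) by auto
  let ?\<sigma>1 = "?t \<circ> \<sigma> \<circ> ?t"
  let ?\<sigma>2 = "?u \<circ> ?\<sigma>1 \<circ> ?u"
  have p1: "?\<sigma>1 permutes {1..k}"
    by (intro permutes_transpose_conj Suc.prems b)
  have p2: "?\<sigma>2 permutes {1..k}"
    by (intro permutes_transpose_conj p1 b)
  have q1: "Q ?\<sigma>1"
    by (intro adj Suc.prems b)
  have "Q ?\<sigma>2"
    by (rule Suc.IH[OF less_imp_le[OF b(2)] p1 q1])
  then have "Q (?t \<circ> ?\<sigma>2 \<circ> ?t)"
    by (intro adj p2 b)
  also have "?t \<circ> ?\<sigma>2 \<circ> ?t = transpose a (?b + 1) \<circ> \<sigma> \<circ> transpose a (?b + 1)"
    unfolding conj by (simp only: comp_assoc)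
  finally show ?case
    by simp
qed

text \<open>
  Conjugating by transpositions, the cycle through \<open>1\<close> can be moved to the initial vertices step
  by step, so every conjugation class contains a concatenation with a standard cycle.
\<close>

lemma permutes_conj_induct:
  fixes k :: nat
  assumes adj: "\<And>l \<sigma>. \<sigma> permutes {1..k} \<Longrightarrow> 1 \<le> l \<Longrightarrow> l < k \<Longrightarrow> Q \<sigma> \<Longrightarrow>
      Q (transpose l (l + 1) \<circ> \<sigma> \<circ> transpose l (l + 1))"
    and cycle: "\<And>j \<rho>. 1 \<le> j \<Longrightarrow> j \<le> k \<Longrightarrow> \<rho> permutes {1..k - j} \<Longrightarrow> Q (perm_concat j (std_cycle j) \<rho>)"
    and "\<sigma> permutes {1..k}" "1 \<le> j" "j \<le> k" "\<And>x. 1 \<le> x \<Longrightarrow> x < j \<Longrightarrow> \<sigma> x = x + 1"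
  shows "Q \<sigma>"
  using assms(3-6)
proof (induction "k - j" arbitrary: j \<sigma> rule: less_induct)
  case (less j \<sigma>)
  note \<sigma> = less.prems(1) and j = less.prems(2,3) and step = less.prems(4)
  have inj: "\<sigma> y = \<sigma> z \<longleftrightarrow> y = z" for y z
    using permutes_inj[OF \<sigma>] by (simp add: inj_eq)
  have \<sigma>j: "\<sigma> j \<in> {1..k}"
    using permutes_in_image[OF \<sigma>, of j] j by simp
  show ?case
  proof (cases "\<sigma> j = 1")
    case True
    define \<rho> where "\<rho> = (\<lambda>x. if x = 0 then 0 else \<sigma> (j + x) - j)"
    have small: "\<sigma> x \<in> {1..j}" if "x \<in> {1..j}" for x
      using that step[of x] True j by (cases "x = j") auto
    have image: "\<sigma> ` {1..j} = {1..j}"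
      using small permutes_inj[OF \<sigma>] by (intro endo_inj_surj) (auto intro: inj_on_subset)
    have large: "\<sigma> x > j" if "x > j" for x
    proof (rule ccontr)
      assume "\<not> \<sigma> x > j"
      moreover have "\<sigma> x \<noteq> 0"
        using that inj[of x 0] permutes_not_in[OF \<sigma>, of 0] by auto
      ultimately have "\<sigma> x \<in> \<sigma> ` {1..j}"
        unfolding image by simp
      then show False
        using that inj by auto
    qed
    have "\<rho> permutes {1..k - j}"
    proof (rule finite_endo_permutes)
      show "\<rho> x \<in> {1..k - j}" if "x \<in> {1..k - j}" for x
        using that large[of "j + x"] permutes_in_image[OF \<sigma>, of "j + x"] by (auto simp: \<rho>_def)
      show "\<rho> x = x" if "x \<notin> {1..k - j}" for x
        using that permutes_not_in[OF \<sigma>, of "j + x"] by (auto simp: \<rho>_def)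
      show "inj_on \<rho> {1..k - j}"
      proof (rule inj_onI)
        fix y z assume yz: "y \<in> {1..k - j}" "z \<in> {1..k - j}" "\<rho> y = \<rho> z"
        then have "\<sigma> (j + y) = \<sigma> (j + z)"
          using large[of "j + y"] large[of "j + z"] by (simp add: \<rho>_def)
        then show "y = z"
          by (simp add: inj)
      qed
    qed simp
    then have "Q (perm_concat j (std_cycle j) \<rho>)"
      by (rule cycle[OF j])
    also have "perm_concat j (std_cycle j) \<rho> = \<sigma>"
    proof
      fix x
      consider "x = 0" | "1 \<le> x" "x < j" | "x = j" | "x > j"
        using j by linarith
      then show "perm_concat j (std_cycle j) \<rho> x = \<sigma> x"
      proof cases
        case 1
        then show ?thesis
          using permutes_not_in[OF \<sigma>, of 0] j by (simp add: perm_concat_def std_cycle_def)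
      next
        case 2
        then show ?thesis
          using step[of x] by (simp add: perm_concat_def std_cycle_def)
      next
        case 3
        then show ?thesis
          using True by (simp add: perm_concat_def std_cycle_def)
      next
        case 4
        then show ?thesis
          using large[OF 4] by (simp add: perm_concat_def \<rho>_def)
      qed
    qed
    finally show ?thesis .
  next
    case False
    \<comment> \<open>The values from 2 to \<open>j\<close> are already images of earlier vertices,
      and the value 1 is excluded in this case.\<close>
    have "\<sigma> j > j"
    proof (rule ccontr)
      assume "\<not> \<sigma> j > j"
      then have "\<sigma> (\<sigma> j - 1) = \<sigma> j" "\<sigma> j - 1 < j"
        using step[of "\<sigma> j - 1"] \<sigma>j False by auto
      then show False
        using inj by auto
    qed
    then have jk: "j + 1 \<le> k"
      using \<sigma>j by simp
    \<comment> \<open>This conjugation renames \<open>\<sigma> j\<close> to \<open>j + 1\<close> and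
      fixes the vertices up to \<open>j\<close>, so the ordered initial path grows by one vertex.
      The property is proved for the conjugate and carried back by the same conjugation.\<close>
    let ?t = "transpose (j + 1) (\<sigma> j)"
    let ?\<sigma>' = "?t \<circ> \<sigma> \<circ> ?t"
    have mem: "j + 1 \<in> {1..k}"
      using jk by simp
    have p': "?\<sigma>' permutes {1..k}"
      by (intro permutes_transpose_conj \<sigma> mem \<sigma>j)
    have "?\<sigma>' x = x + 1" if "1 \<le> x" "x < j + 1" for x
    proof (cases "x = j")
      case True
      then show ?thesis
        using \<open>\<sigma> j > j\<close> by (simp add: transpose_def)
    next
      case False
      then show ?thesis
        using that step[of x] \<open>\<sigma> j > j\<close> by (simp add: transpose_def)
    qed
    then have Q': "Q ?\<sigma>'"
      using jk j p' by (intro less.hyps[of "j + 1" ?\<sigma>']) auto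
    show ?thesis
    proof (cases "\<sigma> j = j + 1")
      case True
      then show ?thesis
        using Q' by simp
    next
      case False
      then obtain d where d: "\<sigma> j = j + 1 + d + 1"
        using \<open>\<sigma> j > j\<close> less_imp_Suc_add[of "j + 1" "\<sigma> j"] by auto
      have "Q (transpose (j + 1) (j + 1 + d + 1) \<circ> ?\<sigma>' \<circ> transpose (j + 1) (j + 1 + d + 1))"
      proof (rule transpose_conj_invariant[of k Q])
        show "j + 1 + d + 1 \<le> k"
          using \<sigma>j d by simp
      qed (use adj p' Q' in \<open>simp_all only: le_add2\<close>)
      then have "Q (?t \<circ> ?\<sigma>' \<circ> ?t)"
        by (simp only: d[symmetric])
      also have "?t \<circ> ?\<sigma>' \<circ> ?t = \<sigma>"
        by (simp add: fun_eq_iff)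
      finally show ?thesis .
    qed
  qed
qed

text \<open>Membership in the carrier is part of the notion, because equality of cosets amounts to
  \<open>U_eq\<close> only for such representatives.\<close>

definition represents ::
    "nat \<Rightarrow> nat \<Rightarrow> (cpoly \<Rightarrow> (nat \<times> nat) tensor set) \<Rightarrow> (nat \<times> nat) tensor \<Rightarrow> cpoly \<Rightarrow> bool"
  where "represents m n \<Phi> p x \<longleftrightarrow> p \<in> carrier (T_gl m n) \<and> U_proj m n p = \<Phi> x"

lemma represents_rules:
  assumes \<Phi>: "casimir_substitution m n \<Phi>"
  defines "rep \<equiv> represents m n \<Phi>"
  shows "rep 1 1"
    and "rep p x \<Longrightarrow> rep q y \<Longrightarrow> rep (p * q) (x * y)"
    and "rep p x \<Longrightarrow> rep q y \<Longrightarrow> rep (p + q) (x + y)"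
    and "rep p x \<Longrightarrow> rep q y \<Longrightarrow> rep (p - q) (x - y)"
    and "rep (tensor_const (of_nat m - of_nat n)) (C_var 0)"
    and "j \<ge> 1 \<Longrightarrow> rep (weight m n {1..j} (std_cycle j)) (C_var j)"
    and "rep p x \<Longrightarrow> U_eq m n p q \<Longrightarrow> q \<in> carrier (T_gl m n) \<Longrightarrow> rep q x"
proof -
  have hom: "\<Phi> \<in> ring_hom class_ring (ZU_gl m n)"
    and const: "\<And>c. \<Phi> (poly_const c) = U_proj m n (tensor_const c)"
    and var: "\<Phi> (C_var 0) = U_proj m n (tensor_const (of_nat m - of_nat n))"
      "\<And>j. j \<ge> 1 \<Longrightarrow> \<Phi> (C_var j) = casimir m n j"
    using \<Phi> by (simp_all add: casimir_substitution_def)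
  show one: "rep 1 1"
    using ring_hom_one[OF hom] by (simp add: rep_def represents_def U_proj_1)
  show mult: "rep (p * q) (x * y)" if "rep p x" "rep q y" for p q x y
    using that ring_hom_mult[OF hom, of x y] by (simp add: rep_def represents_def U_proj_hom)
  show plus: "rep (p + q) (x + y)" if "rep p x" "rep q y" for p q x y
    using that ring_hom_add[OF hom, of x y] by (simp add: rep_def represents_def U_proj_hom)
  \<comment> \<open>Subtraction is reduced to sums and products by means of the constant -1, for
    which the value of \<Phi> is prescribed.\<close>
  have "rep (tensor_const (-1)) (poly_const (-1))"
    using const by (simp add: rep_def represents_def)
  moreover have "tensor_const (-1) * q = - q" for q :: "(nat \<times> nat) tensor"
  proof -
    have "tensor_const (-1) = (-1 :: (nat \<times> nat) tensor)"
      by (simp add: tensor_const_def single_uminus)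
    then show ?thesis
      by simp
  qed
  moreover have "poly_const (-1) * y = - y" for y
    by (simp add: poly_const_def single_uminus)
  ultimately have "rep (- q) (- y)" if "rep q y" for q y
    using mult[OF _ that, of "tensor_const (-1)" "poly_const (-1)"] by simp
  then show "rep (p - q) (x - y)" if "rep p x" "rep q y" for p q x y
    using plus[of p x "- q" "- y"] that by simp
  show "rep (tensor_const (of_nat m - of_nat n)) (C_var 0)"
    using var(1) by (simp add: rep_def represents_def)
  show "rep (weight m n {1..j} (std_cycle j)) (C_var j)" if "j \<ge> 1" for j
    unfolding rep_def represents_def var(2)[OF that] casimir_eq_weight[OF that]
    by (intro conjI weight_carrier std_cycle_image refl) simp
  show "rep q x" if "rep p x" "U_eq m n p q" "q \<in> carrier (T_gl m n)" for p q x
    using that U_proj_eq_iff[of p m n q] by (simp add: rep_def represents_def)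
qed

section \<open>Induction on the number of vertices\<close>

lemma weight_range_carrier: "\<sigma> permutes {1..k} \<Longrightarrow> weight m n {1..k} \<sigma> \<in> carrier (T_gl m n)"
  by (rule weight_carrier) (simp_all add: permutes_image)

text \<open>Strong induction on \<open>k\<close>. By the induction hypothesis the differences
  \<open>w k \<sigma> - w k \<sigma>'\<close> are represented correctly, so for fixed
  \<open>k\<close> the claim is invariant under adjacent conjugation; concatenations with a standard
  cycle start this inner induction.\<close>

lemma weight_eq_casimir_substitution:
  assumes \<Phi>: "casimir_substitution m n \<Phi>" and w: "universal_gl_weight_system w"
    and "\<sigma> permutes {1..k}"
  shows "U_proj m n (weight m n {1..k} \<sigma>) = \<Phi> (w k \<sigma>)"
proof -
  define rep where "rep = represents m n \<Phi>"
  note rep = represents_rules[OF \<Phi>, folded rep_def]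
  have w_empty: "\<And>\<sigma>. \<sigma> permutes {1..0} \<Longrightarrow> w 0 \<sigma> = 1"
    and w_concat: "\<And>k j \<sigma> \<rho>. \<sigma> permutes {1..k} \<Longrightarrow> \<rho> permutes {1..j} \<Longrightarrow>
      w (k + j) (perm_concat k \<sigma> \<rho>) = w k \<sigma> * w j \<rho>"
    and w_cycle: "\<And>k. k \<ge> 1 \<Longrightarrow> w k (std_cycle k) = C_var k"
    using w unfolding universal_gl_weight_system_def by blast+
  have w_rec: "(\<sigma> l \<noteq> l + 1 \<and> \<sigma> (l + 1) \<noteq> l \<longrightarrow> w k \<sigma> - w k (\<tau> \<circ> \<sigma> \<circ> \<tau>) =
        w (k - 1) (D_perm l (\<sigma> \<circ> \<tau>)) - w (k - 1) (D_perm l (\<tau> \<circ> \<sigma> \<circ> \<tau> \<circ> \<tau>))) \<and>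
      (\<sigma> (l + 1) = l \<and> \<sigma> l \<noteq> l + 1 \<longrightarrow> w k \<sigma> - w k (\<tau> \<circ> \<sigma> \<circ> \<tau>) =
        C_var 1 * w (k - 2) (rho_perm l \<sigma>) - C_var 0 * w (k - 1) (rho'_perm l \<sigma>))"
    if "\<sigma> permutes {1..k}" "1 \<le> l" "l < k" "\<tau> = transpose l (l + 1)" for k l \<sigma> \<tau>
    using w that unfolding universal_gl_weight_system_def Let_def by blast
  define P where "P = (\<lambda>k \<sigma>. rep (weight m n {1..k} \<sigma>) (w k \<sigma>))"
  have "P k \<sigma>" if "\<sigma> permutes {1..k}" for k \<sigma>
    using that
  proof (induction k arbitrary: \<sigma> rule: less_induct)
    case (less k)
    have diff: "rep (weight m n {1..k} \<sigma> - weight m n {1..k} (\<tau> \<circ> \<sigma> \<circ> \<tau>)) (w k \<sigma> - w k (\<tau> \<circ> \<sigma> \<circ> \<tau>))"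
      if \<sigma>: "\<sigma> permutes {1..k}" and l: "1 \<le> l" "l < k" and \<tau>: "\<tau> = transpose l (l + 1)"
        and ne: "\<sigma> l \<noteq> l + 1" for l \<sigma> \<tau>
    proof -
      let ?\<sigma>' = "\<tau> \<circ> \<sigma> \<circ> \<tau>"
      have \<sigma>': "?\<sigma>' permutes {1..k}"
        unfolding \<tau> by (rule \<sigma>'_permutes[OF \<sigma> l])
      have closed: "weight m n {1..k} \<sigma> - weight m n {1..k} ?\<sigma>' \<in> carrier (T_gl m n)"
        by (intro tensor_carrier_diff weight_range_carrier \<sigma> \<sigma>')
      have swap: "U_eq m n (weight m n {1..k} \<sigma> - weight m n {1..k} ?\<sigma>')
          (contracted_weight m n {1..k} l \<sigma> - contracted_weight m n {1..k} l ?\<sigma>')"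
        unfolding \<tau> by (rule weight_swap_range[OF \<sigma> l])
      have IH: "P j \<rho>" if "\<rho> permutes {1..j}" "j < k" for j \<rho>
        using less.IH that by blast
      show ?thesis
      proof (cases "\<sigma> (l + 1) = l")
        case False
        \<comment> \<open>The conjugate sends \<open>l\<close> to \<open>l + 1\<close> exactly when
          \<open>\<sigma>\<close> sends \<open>l + 1\<close> to \<open>l\<close>, so both
          permutations are in the merging case.\<close>
        have ne': "?\<sigma>' l \<noteq> l + 1"
          using False unfolding \<tau> by (auto simp: transpose_def)
        have c1: "contracted_weight m n {1..k} l \<sigma> = weight m n {1..k - 1} (D_perm l (\<sigma> \<circ> \<tau>))"
          unfolding \<tau> by (rule contracted_weight_D_perm[OF \<sigma> l ne])
        have c2: "contracted_weight m n {1..k} l ?\<sigma>' = weight m n {1..k - 1} (D_perm l (?\<sigma>' \<circ> \<tau>))"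
          unfolding \<tau> by (rule contracted_weight_D_perm[OF \<sigma>'[unfolded \<tau>] l ne'[unfolded \<tau>]])
        have "P (k - 1) (D_perm l (\<sigma> \<circ> \<tau>))"
          by (rule IH[OF D_perm_permutes[OF \<sigma> l ne, folded \<tau>]]) (use l in simp)
        moreover have "P (k - 1) (D_perm l (?\<sigma>' \<circ> \<tau>))"
          by (rule IH[OF D_perm_permutes[OF \<sigma>' l ne', folded \<tau>]]) (use l in simp)
        ultimately have "rep (contracted_weight m n {1..k} l \<sigma> - contracted_weight m n {1..k} l ?\<sigma>')
            (w (k - 1) (D_perm l (\<sigma> \<circ> \<tau>)) - w (k - 1) (D_perm l (?\<sigma>' \<circ> \<tau>)))"
          unfolding c1 c2 P_def by (rule rep(4))
        also have "w (k - 1) (D_perm l (\<sigma> \<circ> \<tau>)) - w (k - 1) (D_perm l (?\<sigma>' \<circ> \<tau>)) = w k \<sigma> - w k ?\<sigma>'"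
          using w_rec[OF \<sigma> l \<tau>] ne False by simp
        finally show ?thesis
          by (rule rep(7)[OF _ U_eq_sym[OF swap] closed])
      next
        case True
        have "P (k - 2) (rho_perm l \<sigma>)"
          using rho_perm_permutes[OF \<sigma> l True ne] l by (auto intro!: IH)
        moreover have "P (k - 1) (rho'_perm l \<sigma>)"
          using rho'_perm_permutes[OF \<sigma> l True ne] l by (auto intro!: IH)
        ultimately have "rep (weight m n {1..1} (std_cycle 1) * weight m n {1..k - 2} (rho_perm l \<sigma>)
              - tensor_const (of_nat m - of_nat n) * weight m n {1..k - 1} (rho'_perm l \<sigma>))
            (C_var 1 * w (k - 2) (rho_perm l \<sigma>) - C_var 0 * w (k - 1) (rho'_perm l \<sigma>))"
          unfolding P_def by (intro rep(2,4,5,6)) auto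
        also have "C_var 1 * w (k - 2) (rho_perm l \<sigma>) - C_var 0 * w (k - 1) (rho'_perm l \<sigma>) = w k \<sigma> - w k ?\<sigma>'"
          using w_rec[OF \<sigma> l \<tau>] ne True by simp
        finally have r: "rep (weight m n {1..1} (std_cycle 1) * weight m n {1..k - 2} (rho_perm l \<sigma>)
            - tensor_const (of_nat m - of_nat n) * weight m n {1..k - 1} (rho'_perm l \<sigma>)) (w k \<sigma> - w k ?\<sigma>')" .
        have "U_eq m n (contracted_weight m n {1..k} l \<sigma> - contracted_weight m n {1..k} l ?\<sigma>')
            (weight m n {1..1} (std_cycle 1) * weight m n {1..k - 2} (rho_perm l \<sigma>)
            - tensor_const (of_nat m - of_nat n) * weight m n {1..k - 1} (rho'_perm l \<sigma>))"
          unfolding \<tau> contracted_weight_rho'_perm[OF \<sigma> l True ne]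
          by (intro U_eq_diff U_eq_refl contracted_weight_rho_perm[OF \<sigma> l True ne])
        from U_eq_sym[OF U_eq_trans[OF swap this]] show ?thesis
          by (rule rep(7)[OF r _ closed])
      qed
    qed
    have adj: "P k (transpose l (l + 1) \<circ> \<sigma> \<circ> transpose l (l + 1))"
      if \<sigma>: "\<sigma> permutes {1..k}" and l: "1 \<le> l" "l < k" and P: "P k \<sigma>" for l \<sigma>
    proof -
      define \<tau> where "\<tau> = transpose l (l + 1)"
      let ?\<sigma>' = "\<tau> \<circ> \<sigma> \<circ> \<tau>"
      have \<sigma>': "?\<sigma>' permutes {1..k}"
        unfolding \<tau>_def by (rule \<sigma>'_permutes[OF \<sigma> l])
      have \<sigma>'': "\<tau> \<circ> ?\<sigma>' \<circ> \<tau> = \<sigma>"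
        by (simp add: \<tau>_def fun_eq_iff)
      \<comment> \<open>The second alternative means that \<open>\<sigma> (l + 1)\<close> is not
        \<open>l\<close>; there the recurrence is used for the conjugate, which covers the mirror
        image of the exceptional rule. If both fail, \<open>\<sigma>\<close> exchanges
        \<open>l\<close> and \<open>l + 1\<close> and equals its conjugate.\<close>
      consider "\<sigma> l \<noteq> l + 1" | "?\<sigma>' l \<noteq> l + 1" | "\<sigma> l = l + 1" "\<sigma> (l + 1) = l"
        by (cases "\<sigma> (l + 1) = l") (auto simp: \<tau>_def transpose_def)
      then have "P k ?\<sigma>'"
      proof cases
        case 1
        have "rep (weight m n {1..k} \<sigma> - (weight m n {1..k} \<sigma> - weight m n {1..k} ?\<sigma>'))
            (w k \<sigma> - (w k \<sigma> - w k ?\<sigma>'))"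
          by (intro rep(4) diff[OF \<sigma> l \<tau>_def 1] P[unfolded P_def])
        then show ?thesis
          by (simp add: P_def)
      next
        case 2
        have "rep ((weight m n {1..k} ?\<sigma>' - weight m n {1..k} (\<tau> \<circ> ?\<sigma>' \<circ> \<tau>)) + weight m n {1..k} \<sigma>)
            ((w k ?\<sigma>' - w k (\<tau> \<circ> ?\<sigma>' \<circ> \<tau>)) + w k \<sigma>)"
          by (intro rep(3) diff[OF \<sigma>' l \<tau>_def 2] P[unfolded P_def])
        then show ?thesis
          unfolding \<sigma>'' by (simp add: P_def)
      next
        case 3
        have "?\<sigma>' x = \<sigma> x" for x
        proof -
          have "\<sigma> x = l \<longleftrightarrow> x = l + 1" "\<sigma> x = l + 1 \<longleftrightarrow> x = l"
            using 3 permutes_inj[OF \<sigma>] by (metis injD)+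
          then show ?thesis
            using 3 by (auto simp: \<tau>_def transpose_def)
        qed
        then have "?\<sigma>' = \<sigma>"
          by (rule ext)
        then show ?thesis
          using P by (simp only:)
      qed
      then show ?thesis
        by (simp only: \<tau>_def)
    qed
    have concat: "P k (perm_concat j (std_cycle j) \<rho>)"
      if j: "1 \<le> j" "j \<le> k" and \<rho>: "\<rho> permutes {1..k - j}" for j \<rho>
    proof -
      have cyc: "std_cycle j permutes {1..j}"
        using j(1) by (intro finite_endo_permutes) (auto simp: std_cycle_def inj_on_def)
      have "P (k - j) \<rho>"
        using j \<rho> by (intro less.IH) auto
      then have "rep (weight m n {1..j} (std_cycle j) * weight m n {1..k - j} \<rho>) (C_var j * w (k - j) \<rho>)"
        unfolding P_def by (intro rep(2) rep(6) j)
      also have "weight m n {1..j} (std_cycle j) * weight m n {1..k - j} \<rho> =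
          weight m n {1..j + (k - j)} (perm_concat j (std_cycle j) \<rho>)"
        by (rule weight_concat[symmetric]) (simp_all only: permutes_image[OF cyc] permutes_image[OF \<rho>] order_refl)
      also have "C_var j * w (k - j) \<rho> = w (j + (k - j)) (perm_concat j (std_cycle j) \<rho>)"
        unfolding w_concat[OF cyc \<rho>] w_cycle[OF j(1)] ..
      finally show ?thesis
        using j by (simp add: P_def)
    qed
    show ?case
    proof (cases "k = 0")
      case True
      have "weight m n {1..0} \<sigma> = 1"
        by (simp add: weight_def perm_sign_def koszul_def)
      moreover have "w 0 \<sigma> = 1"
        using less.prems True by (intro w_empty) simp
      ultimately show ?thesis
        using rep(1) by (simp only: P_def True)
    next
      case False
      then show ?thesis
        \<comment> \<open>The start \<open>j = 1\<close> imposes no condition on an initial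
          path.\<close>
        using permutes_conj_induct[of k "P k" \<sigma> 1] adj concat less.prems by simp
    qed
  qed
  then show ?thesis
    using assms(3) by (simp add: P_def rep_def represents_def)
qed

text \<open>Unique existence of \<Phi> is part of the conclusion, so the statement about all \<Phi>
  is not vacuous and concerns one definite homomorphism.\<close>

theorem mainTheorem1:
  fixes m n :: nat
    and w_gl :: "nat \<Rightarrow> (nat \<Rightarrow> nat) \<Rightarrow> cpoly"
  assumes "m + n \<ge> 1"
    and "universal_gl_weight_system w_gl"
  shows "(\<exists>!\<Phi>. casimir_substitution m n \<Phi>) \<and>
    (\<forall>\<Phi>. casimir_substitution m n \<Phi> \<longrightarrow>
      (\<forall>k \<sigma>. \<sigma> permutes {1..k} \<longrightarrow> w_super m n k \<sigma> = \<Phi> (w_gl k \<sigma>)))"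
  using casimir_substitution_unique_existence weight_eq_casimir_substitution[OF _ assms(2)]
  by (simp add: w_super_eq_weight)

end
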